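(* For each $q,p\in\mathbb{N}$, $\vec r\in\mathbb{N}^p_{\mathrm{ord}}$, $\vec a\in\mathbb{R}_+^p$, $\sigma\in\{0,1\}$, $T>0$, $x_0\in\mathbb{R}$ and $\delta\in(0,\tfrac12)$, there exist Schwartz class solutions $u:\mathbb{R}\times[0,T)\to\mathbb{R}$ of the Boussinesq equation $u_{tt}=u_{xx}+(u^2)_{xx}+u_{xxxx}$ on $\mathbb{R}\times[0,T)$ such that: (i) for each $q_1,q_2\in\mathbb{N}$ with $q_1+2q_2\le q$, $\sup_{(x,t)\in\mathbb{R}\times[0,T)}\big|\partial_x^{q_1}\partial_t^{q_2}u(x,t)\big|<\infty$ and $\partial_x^{q_1}\partial_t^{q_2}u$ can be continuously extended to $\mathbb{R}\times[0,T]$; (ii) for each $q_1,q_2\in\mathbb{N}$ with $q_1+2q_2=q+1$, $$(-1)^{\lceil q_1/2\rceil}\,\partial_x^{q_1}\partial_t^{q_2}u(x_0,t)\asymp\frac{\mathrm{LOG}\big(\tfrac1{T-t};\vec r,\vec a,\sigma\big)}{(T-t)^{\delta}}\quad\text{as }t\to T,$$ and $$\big|\partial_x^{q_1}\partial_t^{q_2}u(x,t)\big|\le C\,\frac{1+|x|}{|x-x_0|},\qquad x\in\mathbb{R}\setminus\{x_0\},\ t\in[0,T),$$ for some constant $C>0$.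
   Context: $\mathbb{N}=\{0,1,2,\dots\}$, $\mathbb{N}_{>0}=\{1,2,\dots\}$, $\mathbb{R}_+=[0,+\infty)$, and $\mathbb{N}^p_{\mathrm{ord}}=\{(r_1,\dots,r_p)\in(\mathbb{N}_{>0})^p: r_1<r_2<\dots<r_p\}$. For $r\in\mathbb{N}_{>0}$, $\log_r$ denotes the $r$-th iterate of the logarithm. Define $\mathrm{LOG}(s;\vec r,\vec a,\sigma)=(-1)^\sigma\prod_{j=1}^p(\log_{r_j}s)^{a_j}$, with $\mathrm{LOG}\equiv(-1)^\sigma$ if $p=0$. For real functions $f,g$ defined for $t<T$ close to $T$, $f(t)\asymp g(t)$ as $t\to T$ means there exist $T_0\in(0,T)$ and $c_1,c_2>0$ with $c_1 g(t)\le f(t)\le c_2 g(t)$ for all $t\in[T_0,T)$. For $T\in(0,\infty]$, $u$ is a Schwartz class solution of the Boussinesq equation on $\mathbb{R}\times[0,T)$ if $u$ is a smooth real-valued solution of $u_{tt}=u_{xx}+(u^2)_{xx}+u_{xxxx}$ on $\mathbb{R}\times[0,T)$ and for each integer $N\ge1$ and each $\tau\in[0,T)$, $\sup_{x\in\mathbb{R},t\in[0,\tau]}\sum_{i=0}^N(1+|x|)^N|\partial_x^i u(x,t)|<\infty$. *)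

theory Defs
  imports "HOL-Analysis.Analysis"
begin

definition dom_T :: "real \<Rightarrow> (real \<times> real) set" where
  "dom_T T = UNIV \<times> {0..<T}"

definition px :: "(real \<times> real \<Rightarrow> real) \<Rightarrow> real \<times> real \<Rightarrow> real" where
  "px u = (\<lambda>(x,t). vector_derivative (\<lambda>y. u (y,t)) (at x))"

definition pt :: "real \<Rightarrow> (real \<times> real \<Rightarrow> real) \<Rightarrow> real \<times> real \<Rightarrow> real" where
  "pt T u = (\<lambda>(x,t). vector_derivative (\<lambda>s. u (x,s)) (at t within {0..<T}))"

fun pd :: "real \<Rightarrow> bool list \<Rightarrow> (real \<times> real \<Rightarrow> real) \<Rightarrow> real \<times> real \<Rightarrow> real" where
  "pd T [] u = u"
| "pd T (True # w) u = px (pd T w u)"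
| "pd T (False # w) u = pt T (pd T w u)"

definition dxt :: "real \<Rightarrow> nat \<Rightarrow> nat \<Rightarrow> (real \<times> real \<Rightarrow> real) \<Rightarrow> real \<times> real \<Rightarrow> real" where
  "dxt T q1 q2 u = pd T (replicate q1 True @ replicate q2 False) u"

definition smooth_on_strip :: "real \<Rightarrow> (real \<times> real \<Rightarrow> real) \<Rightarrow> bool" where
  "smooth_on_strip T u \<longleftrightarrow>
     (\<forall>w. continuous_on (dom_T T) (pd T w u) \<and>
        (\<forall>x t. 0 \<le> t \<and> t < T \<longrightarrow>
            (\<lambda>y. pd T w u (y,t)) differentiable (at x) \<and>
            (\<lambda>s. pd T w u (x,s)) differentiable (at t within {0..<T})))"

definition schwartz_boussinesq :: "real \<Rightarrow> (real \<times> real \<Rightarrow> real) \<Rightarrow> bool" where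
  "schwartz_boussinesq T u \<longleftrightarrow>
     smooth_on_strip T u \<and>
     (\<forall>x t. 0 \<le> t \<and> t < T \<longrightarrow>
        dxt T 0 2 u (x,t) = dxt T 2 0 u (x,t) + dxt T 2 0 (\<lambda>z. (u z)\<^sup>2) (x,t) + dxt T 4 0 u (x,t)) \<and>
     (\<forall>N::nat. N \<ge> 1 \<longrightarrow> (\<forall>\<tau>. 0 \<le> \<tau> \<and> \<tau> < T \<longrightarrow>
        (\<exists>M. \<forall>x t. 0 \<le> t \<and> t \<le> \<tau> \<longrightarrow>
           (\<Sum>i\<le>N. (1 + \<bar>x\<bar>) ^ N * \<bar>dxt T i 0 u (x,t)\<bar>) \<le> M)))"

definition iter_log :: "nat \<Rightarrow> real \<Rightarrow> real" where
  "iter_log r s = (ln ^^ r) s"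

definition LOG :: "real \<Rightarrow> nat list \<Rightarrow> real list \<Rightarrow> nat \<Rightarrow> real" where
  "LOG s rs as \<sigma> = (-1) ^ \<sigma> * (\<Prod>j<length rs. (iter_log (rs ! j) s) powr (as ! j))"

definition asymp_at :: "real \<Rightarrow> (real \<Rightarrow> real) \<Rightarrow> (real \<Rightarrow> real) \<Rightarrow> bool" where
  "asymp_at T f g \<longleftrightarrow> (\<exists>T0 c1 c2. 0 < T0 \<and> T0 < T \<and> c1 > 0 \<and> c2 > 0 \<and>
      (\<forall>t. T0 \<le> t \<and> t < T \<longrightarrow> c1 * g t \<le> f t \<and> f t \<le> c2 * g t))"

end

theory Submission
  imports Defs
begin

text \<open>
The linearised equation has the growing modes \<open>exp (\<i>kx + \<lambda>t)\<close> with \<open>\<lambda>\<^sup>2 = k\<^sup>4 - k\<^sup>2\<close>, so the superposition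
\<open>\<integral> \<mu>(k) exp (\<i>kx - \<lambda>(T - t)) dk\<close> with \<open>\<mu>\<close> supported in \<open>\<bar>k\<bar> \<ge> 2\<close> is a Schwartz function for \<open>t < T\<close>, while its
regularity at \<open>t = T\<close> is dictated by the decay of \<open>\<mu>\<close>, which can be prescribed. Direct linearisation turns it into an exact solution
\<open>u = 6 \<partial>\<^sub>x\<^sup>2 log det (1 + K)\<close>, where \<open>K\<close> is the Cauchy-type operator with kernel
\<open>\<mu>(l) exp (\<dots>) / (p(k) - q(l))\<close> on the spectral curve. If \<open>\<mu>\<close> is small the Neumann series converges, and its
matrix elements form a ring that is closed under \<open>\<partial>\<^sub>x\<close> and \<open>\<partial>\<^sub>t\<close>; the Boussinesq equation becomes a polynomial
identity in this ring. Counting weights, a derivative of \<open>u\<close> of order \<open>q\<^sub>1 + 2q\<^sub>2 = q + 1\<close> is the corresponding derivative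
of the linear superposition plus a bounded remainder. At \<open>x\<^sub>0\<close> the linear part is the Laplace-type integral
\<open>\<integral> k\<^sup>2\<^sup>\<delta>\<^sup>-\<^sup>1 L(k\<^sup>2) exp (- \<lambda>(T - t)) dk\<close>, comparable to \<open>L(1/(T - t)) / (T - t)\<^sup>\<delta>\<close> for a product \<open>L\<close> of powers of iterated
logarithms, and one integration by parts in \<open>k\<close> bounds it elsewhere by \<open>C / \<bar>x - x\<^sub>0\<bar>\<close>.
\<close>

section \<open>The spectral curve\<close>

text \<open>The size of the singularity is prescribed for derivatives of order \<open>q + 1\<close>
  only, although the equation is nonlinear. A generator \<open>F i j\<close> consumes the moment of
  order i + j of the density, and derivatives of order \<open>q + 1\<close> reach i + j = q + 2. The
  density decays like k to the power 2\<delta> - q - 3, up to logarithms: its moment of order q + 1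
  is finite because \<delta> < 1/2, and the next one diverges at t = T like the wanted singularity
  because \<delta> > 0. A product of generators splits the weight, so each factor stays below the
  critical order; inside a single generator a Cauchy denominator takes one power off every term but
  the first. Two majorants of the same data are used. One is the modulus of the density, valid up to
  t = T, with moments up to q + 1: it gives the uniform bounds. The other carries exp (- la k *
  \<eta>), is valid for t \<le> T - \<eta>, and has all moments: it gives smoothness and spatial
  decay. No determinant occurs: \<open>F 0 0\<close> is formally the x-derivative of log det (1 +
  K), and only its form as a matrix element is used. The density has constant coefficients on dyadic
  blocks, so that differentiating it in k never differentiates a logarithm.\<close>

text \<open>The points \<open>p\<close> and \<open>q\<close> lie on the cubic \<open>p\<^sup>3 + p/4 = q\<^sup>3 + q/4\<close>, which reduces the KP hierarchy to the
  Boussinesq equation. With \<open>p - q = \<i>k\<close> the plane wave \<open>exp ((p - q) x - \<i> \<surd>3 (p\<^sup>2 - q\<^sup>2) t)\<close> is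
  \<open>exp (\<i>kx + la k t)\<close>, where \<open>la k\<^sup>2 = k\<^sup>4 - k\<^sup>2\<close> is the dispersion relation and \<open>la\<close> its growing branch.\<close>

definition rr :: "real \<Rightarrow> real" where "rr k = sgn k * sqrt (k\<^sup>2 - 1)"
definition pp :: "real \<Rightarrow> complex" where "pp k = of_real (rr k / (2 * sqrt 3)) + \<i> * of_real (k / 2)"
definition qq :: "real \<Rightarrow> complex" where "qq k = of_real (rr k / (2 * sqrt 3)) - \<i> * of_real (k / 2)"
definition la :: "real \<Rightarrow> real" where "la k = k * rr k"

lemma rr_minus [simp]: "rr (- k) = - rr k"
  by (simp add: rr_def sgn_minus)
lemma pp_minus [simp]: "pp (- k) = - pp k"
  by (simp add: pp_def)
lemma qq_minus [simp]: "qq (- k) = - qq k"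
  by (simp add: qq_def)
lemma la_minus [simp]: "la (- k) = la k"
  by (simp add: la_def)
lemma cnj_pp [simp]: "cnj (pp k) = qq k"
  by (simp add: pp_def qq_def)
lemma cnj_qq [simp]: "cnj (qq k) = pp k"
  by (simp add: pp_def qq_def)

lemma rr_sq: "\<bar>k\<bar> \<ge> 1 \<Longrightarrow> (rr k)\<^sup>2 = k\<^sup>2 - 1"
  by (cases "k = 0") (auto simp: rr_def power_mult_distrib sgn_if abs_le_square_iff[of 1 k, simplified])

lemma measurable_rr [measurable]: "rr \<in> borel_measurable borel"
proof -
  have m: "(\<lambda>k::real. if k > 0 then sqrt (k\<^sup>2 - 1) else if k < 0 then - sqrt (k\<^sup>2 - 1) else 0) \<in> borel_measurable borel"
    by measurable
  have "rr = (\<lambda>k. if k > 0 then sqrt (k\<^sup>2 - 1) else if k < 0 then - sqrt (k\<^sup>2 - 1) else 0)"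
    by (auto simp: rr_def fun_eq_iff)
  with m show ?thesis by (simp only:)
qed
lemma measurable_pp [measurable]: "pp \<in> borel_measurable borel"
  unfolding pp_def by measurable
lemma measurable_qq [measurable]: "qq \<in> borel_measurable borel"
  unfolding qq_def by measurable
lemma measurable_la [measurable]: "la \<in> borel_measurable borel"
  unfolding la_def by measurable

lemma pp_minus_qq: "pp k - qq k = \<i> * of_real k"
  by (simp add: pp_def qq_def)

lemma pp_plus_qq: "pp k + qq k = of_real (rr k / sqrt 3)"
  by (simp add: pp_def qq_def field_simps)

lemma pp_qq_sq: "- \<i> * of_real (sqrt 3) * ((pp k)\<^sup>2 - (qq k)\<^sup>2) = of_real (la k)"
proof -
  have "(pp k)\<^sup>2 - (qq k)\<^sup>2 = (pp k - qq k) * (pp k + qq k)" by (simp add: power2_eq_square algebra_simps)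
  also have "\<dots> = \<i> * of_real k * of_real (rr k / sqrt 3)" by (simp only: pp_minus_qq pp_plus_qq)
  finally show ?thesis by (simp add: la_def)
qed

lemma pp_qq_cube:
  assumes "\<bar>k\<bar> \<ge> 1"
  shows "- 4 * ((pp k) ^ 3 - (qq k) ^ 3) = pp k - qq k"
proof -
  have "4 * ((pp k)^2 + pp k * qq k + (qq k)^2) = 3 * (pp k + qq k)^2 + (pp k - qq k)^2"
    by (simp add: power2_eq_square algebra_simps)
  also have "\<dots> = 3 * of_real ((rr k / sqrt 3)^2) - of_real (k^2)"
    by (simp only: pp_minus_qq pp_plus_qq) (simp add: power_mult_distrib)
  also have "\<dots> = of_real ((rr k)^2 - k^2)"
    by (simp add: power_divide flip: of_real_power)
  also have "\<dots> = -1" using rr_sq[OF assms] by simp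
  finally have *: "4 * ((pp k)^2 + pp k * qq k + (qq k)^2) = -1" .
  have "- 4 * ((pp k) ^ 3 - (qq k) ^ 3) = - (4 * ((pp k)^2 + pp k * qq k + (qq k)^2)) * (pp k - qq k)"
    by (simp add: power2_eq_square power3_eq_cube algebra_simps)
  then show ?thesis unfolding * by simp
qed

lemma abs_rr_le: "\<bar>rr k\<bar> \<le> \<bar>k\<bar>" if "\<bar>k\<bar> \<ge> 1"
  using rr_sq[OF that] by (simp add: abs_le_square_iff)

text \<open>The threshold 2 is where k squared minus 1 is at least 3/4 of k squared. It keeps the
  spectral variable away from the branch points 1 and -1, where \<open>rr\<close> vanishes and the
  Cauchy kernel becomes singular.\<close>

lemma abs_rr_ge: "\<bar>rr k\<bar> \<ge> sqrt 3 / 2 * \<bar>k\<bar>" if "\<bar>k\<bar> \<ge> 2"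
proof -
  have "4 \<le> k\<^sup>2" using that abs_le_square_iff[of 2 k] by simp
  then have "(sqrt 3 / 2 * \<bar>k\<bar>)\<^sup>2 \<le> (rr k)\<^sup>2"
    using that by (simp add: rr_sq power_mult_distrib power_divide)
  then show ?thesis by (simp add: abs_le_square_iff[symmetric] abs_mult)
qed

lemma norm_pp_le: "cmod (pp k) \<le> \<bar>k\<bar>" if "\<bar>k\<bar> \<ge> 1"
proof -
  have "cmod (pp k) \<le> \<bar>rr k\<bar> / (2 * sqrt 3) + \<bar>k\<bar>/2"
    unfolding pp_def by (rule order_trans[OF norm_triangle_ineq]) (simp add: norm_mult norm_divide)
  also have "\<bar>rr k\<bar> / (2 * sqrt 3) \<le> \<bar>k\<bar> / 2"
    using abs_rr_le[OF that] by (intro frac_le) auto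
  finally show ?thesis by simp
qed

lemma norm_qq_le: "cmod (qq k) \<le> \<bar>k\<bar>" if "\<bar>k\<bar> \<ge> 1"
  using norm_pp_le[OF that] by (metis complex_mod_cnj cnj_pp)

lemma rr_mono_sgn: "k > 0 \<Longrightarrow> rr k = \<bar>rr k\<bar>" "k < 0 \<Longrightarrow> rr k = - \<bar>rr k\<bar>" if "\<bar>k\<bar> \<ge> 1"
  using that abs_le_square_iff[of 1 k] by (auto simp: rr_def)

lemma Re_pp_qq: "Re (pp k - qq l) = (rr k - rr l) / (2 * sqrt 3)"
  by (simp add: pp_def qq_def diff_divide_distrib)
lemma Im_pp_qq: "Im (pp k - qq l) = (k + l) / 2"
  by (simp add: pp_def qq_def field_simps)

lemma pp_neq_qq: assumes "\<bar>k\<bar> > 1" "\<bar>l\<bar> > 1" shows "pp k - qq l \<noteq> 0"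
proof
  assume a: "pp k - qq l = 0"
  then have "rr k = rr l" "k = - l" using Re_pp_qq[of k l] Im_pp_qq[of k l] by auto
  then have "rr l = 0" by simp
  then show False using rr_sq[of l] assms(2) abs_square_eq_1[of l] by auto
qed

text \<open>Opposite signs of \<open>k\<close> and \<open>l\<close> are controlled by the real part, equal signs by the imaginary part.\<close>

lemma pp_qq_ge:
  assumes "\<bar>k\<bar> \<ge> 2" "\<bar>l\<bar> \<ge> 2"
  shows "cmod (pp k - qq l) \<ge> (\<bar>k\<bar> + \<bar>l\<bar>) / 4"
proof (cases "k * l > 0")
  case True
  then have "\<bar>k + l\<bar> = \<bar>k\<bar> + \<bar>l\<bar>" by (auto simp: zero_less_mult_iff)
  then have "\<bar>Im (pp k - qq l)\<bar> = (\<bar>k\<bar> + \<bar>l\<bar>) / 2" unfolding Im_pp_qq by simp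
  then show ?thesis using abs_Im_le_cmod[of "pp k - qq l"] assms by linarith
next
  case False
  then have "k > 0 \<and> l < 0 \<or> k < 0 \<and> l > 0" using assms by (auto simp: zero_less_mult_iff)
  then have "\<bar>rr k - rr l\<bar> = \<bar>rr k\<bar> + \<bar>rr l\<bar>"
    using rr_mono_sgn[of k] rr_mono_sgn[of l] assms by (smt (verit))
  also have "\<dots> \<ge> sqrt 3 / 2 * (\<bar>k\<bar> + \<bar>l\<bar>)"
    using abs_rr_ge[OF assms(1)] abs_rr_ge[OF assms(2)] by (simp add: algebra_simps)
  finally have "\<bar>rr k - rr l\<bar> / (2 * sqrt 3) \<ge> sqrt 3 / 2 * (\<bar>k\<bar> + \<bar>l\<bar>) / (2 * sqrt 3)"
    by (intro divide_right_mono) auto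
  then have "\<bar>Re (pp k - qq l)\<bar> \<ge> (\<bar>k\<bar> + \<bar>l\<bar>) / 4" unfolding Re_pp_qq by simp
  then show ?thesis using abs_Re_le_cmod[of "pp k - qq l"] by linarith
qed

lemma la_lower: "\<bar>k\<bar> \<ge> 2 \<Longrightarrow> la k \<ge> k\<^sup>2 / 2"
proof -
  assume k: "\<bar>k\<bar> \<ge> 2"
  have "la k = \<bar>k\<bar> * \<bar>rr k\<bar>"
    using rr_mono_sgn[of k] k unfolding la_def by (cases "k > 0") (auto simp: abs_if)
  also have "\<dots> \<ge> \<bar>k\<bar> * (sqrt 3 / 2 * \<bar>k\<bar>)"
    using abs_rr_ge[OF k] by (intro mult_left_mono) auto
  moreover have "\<bar>k\<bar> * (sqrt 3 / 2 * \<bar>k\<bar>) = sqrt 3 * (k\<^sup>2/2)" 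
    by (simp add: power2_eq_square abs_mult_self_eq mult.assoc[symmetric] mult.commute)
  moreover have "sqrt 3 * (k\<^sup>2/2) \<ge> 1 * (k\<^sup>2/2)" by (intro mult_right_mono) auto
  ultimately show ?thesis by linarith
qed

lemma la_upper: "\<bar>k\<bar> \<ge> 1 \<Longrightarrow> la k \<le> k\<^sup>2"
proof -
  assume k: "\<bar>k\<bar> \<ge> 1"
  have "la k \<le> \<bar>k\<bar> * \<bar>rr k\<bar>" unfolding la_def by (simp flip: abs_mult)
  also have "\<dots> \<le> \<bar>k\<bar> * \<bar>k\<bar>" using abs_rr_le[OF k] by (intro mult_left_mono) auto
  finally show ?thesis by (simp add: power2_eq_square)
qed

text \<open>The denominator dominates (\<bar>k\<bar> + \<bar>l\<bar>) / 4. Hence it is at least 1,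
  which bounds the operator, and it absorbs one power of k, which makes the nonlinear terms one
  order smoother than the linear one.\<close>

lemma kernel_bounds:
  assumes "\<bar>k\<bar> \<ge> 2" "\<bar>l\<bar> \<ge> 2"
  shows "cmod (1 / (pp k - qq l)) \<le> 1" "cmod (qq k / (pp k - qq l)) \<le> 4"
    "\<bar>k\<bar> * cmod (1 / (pp k - qq l)) \<le> 4"
proof -
  define c where "c = cmod (pp k - qq l)"
  have d: "c \<ge> (\<bar>k\<bar> + \<bar>l\<bar>) / 4" unfolding c_def by (rule pp_qq_ge[OF assms])
  have "(\<bar>k\<bar> + \<bar>l\<bar>) / 4 \<ge> 1" using assms by simp
  then have c1: "c \<ge> 1" using d by (rule order_trans)
  then show "cmod (1 / (pp k - qq l)) \<le> 1" by (simp add: norm_divide divide_le_eq c_def)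
  have "\<bar>k\<bar> \<le> 4 * c" using d abs_ge_zero[of l] by (simp add: field_simps)
  moreover have "cmod (qq k) \<le> \<bar>k\<bar>" using norm_qq_le assms by simp
  ultimately show "cmod (qq k / (pp k - qq l)) \<le> 4" "\<bar>k\<bar> * cmod (1 / (pp k - qq l)) \<le> 4"
    using c1 by (auto simp: norm_divide divide_le_eq c_def)
qed

section \<open>Derivatives and continuity of parameter integrals\<close>

lemma has_vector_derivative_iff_quotient:
  fixes f :: "real \<Rightarrow> 'b::real_normed_vector"
  shows "(f has_vector_derivative D) (at s within X) \<longleftrightarrow>
    ((\<lambda>y. (1 / (y - s)) *\<^sub>R (f y - f s)) \<longlongrightarrow> D) (at s within X)"
proof -
  have "norm ((f y - f s) - (y - s) *\<^sub>R D) / norm (y - s) = norm ((1 / (y - s)) *\<^sub>R (f y - f s) - D)" if "y \<noteq> s" for y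
  proof -
    have "(1 / (y - s)) *\<^sub>R (f y - f s) - D = (1 / (y - s)) *\<^sub>R ((f y - f s) - (y - s) *\<^sub>R D)"
      using that by (simp add: scaleR_diff_right)
    then show ?thesis by simp
  qed
  then have "((\<lambda>y. norm ((f y - f s) - (y - s) *\<^sub>R D) / norm (y - s)) \<longlongrightarrow> 0) (at s within X) \<longleftrightarrow>
    ((\<lambda>y. norm ((1 / (y - s)) *\<^sub>R (f y - f s) - D)) \<longlongrightarrow> 0) (at s within X)"
    by (intro filterlim_cong) (auto simp: eventually_at_filter)
  moreover have "((\<lambda>y. (1 / (y - s)) *\<^sub>R (f y - f s)) \<longlongrightarrow> D) (at s within X) \<longleftrightarrow>
    ((\<lambda>y. norm ((1 / (y - s)) *\<^sub>R (f y - f s) - D)) \<longlongrightarrow> 0) (at s within X)"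
    by (subst tendsto_norm_zero_iff, subst LIM_zero_iff) (rule refl)
  ultimately show ?thesis
    by (simp add: has_vector_derivative_def has_derivative_iff_norm bounded_linear_scaleR_left)
qed

text \<open>Dominated convergence along sequences of difference quotients: the mean value inequality
  on the convex set \<open>X\<close> bounds each quotient by \<open>g\<close>. Derivatives within
  \<open>X\<close> are required because time derivatives at t = 0 are one-sided.\<close>

lemma has_vector_derivative_integral:
  fixes f :: "real \<Rightarrow> 'a \<Rightarrow> complex"
  assumes X: "convex X" and s: "s \<in> X"
    and d: "\<And>y k. y \<in> X \<Longrightarrow> k \<in> space M \<Longrightarrow> ((\<lambda>y. f y k) has_vector_derivative f' y k) (at y within X)"
    and b: "\<And>y k. y \<in> X \<Longrightarrow> k \<in> space M \<Longrightarrow> cmod (f' y k) \<le> g k"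
    and g: "integrable M g"
    and f: "\<And>y. y \<in> X \<Longrightarrow> integrable M (f y)"
    and m: "f' s \<in> borel_measurable M"
  shows "((\<lambda>y. \<integral>k. f y k \<partial>M) has_vector_derivative (\<integral>k. f' s k \<partial>M)) (at s within X)"
proof -
  have "((\<lambda>y. (1 / (y - s)) *\<^sub>R ((\<integral>k. f y k \<partial>M) - (\<integral>k. f s k \<partial>M))) \<longlongrightarrow> (\<integral>k. f' s k \<partial>M)) (at s within X)"
    unfolding tendsto_at_iff_sequentially comp_def
  proof safe
    fix Y assume Y: "\<forall>i. Y i \<in> X - {s}" "Y \<longlonglongrightarrow> s"
    have YX: "Y i \<in> X" "Y i \<noteq> s" for i using Y by auto
    have "(\<lambda>i. \<integral>k. (1 / (Y i - s)) *\<^sub>R (f (Y i) k - f s k) \<partial>M) \<longlonglongrightarrow> (\<integral>k. f' s k \<partial>M)"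
    proof (rule integral_dominated_convergence[where w=g])
      show "integrable M g" by fact
      show "f' s \<in> borel_measurable M" by fact
      show "(\<lambda>k. (1 / (Y i - s)) *\<^sub>R (f (Y i) k - f s k)) \<in> borel_measurable M" for i
        using f[OF YX(1)[of i]] f[OF s] by (intro borel_measurable_scaleR borel_measurable_diff) auto
      show "AE k in M. (\<lambda>i. (1 / (Y i - s)) *\<^sub>R (f (Y i) k - f s k)) \<longlonglongrightarrow> f' s k"
      proof (rule AE_I2)
        fix k assume k: "k \<in> space M"
        have "((\<lambda>y. (1 / (y - s)) *\<^sub>R (f y k - f s k)) \<longlongrightarrow> f' s k) (at s within X)"
          using d[OF s k] by (simp only: has_vector_derivative_iff_quotient)
        then show "(\<lambda>i. (1 / (Y i - s)) *\<^sub>R (f (Y i) k - f s k)) \<longlonglongrightarrow> f' s k"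
          using Y unfolding tendsto_at_iff_sequentially comp_def by blast
      qed
      show "AE k in M. norm ((1 / (Y i - s)) *\<^sub>R (f (Y i) k - f s k)) \<le> g k" for i
      proof (rule AE_I2)
        fix k assume k: "k \<in> space M"
        have "norm (f (Y i) k - f s k) \<le> g k * norm (Y i - s)"
        proof (rule differentiable_bound[OF X, where f'="\<lambda>y h. h *\<^sub>R f' y k"])
          show "((\<lambda>y. f y k) has_derivative (\<lambda>h. h *\<^sub>R f' y k)) (at y within X)" if "y \<in> X" for y
            using d[OF that k] by (simp add: has_vector_derivative_def)
          show "onorm (\<lambda>h. h *\<^sub>R f' y k) \<le> g k" if "y \<in> X" for y
            using b[OF that k] by (intro onorm_le) (simp add: mult.commute[of "g k"] mult_left_mono)
        qed (use YX s in auto)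
        then show "norm ((1 / (Y i - s)) *\<^sub>R (f (Y i) k - f s k)) \<le> g k"
          using YX(2)[of i] by (simp add: divide_le_eq)
      qed
    qed
    moreover have "(\<integral>k. (1 / (Y i - s)) *\<^sub>R (f (Y i) k - f s k) \<partial>M) = (1 / (Y i - s)) *\<^sub>R ((\<integral>k. f (Y i) k \<partial>M) - (\<integral>k. f s k \<partial>M))" for i
      using f[OF YX(1)[of i]] f[OF s] by simp
    ultimately show "(\<lambda>i. (1 / (Y i - s)) *\<^sub>R ((\<integral>k. f (Y i) k \<partial>M) - (\<integral>k. f s k \<partial>M))) \<longlonglongrightarrow> (\<integral>k. f' s k \<partial>M)"
      by (simp only:)
  qed
  then show ?thesis
    by (simp only: has_vector_derivative_iff_quotient)
qed

lemma continuous_on_integral_dominated: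
  fixes f :: "'b::{first_countable_topology, t2_space} \<Rightarrow> 'a \<Rightarrow> complex"
  assumes c: "\<And>k. k \<in> space M \<Longrightarrow> continuous_on X (\<lambda>y. f y k)"
    and b: "\<And>y k. y \<in> X \<Longrightarrow> k \<in> space M \<Longrightarrow> cmod (f y k) \<le> g k"
    and g: "integrable M g"
    and f: "\<And>y. y \<in> X \<Longrightarrow> f y \<in> borel_measurable M"
  shows "continuous_on X (\<lambda>y. \<integral>k. f y k \<partial>M)"
proof (rule continuous_on_sequentiallyI)
  fix u a assume u: "\<forall>n. u n \<in> X" "a \<in> X" "u \<longlonglongrightarrow> a"
  show "(\<lambda>n. \<integral>k. f (u n) k \<partial>M) \<longlonglongrightarrow> (\<integral>k. f a k \<partial>M)"
  proof (rule integral_dominated_convergence[where w=g])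
    show "AE k in M. (\<lambda>i. f (u i) k) \<longlonglongrightarrow> f a k"
    proof (rule AE_I2)
      fix k assume k: "k \<in> space M"
      show "(\<lambda>i. f (u i) k) \<longlonglongrightarrow> f a k"
        using continuous_on_tendsto_compose[OF c[OF k] u(3) u(2)] u(1) by simp
    qed
  qed (use u f b g in auto)
qed

section \<open>Neumann series of the Cauchy kernel\<close>

text \<open>For the operator \<open>K\<close> with kernel \<open>w l / (pp k - qq l)\<close>, \<open>cauchy_sum w i j\<close> is the matrix element
  \<open>\<langle>qq\<^sup>i w, (1 + K)\<^sup>-\<^sup>1 pp\<^sup>j\<rangle>\<close>.\<close>

primrec neumann :: "(real \<Rightarrow> complex) \<Rightarrow> nat \<Rightarrow> nat \<Rightarrow> real \<Rightarrow> complex" where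
  "neumann w 0 j = (\<lambda>k. pp k ^ j)"
| "neumann w (Suc n) j = (\<lambda>k. \<integral>l. w l * (1 / (pp k - qq l) * neumann w n j l) \<partial>lborel)"

definition cauchy_term :: "(real \<Rightarrow> complex) \<Rightarrow> nat \<Rightarrow> nat \<Rightarrow> nat \<Rightarrow> complex" where
  "cauchy_term w n i j = (\<integral>k. w k * (qq k ^ i * neumann w n j k) \<partial>lborel)"

definition cauchy_sum :: "(real \<Rightarrow> complex) \<Rightarrow> nat \<Rightarrow> nat \<Rightarrow> complex" where
  "cauchy_sum w i j = (\<Sum>n. (- 1) ^ n * cauchy_term w n i j)"

lemma measurable_neumann [measurable]:
  assumes [measurable]: "w \<in> borel_measurable borel"
  shows "neumann w n j \<in> borel_measurable borel"
proof (induction n)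
  case 0 show ?case by simp
next
  case (Suc n)
  note [measurable] = Suc
  show ?case unfolding neumann.simps by measurable
qed

text \<open>\<open>m\<close> majorises all weights that occur, uniformly in space and time, and
  \<open>d\<close> is the number of available moments. Since the kernel is bounded by 1, the mass
  1/2 makes the Neumann series geometric with ratio 1/2.\<close>

locale weight =
  fixes m :: "real \<Rightarrow> real" and d :: nat
  assumes m_meas [measurable]: "m \<in> borel_measurable borel"
    and m_nonneg: "0 \<le> m k"
    and m_supp: "\<bar>k\<bar> < 2 \<Longrightarrow> m k = 0"
    and m_int: "integrable lborel (\<lambda>k. \<bar>k\<bar> ^ d * m k)"
    and m_small: "(\<integral>k. m k \<partial>lborel) \<le> 1/2"
begin

definition mom :: "nat \<Rightarrow> real" where "mom j = (\<integral>k. \<bar>k\<bar> ^ j * m k \<partial>lborel)"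

definition adm :: "(real \<Rightarrow> complex) \<Rightarrow> bool" where
  "adm w \<longleftrightarrow> w \<in> borel_measurable borel \<and> (\<forall>k. cmod (w k) \<le> m k)"

lemma adm_meas [measurable_dest]: "adm w \<Longrightarrow> w \<in> borel_measurable borel"
  and adm_le: "adm w \<Longrightarrow> cmod (w k) \<le> m k"
  by (auto simp: adm_def)

lemma pow_m_le: "j \<le> e \<Longrightarrow> \<bar>k\<bar> ^ j * m k \<le> \<bar>k\<bar> ^ e * m k"
  using m_supp[of k] m_nonneg[of k] by (cases "\<bar>k\<bar> < 2") (auto intro!: mult_right_mono power_increasing)

lemma mom_int: "j \<le> d \<Longrightarrow> integrable lborel (\<lambda>k. \<bar>k\<bar> ^ j * m k)"
  by (rule Bochner_Integration.integrable_bound[OF m_int])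
     (auto simp: abs_mult m_nonneg pow_m_le abs_of_nonneg power_abs)

lemma mom_nonneg: "0 \<le> mom j"
  unfolding mom_def by (intro Bochner_Integration.integral_nonneg) (auto simp: m_nonneg)

lemma mom_le: "j \<le> e \<Longrightarrow> e \<le> d \<Longrightarrow> mom j \<le> mom e"
  unfolding mom_def by (intro Bochner_Integration.integral_mono mom_int pow_m_le) auto

lemma mom_0: "mom 0 \<le> 1/2"
  using m_small by (simp add: mom_def)

text \<open>An admissible \<open>w\<close> vanishes for \<bar>k\<bar> < 2, so bounds on
  \<open>f\<close> are asked for on the support only. This is why the estimates below all assume
  \<bar>k\<bar> \<ge> 2.\<close>

lemma adm_pointwise:
  assumes w: "adm w" and f: "\<bar>k\<bar> \<ge> 2 \<Longrightarrow> cmod (f k) \<le> c * \<bar>k\<bar> ^ j"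
  shows "cmod (w k * f k) \<le> c * (\<bar>k\<bar> ^ j * m k)"
proof (cases "\<bar>k\<bar> < 2")
  case True
  then have "w k = 0" using adm_le[OF w, of k] m_supp by auto
  then show ?thesis using True m_supp by simp
next
  case False
  then have "cmod (w k) * cmod (f k) \<le> m k * (c * \<bar>k\<bar> ^ j)"
    using f adm_le[OF w, of k] by (intro mult_mono) (auto simp: m_nonneg)
  then show ?thesis by (simp add: norm_mult algebra_simps)
qed

lemma adm_integrable:
  assumes w: "adm w" and [measurable]: "f \<in> borel_measurable borel"
    and f: "\<And>k. \<bar>k\<bar> \<ge> 2 \<Longrightarrow> cmod (f k) \<le> c * \<bar>k\<bar> ^ j" and j: "j \<le> d"
  shows "integrable lborel (\<lambda>k. w k * f k)"
    and "cmod (\<integral>k. w k * f k \<partial>lborel) \<le> c * mom j"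
proof -
  note [measurable] = adm_meas[OF w]
  have b: "cmod (w k * f k) \<le> c * (\<bar>k\<bar> ^ j * m k)" for k
    by (rule adm_pointwise[OF w f])
  have i: "integrable lborel (\<lambda>k. c * (\<bar>k\<bar> ^ j * m k))"
    using mom_int[OF j] by auto
  show I: "integrable lborel (\<lambda>k. w k * f k)"
    by (rule Bochner_Integration.integrable_bound[OF i]) (auto intro: order_trans[OF b abs_ge_self])
  have "cmod (\<integral>k. w k * f k \<partial>lborel) \<le> (\<integral>k. c * (\<bar>k\<bar> ^ j * m k) \<partial>lborel)"
    by (rule Bochner_Integration.integral_norm_bound_integral[OF I i b])
  then show "cmod (\<integral>k. w k * f k \<partial>lborel) \<le> c * mom j"
    by (simp add: mom_def)
qed

lemma kernel_pow:
  assumes "\<bar>k\<bar> \<ge> 2" "\<bar>l\<bar> \<ge> 2" "cmod z \<le> c"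
  shows "cmod (z / (pp k - qq l)) \<le> c"
proof -
  have "cmod (1 / (pp k - qq l)) * cmod z \<le> 1 * c"
    using kernel_bounds(1)[OF assms(1,2)] assms(3) by (intro mult_mono) auto
  then show ?thesis by (simp add: norm_divide)
qed

lemma pp_pow_le: "\<bar>k\<bar> \<ge> 2 \<Longrightarrow> cmod (pp k ^ j) \<le> \<bar>k\<bar> ^ j"
  and qq_pow_le: "\<bar>k\<bar> \<ge> 2 \<Longrightarrow> cmod (qq k ^ j) \<le> \<bar>k\<bar> ^ j"
  by (auto simp: norm_power intro!: power_mono norm_pp_le norm_qq_le)

text \<open>After one application of the operator the variable k occurs in the kernel only, so the
  growth \<bar>k\<bar> ^ j of the starting vector is gone and costs one factor \<open>mom j\<close>.
  Every further application costs \<open>mom 0\<close>, at most 1/2.\<close>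

lemma neumann_Suc_bound:
  assumes w: "adm w" and j: "j \<le> d" and k: "\<bar>k\<bar> \<ge> 2"
  shows "cmod (neumann w (Suc n) j k) \<le> (1/2) ^ n * mom j"
  using k
proof (induction n arbitrary: k)
  case 0
  note [measurable] = adm_meas[OF w]
  have "cmod (neumann w (Suc 0) j k) \<le> 1 * mom j"
    unfolding neumann.simps using 0 j
    by (intro adm_integrable(2)[OF w]) (auto intro!: kernel_pow pp_pow_le)
  then show ?case by simp
next
  case (Suc n)
  note [measurable] = adm_meas[OF w]
  have "cmod (neumann w (Suc (Suc n)) j k) \<le> ((1/2) ^ n * mom j) * mom 0"
    unfolding neumann.simps(2)[of w "Suc n"]
    by (rule adm_integrable(2)[OF w]) (use Suc in \<open>auto intro!: kernel_pow simp del: neumann.simps\<close>)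
  also have "\<dots> \<le> ((1/2) ^ n * mom j) * (1/2)"
    by (intro mult_left_mono mom_0) (simp add: mom_nonneg)
  finally show ?case by (simp add: algebra_simps)
qed

lemma neumann_bound:
  assumes w: "adm w" and j: "j \<le> d" and k: "\<bar>k\<bar> \<ge> 2"
  shows "cmod (neumann w n j k) \<le> (1 + mom d) * \<bar>k\<bar> ^ j"
proof (cases n)
  case 0
  have "cmod (pp k ^ j) \<le> 1 * \<bar>k\<bar> ^ j" using pp_pow_le[OF k] by simp
  also have "\<dots> \<le> (1 + mom d) * \<bar>k\<bar> ^ j" using mom_nonneg by (intro mult_right_mono) auto
  finally show ?thesis using 0 by simp
next
  case (Suc n')
  have "cmod (neumann w n j k) \<le> (1/2) ^ n' * mom j" using neumann_Suc_bound[OF w j k] Suc by simp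
  also have "\<dots> \<le> 1 * mom j" by (intro mult_right_mono mom_nonneg) (simp add: power_le_one)
  also have "\<dots> \<le> (1 + mom d) * 1" using mom_le[OF j order_refl] by simp
  also have "\<dots> \<le> (1 + mom d) * \<bar>k\<bar> ^ j" using k mom_nonneg[of d] by (intro mult_left_mono) auto
  finally show ?thesis .
qed

lemma cauchy_term_integrable:
  assumes w: "adm w" and ij: "i + j \<le> d"
  shows "integrable lborel (\<lambda>k. w k * (qq k ^ i * neumann w n j k))"
proof -
  note [measurable] = adm_meas[OF w]
  show ?thesis
  proof (rule adm_integrable(1)[OF w, where c="1 + mom d" and j="i+j"])
    fix k :: real assume k: "\<bar>k\<bar> \<ge> 2"
    have "cmod (qq k ^ i) * cmod (neumann w n j k) \<le> \<bar>k\<bar> ^ i * ((1 + mom d) * \<bar>k\<bar> ^ j)"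
      using ij by (intro mult_mono qq_pow_le neumann_bound w k) auto
    then show "cmod (qq k ^ i * neumann w n j k) \<le> (1 + mom d) * \<bar>k\<bar> ^ (i + j)"
      by (simp add: norm_mult power_add algebra_simps)
  qed (use ij in auto)
qed

text \<open>\<open>mom d\<close> serves the term n = 0. The remaining terms are at most (1/2) ^ (n -
  1) times \<open>mom d\<close> squared, and the factor 2 absorbs the shift of the exponent.\<close>

definition term_const :: real where "term_const = mom d + 2 * (mom d)\<^sup>2"

lemma term_const_nonneg: "term_const \<ge> 0"
  by (auto simp: term_const_def mom_nonneg)

lemma cauchy_term_0_bound:
  assumes w: "adm w" and ij: "i + j \<le> d"
  shows "cmod (cauchy_term w 0 i j) \<le> mom (i + j)"
proof -
  note [measurable] = adm_meas[OF w]
  have "cmod (cauchy_term w 0 i j) \<le> 1 * mom (i + j)"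
    unfolding cauchy_term_def neumann.simps using ij
    by (intro adm_integrable(2)[OF w])
       (auto simp: norm_mult power_add intro!: mult_mono pp_pow_le qq_pow_le)
  then show ?thesis by simp
qed

lemma cauchy_term_Suc_bound:
  assumes w: "adm w" and i: "i \<le> d" and j: "j \<le> d"
  shows "cmod (cauchy_term w (Suc n) i j) \<le> (1/2) ^ n * mom j * mom i"
proof -
  note [measurable] = adm_meas[OF w]
  show ?thesis
    unfolding cauchy_term_def using i j
    by (intro adm_integrable(2)[OF w])
       (auto simp: norm_mult mult.commute[of "(1/2) ^ n * mom j"] simp del: neumann.simps
          intro!: mult_mono qq_pow_le neumann_Suc_bound w)
qed

lemma cauchy_term_bound:
  assumes w: "adm w" and ij: "i + j \<le> d"
  shows "cmod (cauchy_term w n i j) \<le> term_const * (1/2) ^ n"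
proof (cases n)
  case 0
  have "cmod (cauchy_term w 0 i j) \<le> mom (i + j)" by (rule cauchy_term_0_bound[OF w ij])
  also have "\<dots> \<le> mom d" by (rule mom_le) (use ij in auto)
  also have "\<dots> \<le> term_const" by (simp add: term_const_def)
  finally show ?thesis using 0 by simp
next
  case (Suc n')
  have "cmod (cauchy_term w n i j) \<le> (1/2) ^ n' * mom j * mom i" using cauchy_term_Suc_bound[OF w, of i j] ij Suc by simp
  also have "\<dots> \<le> (1/2) ^ n' * mom d * mom d"
    using ij by (intro mult_mono mom_le mom_nonneg) (auto simp: mom_nonneg)
  also have "\<dots> = (2 * (mom d)\<^sup>2) * (1/2) ^ n" using Suc by (simp add: power2_eq_square)
  also have "\<dots> \<le> term_const * (1/2) ^ n" by (intro mult_right_mono) (auto simp: term_const_def mom_nonneg)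
  finally show ?thesis .
qed

lemma summable_half: "summable (\<lambda>n. C * (1/2::real) ^ n)"
  by (intro summable_mult summable_geometric) auto

lemma cauchy_sum_summable:
  assumes w: "adm w" and ij: "i + j \<le> d"
  shows "summable (\<lambda>n. cmod ((- 1) ^ n * cauchy_term w n i j))"
  by (rule summable_comparison_test'[OF summable_half[of term_const]])
     (use cauchy_term_bound[OF w ij] in \<open>auto simp: norm_mult norm_power\<close>)

lemma cauchy_sum_bound:
  assumes w: "adm w" and ij: "i + j \<le> d"
  shows "cmod (cauchy_sum w i j) \<le> 2 * term_const"
proof -
  have "cmod (cauchy_sum w i j) \<le> (\<Sum>n. term_const * (1/2::real) ^ n)"
    unfolding cauchy_sum_def by (rule norm_suminf_le[OF _ summable_half])
     (use cauchy_term_bound[OF w ij] in \<open>auto simp: norm_mult norm_power\<close>)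
  also have "\<dots> = 2 * term_const" by (simp add: suminf_mult summable_geometric suminf_geometric)
  finally show ?thesis .
qed

context
  fixes X :: "'b::{first_countable_topology, t2_space} set" and w :: "'b \<Rightarrow> real \<Rightarrow> complex"
  assumes w: "\<And>s. s \<in> X \<Longrightarrow> adm (w s)"
    and cw: "\<And>k. continuous_on X (\<lambda>s. w s k)"
begin

text \<open>Induction on n with dominated convergence. The induction hypothesis covers only
  \<bar>l\<bar> \<ge> 2, and for other l the weight makes the integrand zero. The parameter space is
  general so that joint continuity in (x, t) is included.\<close>

lemma neumann_continuous:
  assumes j: "j \<le> d" and k: "\<bar>k\<bar> \<ge> 2"
  shows "continuous_on X (\<lambda>s. neumann (w s) n j k)"
  using k
proof (induction n arbitrary: k)
  case 0 show ?case by simp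
next
  case (Suc n)
  show ?case unfolding neumann.simps
  proof (rule continuous_on_integral_dominated[where g="\<lambda>l. (1 + mom d) * (\<bar>l\<bar> ^ j * m l)"])
    show "integrable lborel (\<lambda>l. (1 + mom d) * (\<bar>l\<bar> ^ j * m l))" using mom_int[OF j] by auto
    fix l :: real
    show "cmod (w s l * (1 / (pp k - qq l) * neumann (w s) n j l)) \<le> (1 + mom d) * (\<bar>l\<bar> ^ j * m l)" if "s \<in> X" for s
      using Suc.prems that by (intro adm_pointwise w) (auto intro!: kernel_pow neumann_bound w j)
    show "continuous_on X (\<lambda>s. w s l * (1 / (pp k - qq l) * neumann (w s) n j l))"
    proof (cases "\<bar>l\<bar> \<ge> 2")
      case True then show ?thesis by (intro continuous_intros cw Suc.IH)
    next
      case False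
      then have "w s l = 0" if "s \<in> X" for s using adm_le[OF w[OF that], of l] m_supp[of l] by simp
      then show ?thesis by (simp add: continuous_on_cong[of X X _ "\<lambda>_. 0"])
    qed
  next
    fix s assume "s \<in> X"
    note [measurable] = adm_meas[OF w[OF this]]
    show "(\<lambda>l. w s l * (1 / (pp k - qq l) * neumann (w s) n j l)) \<in> borel_measurable lborel" by measurable
  qed
qed

lemma cauchy_term_continuous:
  assumes ij: "i + j \<le> d"
  shows "continuous_on X (\<lambda>s. cauchy_term (w s) n i j)"
  unfolding cauchy_term_def
proof (rule continuous_on_integral_dominated[where g="\<lambda>l. (1 + mom d) * (\<bar>l\<bar> ^ (i+j) * m l)"])
  show "integrable lborel (\<lambda>l. (1 + mom d) * (\<bar>l\<bar> ^ (i+j) * m l))" using mom_int[OF ij] by auto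
  fix l :: real
  show "cmod (w s l * (qq l ^ i * neumann (w s) n j l)) \<le> (1 + mom d) * (\<bar>l\<bar> ^ (i+j) * m l)" if "s \<in> X" for s
  proof (intro adm_pointwise w that)
    assume k: "\<bar>l\<bar> \<ge> 2"
    have "cmod (qq l ^ i) * cmod (neumann (w s) n j l) \<le> \<bar>l\<bar> ^ i * ((1 + mom d) * \<bar>l\<bar> ^ j)"
      using ij by (intro mult_mono qq_pow_le neumann_bound w that k) auto
    then show "cmod (qq l ^ i * neumann (w s) n j l) \<le> (1 + mom d) * \<bar>l\<bar> ^ (i + j)"
      by (simp add: norm_mult power_add algebra_simps)
  qed
  show "continuous_on X (\<lambda>s. w s l * (qq l ^ i * neumann (w s) n j l))"
  proof (cases "\<bar>l\<bar> \<ge> 2")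
    case True then show ?thesis using ij by (intro continuous_intros cw neumann_continuous) auto
  next
    case False
    then have "w s l = 0" if "s \<in> X" for s using adm_le[OF w[OF that], of l] m_supp[of l] by simp
    then show ?thesis by (simp add: continuous_on_cong[of X X _ "\<lambda>_. 0"])
  qed
next
  fix s assume "s \<in> X"
  note [measurable] = adm_meas[OF w[OF this]]
  show "(\<lambda>l. w s l * (qq l ^ i * neumann (w s) n j l)) \<in> borel_measurable lborel" by measurable
qed

lemma cauchy_sum_continuous:
  assumes ij: "i + j \<le> d"
  shows "continuous_on X (\<lambda>s. cauchy_sum (w s) i j)"
proof (rule uniform_limit_theorem[where F=sequentially and f="\<lambda>n s. \<Sum>a<n. (-1) ^ a * cauchy_term (w s) a i j"])
  show "\<forall>\<^sub>F n in sequentially. continuous_on X (\<lambda>s. \<Sum>a<n. (-1) ^ a * cauchy_term (w s) a i j)"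
    by (intro always_eventually allI continuous_intros cauchy_term_continuous ij)
  show "uniform_limit X (\<lambda>n s. \<Sum>a<n. (-1) ^ a * cauchy_term (w s) a i j) (\<lambda>s. cauchy_sum (w s) i j) sequentially"
    unfolding cauchy_sum_def
    by (rule Weierstrass_m_test[OF _ summable_half[of term_const]])
       (use cauchy_term_bound[OF w ij] in \<open>auto simp: norm_mult norm_power\<close>)
qed simp

end

end

section \<open>Derivatives of the Neumann series along the flows\<close>

text \<open>Trading q ^ m for p ^ m over the denominator leaves a sum of products of a power of p
  and a power of q. These terms have no denominator, so the integral over q factors there.\<close>

lemma power_diff_kernel:
  fixes p q :: complex
  assumes "p - q \<noteq> 0"
  shows "q ^ m / (p - q) = p ^ m / (p - q) - (\<Sum>l<m. p ^ (m - Suc l) * q ^ l)"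
proof -
  have "q ^ m - p ^ m = (q - p) * (\<Sum>l<m. p ^ (m - Suc l) * q ^ l)"
    by (rule power_diff_sumr2)
  then show ?thesis using assms by (simp add: field_simps)
qed

text \<open>The M-test makes the series of derivatives converge uniformly.
  \<open>has_derivative_series\<close> then yields some limit function \<open>g\<close>, which
  agrees with the sum on \<open>X\<close> because limits are unique.\<close>

lemma has_vector_derivative_series:
  fixes f :: "nat \<Rightarrow> real \<Rightarrow> complex"
  assumes X: "convex X" and s: "s \<in> X"
    and d: "\<And>n y. y \<in> X \<Longrightarrow> (f n has_vector_derivative f' n y) (at y within X)"
    and b: "\<And>n y. y \<in> X \<Longrightarrow> cmod (f' n y) \<le> M n" "summable M"
    and f: "\<And>y. y \<in> X \<Longrightarrow> summable (\<lambda>n. f n y)"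
  shows "((\<lambda>y. \<Sum>n. f n y) has_vector_derivative (\<Sum>n. f' n s)) (at s within X)"
proof -
  have "\<exists>g. \<forall>x\<in>X. (\<lambda>n. f n x) sums g x \<and> (g has_derivative (\<lambda>h. h *\<^sub>R (\<Sum>n. f' n x))) (at x within X)"
  proof (rule has_derivative_series[OF X, where f'="\<lambda>n y h. h *\<^sub>R f' n y" and x=s])
    show "(f n has_derivative (\<lambda>h. h *\<^sub>R f' n x)) (at x within X)" if "x \<in> X" for n x
      using d[OF that] by (simp add: has_vector_derivative_def)
    have u: "uniform_limit X (\<lambda>n y. \<Sum>i<n. f' i y) (\<lambda>y. \<Sum>i. f' i y) sequentially"
      by (rule Weierstrass_m_test[OF b])
    show "\<forall>\<^sub>F n in sequentially. \<forall>x\<in>X. \<forall>h. norm ((\<Sum>i<n. h *\<^sub>R f' i x) - h *\<^sub>R (\<Sum>n. f' n x)) \<le> e * norm h"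
      if "e > 0" for e
      using uniform_limitD[OF u that]
    proof (rule eventually_mono, intro ballI allI)
      fix n x h assume "\<forall>x\<in>X. dist (\<Sum>i<n. f' i x) (\<Sum>i. f' i x) < e" "x \<in> X"
      then have "norm ((\<Sum>i<n. f' i x) - (\<Sum>i. f' i x)) \<le> e" by (force simp: dist_norm)
      moreover have "(\<Sum>i<n. h *\<^sub>R f' i x) - h *\<^sub>R (\<Sum>n. f' n x) = h *\<^sub>R ((\<Sum>i<n. f' i x) - (\<Sum>i. f' i x))"
        by (simp add: scaleR_diff_right scaleR_sum_right)
      ultimately show "norm ((\<Sum>i<n. h *\<^sub>R f' i x) - h *\<^sub>R (\<Sum>n. f' n x)) \<le> e * norm h"
        by (simp add: mult.commute[of e] mult_left_mono)
    qed
    show "s \<in> X" by fact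
    show "(\<lambda>n. f n s) sums (\<Sum>n. f n s)" using f[OF s] by (rule summable_sums)
  qed
  then obtain g where g: "\<And>x. x \<in> X \<Longrightarrow> (\<lambda>n. f n x) sums g x"
      "\<And>x. x \<in> X \<Longrightarrow> (g has_derivative (\<lambda>h. h *\<^sub>R (\<Sum>n. f' n x))) (at x within X)" by blast
  have "(g has_vector_derivative (\<Sum>n. f' n s)) (at s within X)"
    using g(2)[OF s] by (simp add: has_vector_derivative_def)
  then show ?thesis
    by (rule has_vector_derivative_transform[OF s, rotated]) (metis g(1) sums_unique)
qed

context weight
begin

text \<open>Each variable contributes a factor \<open>pp\<^sup>e - qq\<^sup>e\<close> to the derivative. These telescope along the chain: a difference
  \<open>pp k\<^sup>e - qq l\<^sup>e\<close> at consecutive variables cancels the denominator \<open>pp k - qq l\<close> and splits the integral.\<close>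

definition neumann_deriv :: "complex \<Rightarrow> nat \<Rightarrow> (real \<Rightarrow> complex) \<Rightarrow> nat \<Rightarrow> nat \<Rightarrow> real \<Rightarrow> complex" where
  "neumann_deriv c e w n j k = c * (neumann w n (j + e) k - pp k ^ e * neumann w n j k
     + (\<Sum>a<n. \<Sum>l<e. neumann w a (e - Suc l) k * cauchy_term w (n - Suc a) l j))"

lemma measurable_neumann_deriv:
  assumes "adm w"
  shows "neumann_deriv c e w n j \<in> borel_measurable borel"
proof -
  note [measurable] = adm_meas[OF assms]
  show ?thesis unfolding neumann_deriv_def by measurable
qed

text \<open>The constant does not depend on \<open>w\<close>, so one integrable majorant serves all
  parameter values when the next integral is differentiated.\<close>

lemma neumann_deriv_bound:
  "\<exists>C\<ge>0. \<forall>w k. adm w \<longrightarrow> j + e \<le> d \<longrightarrow> \<bar>k\<bar> \<ge> 2 \<longrightarrow> cmod (neumann_deriv c e w n j k) \<le> C * \<bar>k\<bar> ^ (j + e)"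
proof -
  define B where "B = 1 + mom d"
  define C where "C = cmod c * (B + B + n * e * (B * term_const))"
  have B: "B \<ge> 0" by (simp add: B_def mom_nonneg)
  have "cmod (neumann_deriv c e w n j k) \<le> C * \<bar>k\<bar> ^ (j + e)" if w: "adm w" and je: "j + e \<le> d" and k: "\<bar>k\<bar> \<ge> 2" for w k
  proof -
    have 1: "cmod (neumann w n (j + e) k) \<le> B * \<bar>k\<bar> ^ (j + e)"
      unfolding B_def by (rule neumann_bound[OF w je k])
    have "cmod (pp k ^ e * neumann w n j k) \<le> \<bar>k\<bar> ^ e * (B * \<bar>k\<bar> ^ j)"
      unfolding norm_mult B_def using je by (intro mult_mono pp_pow_le neumann_bound w k) auto
    then have 2: "cmod (pp k ^ e * neumann w n j k) \<le> B * \<bar>k\<bar> ^ (j + e)" by (simp add: power_add algebra_simps)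
    have "cmod (\<Sum>a<n. \<Sum>l<e. neumann w a (e - Suc l) k * cauchy_term w (n - Suc a) l j)
      \<le> (\<Sum>a<n. \<Sum>l<e. B * \<bar>k\<bar> ^ (j + e) * term_const)"
    proof (intro sum_norm_le)
      fix a l assume "l \<in> {..<e}"
      then have l: "l < e" by simp
      have "cmod (neumann w a (e - Suc l) k) \<le> B * \<bar>k\<bar> ^ (e - Suc l)"
        unfolding B_def using l je by (intro neumann_bound w k) auto
      also have "\<dots> \<le> B * \<bar>k\<bar> ^ (j + e)" using k B by (intro mult_left_mono power_increasing) auto
      finally have "cmod (neumann w a (e - Suc l) k) \<le> B * \<bar>k\<bar> ^ (j + e)" .
      moreover have "cmod (cauchy_term w (n - Suc a) l j) \<le> term_const * (1/2) ^ (n - Suc a)" using l je by (intro cauchy_term_bound w) auto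
      moreover have "\<dots> \<le> term_const * 1" using term_const_nonneg by (intro mult_left_mono power_le_one) auto
      ultimately show "cmod (neumann w a (e - Suc l) k * cauchy_term w (n - Suc a) l j) \<le> B * \<bar>k\<bar> ^ (j + e) * term_const"
        unfolding norm_mult using B by (intro mult_mono) auto
    qed
    then have 3: "cmod (\<Sum>a<n. \<Sum>l<e. neumann w a (e - Suc l) k * cauchy_term w (n - Suc a) l j) \<le> n * e * (B * term_const) * \<bar>k\<bar> ^ (j + e)"
      by (simp add: algebra_simps)
    have "cmod (neumann_deriv c e w n j k) \<le> cmod c * (B * \<bar>k\<bar> ^ (j + e) + B * \<bar>k\<bar> ^ (j + e) + n * e * (B * term_const) * \<bar>k\<bar> ^ (j + e))"
      unfolding neumann_deriv_def norm_mult
      by (intro mult_left_mono order_trans[OF norm_triangle_ineq] add_mono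
          order_trans[OF norm_triangle_ineq4] 1 2 3) auto
    then show ?thesis by (simp add: C_def algebra_simps)
  qed
  moreover have "C \<ge> 0" using B term_const_nonneg by (auto simp: C_def)
  ultimately show ?thesis by blast
qed

context
  fixes X :: "real set" and w :: "real \<Rightarrow> real \<Rightarrow> complex" and c :: complex and e :: nat
  assumes X: "convex X"
    and w: "\<And>s. s \<in> X \<Longrightarrow> adm (w s)"
    and dw: "\<And>s k. s \<in> X \<Longrightarrow> ((\<lambda>s. w s k) has_vector_derivative c * (pp k ^ e - qq k ^ e) * w s k) (at s within X)"
begin

lemma w_0: "s \<in> X \<Longrightarrow> \<bar>k\<bar> < 2 \<Longrightarrow> w s k = 0"
  using adm_le[OF w, of s k] m_supp[of k] by simp

text \<open>One computation for both uses: \<open>h\<close> = 1/(pp k - qq l) produces the next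
  Neumann iterate, \<open>h\<close> = qq k ^ i the matrix element. The factor
  \<open>pp k ^ e\<close> from the derivative of the weight cancels the term - pp k ^ e of
  \<open>neumann_deriv\<close>, so only \<open>qq k ^ e\<close> survives. The derivative of the
  iterate is the hypothesis \<open>dA\<close>, since the lemma is applied inside the induction that
  proves it. The exponents e = 1, 3, 2 will be the x-flow, its expression as a third flow, and the
  t-flow.\<close>

lemma integral_derivative:
  assumes hm [measurable]: "h \<in> borel_measurable borel"
    and h: "\<And>k. \<bar>k\<bar> \<ge> 2 \<Longrightarrow> cmod (h k) \<le> H * \<bar>k\<bar> ^ i" and H: "H \<ge> 0"
    and ij: "i + j + e \<le> d" and s: "s \<in> X"
    and dA: "\<And>s k. s \<in> X \<Longrightarrow> \<bar>k\<bar> \<ge> 2 \<Longrightarrow> ((\<lambda>s. neumann (w s) n j k) has_vector_derivative neumann_deriv c e (w s) n j k) (at s within X)"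
  shows "((\<lambda>s. \<integral>k. w s k * (h k * neumann (w s) n j k) \<partial>lborel) has_vector_derivative
    c * ((\<integral>k. w s k * (h k * neumann (w s) n (j + e) k) \<partial>lborel)
      - (\<integral>k. w s k * (h k * qq k ^ e * neumann (w s) n j k) \<partial>lborel)
      + (\<Sum>a<n. \<Sum>l<e. (\<integral>k. w s k * (h k * neumann (w s) a (e - Suc l) k) \<partial>lborel) * cauchy_term (w s) (n - Suc a) l j))) (at s within X)"
proof -
  define F' where "F' s k = c * (pp k ^ e - qq k ^ e) * w s k * (h k * neumann (w s) n j k) + w s k * (h k * neumann_deriv c e (w s) n j k)" for s k
  obtain C where C: "C \<ge> 0" "\<And>w k. adm w \<Longrightarrow> \<bar>k\<bar> \<ge> 2 \<Longrightarrow> cmod (neumann_deriv c e w n j k) \<le> C * \<bar>k\<bar> ^ (j + e)"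
    using neumann_deriv_bound[of j e c n] ij by auto
  define B where "B = 1 + mom d"
  have B: "B \<ge> 0" by (simp add: B_def mom_nonneg)
  have hA: "cmod (h k * neumann (w s) a b k) \<le> H * B * \<bar>k\<bar> ^ (i + b)" if "s \<in> X" "b \<le> d" "\<bar>k\<bar> \<ge> 2" for s a b k
  proof -
    have "cmod (h k) * cmod (neumann (w s) a b k) \<le> (H * \<bar>k\<bar> ^ i) * (B * \<bar>k\<bar> ^ b)"
      unfolding B_def using that H by (intro mult_mono h neumann_bound w) auto
    then show ?thesis by (simp add: norm_mult power_add algebra_simps)
  qed
  have b1: "cmod (h k * qq k ^ e * neumann (w s) n j k) \<le> H * B * \<bar>k\<bar> ^ (i + j + e)" if "s \<in> X" "\<bar>k\<bar> \<ge> 2" for s k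
  proof -
    have "cmod (h k * neumann (w s) n j k) * cmod (qq k ^ e) \<le> (H * B * \<bar>k\<bar> ^ (i + j)) * \<bar>k\<bar> ^ e"
      using ij H B that by (intro mult_mono hA qq_pow_le) auto
    then show ?thesis by (simp add: norm_mult power_add algebra_simps)
  qed
  have "((\<lambda>s. \<integral>k. w s k * (h k * neumann (w s) n j k) \<partial>lborel) has_vector_derivative (\<integral>k. F' s k \<partial>lborel)) (at s within X)"
  proof (rule has_vector_derivative_integral[OF X s, where g="\<lambda>k. (2 * cmod c * H * B + H * C) * (\<bar>k\<bar> ^ (i + j + e) * m k)"])
    show "integrable lborel (\<lambda>k. (2 * cmod c * H * B + H * C) * (\<bar>k\<bar> ^ (i + j + e) * m k))"
      using mom_int[OF ij] by auto
    fix y k assume y: "y \<in> X"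
    show "((\<lambda>s. w s k * (h k * neumann (w s) n j k)) has_vector_derivative F' y k) (at y within X)"
    proof (cases "\<bar>k\<bar> \<ge> 2")
      case True
      show ?thesis unfolding F'_def
        by (rule has_vector_derivative_eq_rhs, rule has_vector_derivative_mult[OF dw[OF y] has_vector_derivative_mult_right[OF dA[OF y True]]])
           (simp add: algebra_simps)
    next
      case False
      then have "w s k = 0" if "s \<in> X" for s using w_0 that by simp
      then have "F' y k = 0" using y by (simp add: F'_def)
      then show ?thesis using \<open>\<And>s. s \<in> X \<Longrightarrow> w s k = 0\<close>
        by (auto intro: has_vector_derivative_transform[OF y, where f="\<lambda>_. 0"])
    qed
    have eq: "F' y k = w y k * (h k * neumann_deriv c e (w y) n j k + c * (pp k ^ e - qq k ^ e) * (h k * neumann (w y) n j k))"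
      by (simp add: F'_def algebra_simps)
    show "cmod (F' y k) \<le> (2 * cmod c * H * B + H * C) * (\<bar>k\<bar> ^ (i + j + e) * m k)"
      unfolding eq
    proof (intro adm_pointwise w y)
      assume k: "\<bar>k\<bar> \<ge> 2"
      have "cmod (h k * neumann_deriv c e (w y) n j k) \<le> (H * \<bar>k\<bar> ^ i) * (C * \<bar>k\<bar> ^ (j + e))"
        unfolding norm_mult using H by (intro mult_mono h C w y k) auto
      moreover have "cmod (c * (pp k ^ e - qq k ^ e) * (h k * neumann (w y) n j k)) \<le> (cmod c * (\<bar>k\<bar> ^ e + \<bar>k\<bar> ^ e)) * (H * B * \<bar>k\<bar> ^ (i + j))"
        unfolding norm_mult[of "c * _"] norm_mult[of c] using ij
        by (intro mult_mono order_trans[OF norm_triangle_ineq4] add_mono pp_pow_le qq_pow_le k hA y) auto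
      ultimately show "cmod (h k * neumann_deriv c e (w y) n j k + c * (pp k ^ e - qq k ^ e) * (h k * neumann (w y) n j k))
        \<le> (2 * cmod c * H * B + H * C) * \<bar>k\<bar> ^ (i + j + e)"
        by (intro order_trans[OF norm_triangle_ineq]) (simp add: power_add algebra_simps)
    qed
  next
    fix y assume y: "y \<in> X"
    note [measurable] = adm_meas[OF w[OF y]]
    show "integrable lborel (\<lambda>k. w y k * (h k * neumann (w y) n j k))"
      by (rule adm_integrable(1)[OF w[OF y], where c="H * B" and j="i+j"]) (use ij y in \<open>auto intro: hA\<close>)
  next
    note [measurable] = adm_meas[OF w[OF s]] measurable_neumann_deriv[OF w[OF s]]
    show "F' s \<in> borel_measurable lborel" unfolding F'_def by measurable
  qed
  moreover have "(\<integral>k. F' s k \<partial>lborel) = c * ((\<integral>k. w s k * (h k * neumann (w s) n (j + e) k) \<partial>lborel)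
      - (\<integral>k. w s k * (h k * qq k ^ e * neumann (w s) n j k) \<partial>lborel)
      + (\<Sum>a<n. \<Sum>l<e. (\<integral>k. w s k * (h k * neumann (w s) a (e - Suc l) k) \<partial>lborel) * cauchy_term (w s) (n - Suc a) l j))"
  proof -
    note [measurable] = adm_meas[OF w[OF s]]
    have i1: "integrable lborel (\<lambda>k. w s k * (h k * neumann (w s) n (j + e) k))"
      by (rule adm_integrable(1)[OF w[OF s], where c="H * B" and j="i+(j+e)"]) (use ij s in \<open>auto intro: hA\<close>)
    have i2: "integrable lborel (\<lambda>k. w s k * (h k * qq k ^ e * neumann (w s) n j k))"
      by (rule adm_integrable(1)[OF w[OF s], where c="H * B" and j="i+j+e"]) (use ij s in \<open>auto intro: b1\<close>)
    have i3: "integrable lborel (\<lambda>k. w s k * (h k * neumann (w s) a (e - Suc l) k))" if "l < e" for a l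
      by (rule adm_integrable(1)[OF w[OF s] _ hA[OF s]]) (use ij that in auto)
    have "F' s k = c * (w s k * (h k * neumann (w s) n (j + e) k) - w s k * (h k * qq k ^ e * neumann (w s) n j k)
      + (\<Sum>a<n. \<Sum>l<e. w s k * (h k * neumann (w s) a (e - Suc l) k) * cauchy_term (w s) (n - Suc a) l j))" for k
    proof -
      define Q where "Q = (\<Sum>a<n. \<Sum>l<e. neumann (w s) a (e - Suc l) k * cauchy_term (w s) (n - Suc a) l j)"
      have "(\<Sum>a<n. \<Sum>l<e. w s k * (h k * neumann (w s) a (e - Suc l) k) * cauchy_term (w s) (n - Suc a) l j) = w s k * h k * Q"
        by (simp add: Q_def sum_distrib_left mult.assoc)
      then show ?thesis unfolding F'_def neumann_deriv_def Q_def[symmetric] by (simp add: algebra_simps)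
    qed
    then have *: "F' s = (\<lambda>k. c * (w s k * (h k * neumann (w s) n (j + e) k) - w s k * (h k * qq k ^ e * neumann (w s) n j k)
      + (\<Sum>a<n. \<Sum>l<e. w s k * (h k * neumann (w s) a (e - Suc l) k) * cauchy_term (w s) (n - Suc a) l j)))" by (rule ext)
    show ?thesis unfolding *
      by (intro has_bochner_integral_integral_eq has_bochner_integral_diff has_bochner_integral_add has_bochner_integral_mult_right
            has_bochner_integral_mult_left has_bochner_integral_sum has_bochner_integral_integrable i1 i2 i3) auto
  qed
  ultimately show ?thesis by simp
qed

text \<open>Induction on n. Differentiating the outer integral leaves \<open>qq l ^ e\<close> next
  to the denominator pp k - qq l, and \<open>power_diff_kernel\<close> turns this into
  \<open>pp k ^ e\<close> times the same iterate minus separated terms.\<close>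

lemma neumann_derivative:
  assumes j: "j + e \<le> d" and s: "s \<in> X" and k: "\<bar>k\<bar> \<ge> 2"
  shows "((\<lambda>s. neumann (w s) n j k) has_vector_derivative neumann_deriv c e (w s) n j k) (at s within X)"
  using s k
proof (induction n arbitrary: s k)
  case 0
  show ?case by (simp add: neumann_deriv_def power_add mult.commute)
next
  case (Suc n)
  note [measurable] = adm_meas[OF w[OF Suc.prems(1)]]
  let ?h = "\<lambda>l. 1 / (pp k - qq l)"
  have hm: "?h \<in> borel_measurable borel" by measurable
  have hb: "cmod (?h l) \<le> 1 * \<bar>l\<bar> ^ 0" if "\<bar>l\<bar> \<ge> 2" for l
    using kernel_bounds(1)[OF Suc.prems(2) that] by simp
  have der: "((\<lambda>s. neumann (w s) (Suc n) j k) has_vector_derivative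
    c * ((\<integral>l. w s l * (?h l * neumann (w s) n (j + e) l) \<partial>lborel)
      - (\<integral>l. w s l * (?h l * qq l ^ e * neumann (w s) n j l) \<partial>lborel)
      + (\<Sum>a<n. \<Sum>b<e. (\<integral>l. w s l * (?h l * neumann (w s) a (e - Suc b) l) \<partial>lborel) * cauchy_term (w s) (n - Suc a) b j))) (at s within X)"
    unfolding neumann.simps using hb j Suc
    by (intro integral_derivative[OF hm, of 1 0]) auto
  have Q: "(\<integral>l. w s l * (?h l * qq l ^ e * neumann (w s) n j l) \<partial>lborel)
      = pp k ^ e * neumann (w s) (Suc n) j k - (\<Sum>b<e. pp k ^ (e - Suc b) * cauchy_term (w s) n b j)"
  proof -
    have i1: "integrable lborel (\<lambda>l. w s l * (?h l * neumann (w s) n j l))"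
    proof (rule adm_integrable(1)[OF w[OF Suc.prems(1)], where c="1 + mom d" and j=j])
      show "(\<lambda>l. ?h l * neumann (w s) n j l) \<in> borel_measurable borel" by measurable
      show "cmod (?h l * neumann (w s) n j l) \<le> (1 + mom d) * \<bar>l\<bar> ^ j" if "\<bar>l\<bar> \<ge> 2" for l
        using kernel_pow[OF Suc.prems(2) that neumann_bound[OF w[OF Suc.prems(1)] _ that]] j by simp
    qed (use j in simp)
    have i2: "integrable lborel (\<lambda>l. w s l * (qq l ^ b * neumann (w s) n j l))" if "b < e" for b
      by (rule cauchy_term_integrable[OF w[OF Suc.prems(1)]]) (use that j in simp)
    have "w s l * (?h l * qq l ^ e * neumann (w s) n j l) = pp k ^ e * (w s l * (?h l * neumann (w s) n j l))
       - (\<Sum>b<e. pp k ^ (e - Suc b) * (w s l * (qq l ^ b * neumann (w s) n j l)))" for l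
    proof (cases "\<bar>l\<bar> \<ge> 2")
      case True
      have "pp k - qq l \<noteq> 0" using pp_neq_qq Suc.prems(2) True by simp
      from power_diff_kernel[OF this, of e]
      have *: "?h l * qq l ^ e = ?h l * pp k ^ e - (\<Sum>b<e. pp k ^ (e - Suc b) * qq l ^ b)" by simp
      show ?thesis unfolding * by (simp add: left_diff_distrib right_diff_distrib sum_distrib_left sum_distrib_right mult_ac)
    next
      case False then show ?thesis using w_0[OF Suc.prems(1)] by simp
    qed
    then have "(\<integral>l. w s l * (?h l * qq l ^ e * neumann (w s) n j l) \<partial>lborel) = 
      (\<integral>l. pp k ^ e * (w s l * (?h l * neumann (w s) n j l))
       - (\<Sum>b<e. pp k ^ (e - Suc b) * (w s l * (qq l ^ b * neumann (w s) n j l))) \<partial>lborel)" by (simp only:)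
    also have "\<dots> = pp k ^ e * neumann (w s) (Suc n) j k - (\<Sum>b<e. pp k ^ (e - Suc b) * cauchy_term (w s) n b j)"
    proof -
      define f1 where "f1 l = w s l * (?h l * neumann (w s) n j l)" for l
      define f2 where "f2 b l = w s l * (qq l ^ b * neumann (w s) n j l)" for b l
      have "integrable lborel f1" "\<And>b. b < e \<Longrightarrow> integrable lborel (f2 b)"
        using i1 i2 unfolding f1_def f2_def by auto
      then show ?thesis
        unfolding neumann.simps cauchy_term_def f1_def[symmetric] f2_def[symmetric]
        by (intro has_bochner_integral_integral_eq has_bochner_integral_diff has_bochner_integral_mult_right
            has_bochner_integral_sum has_bochner_integral_integrable) auto
    qed
    finally show ?thesis .
  qed
  \<comment> \<open>The separated terms in \<open>Q\<close> are the summand a = 0 of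
    \<open>neumann_deriv\<close> for Suc n, because \<open>neumann w 0\<close> is a power of
    \<open>pp k\<close>; the summands already present move from a to Suc a.\<close>
  show ?case
    by (rule has_vector_derivative_eq_rhs[OF der],
        unfold Q neumann_deriv_def sum.lessThan_Suc_shift neumann.simps(2)[THEN fun_cong, symmetric])
      (simp add: algebra_simps del: neumann.simps(2))
qed

text \<open>At the left end of the chain there is no denominator to cancel: the surviving
  \<open>qq k ^ e\<close> just raises the index i.\<close>

lemma cauchy_term_derivative:
  assumes j: "i + j + e \<le> d" and s: "s \<in> X"
  shows "((\<lambda>s. cauchy_term (w s) n i j) has_vector_derivative
    c * (cauchy_term (w s) n i (j + e) - cauchy_term (w s) n (i + e) j
      + (\<Sum>l<e. \<Sum>a<n. cauchy_term (w s) a i (e - Suc l) * cauchy_term (w s) (n - Suc a) l j))) (at s within X)"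
  unfolding cauchy_term_def[of "w _" n i j]
  by (rule has_vector_derivative_eq_rhs, rule integral_derivative[where H=1 and i=i])
     (use j s in \<open>auto intro!: qq_pow_le neumann_derivative simp: cauchy_term_def[symmetric] power_add[symmetric]
        sum.swap[of _ "{..<e}" "{..<n}"]\<close>)

text \<open>The two factors of each product term have orders adding up to n - 1, so summation over n
  gives a Cauchy product shifted by one. The sign lost in this shift is the minus in front of the
  quadratic terms, which makes the system of Riccati type.\<close>

lemma cauchy_sum_derivative:
  assumes j: "i + j + e \<le> d" and s: "s \<in> X"
  shows "((\<lambda>s. cauchy_sum (w s) i j) has_vector_derivative
    c * (cauchy_sum (w s) i (j + e) - cauchy_sum (w s) (i + e) j - (\<Sum>l<e. cauchy_sum (w s) i (e - Suc l) * cauchy_sum (w s) l j))) (at s within X)"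
proof -
  define t where "t s n i j = (-1) ^ n * cauchy_term (w s) n i j" for s n i j
  \<comment> \<open>The value 0 at n = 0 implements the shift: entry Suc n' holds the n'-th
    coefficient of the Cauchy product.\<close>
  define G where "G s n i' j' = (case n of 0 \<Rightarrow> 0 | Suc n' \<Rightarrow> \<Sum>a\<le>n'. t s a i i' * t s (n' - a) j' j)" for s n i' j'
  have SSt: "(\<lambda>n. t s n i j) sums cauchy_sum (w s) i j" if "s \<in> X" "i + j \<le> d" for s i j
    unfolding cauchy_sum_def t_def using cauchy_sum_summable[OF w[OF that(1)] that(2)] by (intro summable_sums) (rule summable_norm_cancel)
  have tb: "cmod (t s n i j) \<le> term_const * (1/2) ^ n" if "s \<in> X" "i + j \<le> d" for s n i j
    using cauchy_term_bound[OF w[OF that(1)] that(2)] by (simp add: t_def norm_mult norm_power)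
  have Gs: "(\<lambda>n. G s n i' j') sums (cauchy_sum (w s) i i' * cauchy_sum (w s) j' j)" if "s \<in> X" "i + i' \<le> d" "j' + j \<le> d" for s i' j'
  proof -
    have "(\<lambda>n. G s (Suc n) i' j') sums ((\<Sum>n. t s n i i') * (\<Sum>n. t s n j' j))"
      unfolding G_def using cauchy_sum_summable[OF w[OF that(1)] that(2)] cauchy_sum_summable[OF w[OF that(1)] that(3)]
      by (auto intro!: Cauchy_product_sums simp: t_def)
    then show ?thesis
      using sums_unique[OF SSt[OF that(1,2)]] sums_unique[OF SSt[OF that(1,3)]]
      by (subst (asm) sums_Suc_iff) (simp add: G_def)
  qed
  \<comment> \<open>The convolution has n summands, all of the same geometric size, hence the
    majorant n / 2 ^ n instead of a pure geometric one.\<close>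
  have Gb: "cmod (G s n i' j') \<le> real n * term_const\<^sup>2 * 2 * (1/2) ^ n" if "s \<in> X" "i + i' \<le> d" "j' + j \<le> d" for s n i' j'
  proof (cases n)
    case 0 then show ?thesis by (simp add: G_def)
  next
    case (Suc n')
    have "cmod (G s n i' j') \<le> (\<Sum>a\<le>n'. (term_const * (1/2) ^ a) * (term_const * (1/2) ^ (n' - a)))"
      unfolding G_def Suc nat.case
      by (intro sum_norm_le) (auto simp: norm_mult term_const_nonneg intro!: mult_mono tb that)
    also have "\<dots> = (\<Sum>a\<le>n'. term_const\<^sup>2 * (1/2) ^ n')"
      by (intro sum.cong) (auto simp: power2_eq_square field_simps simp flip: power_add)
    finally show ?thesis using Suc by (simp add: mult_ac)
  qed
  define f' where "f' n s = c * (t s n i (j + e) - t s n (i + e) j - (\<Sum>l<e. G s n (e - Suc l) l))" for n s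
  have GT: "(-1) ^ n * (\<Sum>a<n. cauchy_term (w s) a i i' * cauchy_term (w s) (n - Suc a) j' j) = - G s n i' j'" for s n i' j'
  proof (cases n)
    case (Suc n')
    have "(-1) ^ Suc n' * (cauchy_term (w s) a i i' * cauchy_term (w s) (Suc n' - Suc a) j' j) = - (t s a i i' * t s (n' - a) j' j)" if "a \<le> n'" for a
    proof -
      have "(-1::complex) ^ n' = (-1) ^ a * (-1) ^ (n' - a)" using that by (simp flip: power_add)
      then show ?thesis by (simp add: t_def)
    qed
    then show ?thesis unfolding Suc G_def nat.case sum_distrib_left lessThan_Suc_atMost
      by (simp add: sum_negf)
  qed (simp add: G_def)
  have "((\<lambda>s. \<Sum>n. t s n i j) has_vector_derivative (\<Sum>n. f' n s)) (at s within X)"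
  proof (rule has_vector_derivative_series[OF X s])
    fix n y assume y: "y \<in> X"
    have "((\<lambda>s. t s n i j) has_vector_derivative (-1) ^ n * (c * (cauchy_term (w y) n i (j + e) - cauchy_term (w y) n (i + e) j
      + (\<Sum>l<e. \<Sum>a<n. cauchy_term (w y) a i (e - Suc l) * cauchy_term (w y) (n - Suc a) l j)))) (at y within X)"
      unfolding t_def by (intro has_vector_derivative_mult_right cauchy_term_derivative j y)
    moreover have "(-1) ^ n * (c * (cauchy_term (w y) n i (j + e) - cauchy_term (w y) n (i + e) j
      + (\<Sum>l<e. \<Sum>a<n. cauchy_term (w y) a i (e - Suc l) * cauchy_term (w y) (n - Suc a) l j))) = 
      c * (t y n i (j + e) - t y n (i + e) j + (\<Sum>l<e. (-1) ^ n * (\<Sum>a<n. cauchy_term (w y) a i (e - Suc l) * cauchy_term (w y) (n - Suc a) l j)))"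
      by (simp add: t_def sum_distrib_left algebra_simps)
    moreover have "\<dots> = f' n y" unfolding GT f'_def by (simp add: sum_negf)
    ultimately show "((\<lambda>s. t s n i j) has_vector_derivative f' n y) (at y within X)" by simp
    show "cmod (f' n y) \<le> cmod c * (2 * term_const * (1/2) ^ n + real e * (real n * term_const\<^sup>2 * 2 * (1/2) ^ n))"
    proof -
      have "cmod (\<Sum>l<e. G y n (e - Suc l) l) \<le> (\<Sum>l<e. real n * term_const\<^sup>2 * 2 * (1/2) ^ n)"
        using j by (intro sum_norm_le Gb y) auto
      moreover have "cmod (t y n i (j + e) - t y n (i + e) j) \<le> term_const * (1/2) ^ n + term_const * (1/2) ^ n"
        using j by (intro order_trans[OF norm_triangle_ineq4] add_mono tb y) auto
      ultimately have "cmod (t y n i (j + e) - t y n (i + e) j - (\<Sum>l<e. G y n (e - Suc l) l)) \<le>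
        2 * term_const * (1/2) ^ n + real e * (real n * term_const\<^sup>2 * 2 * (1/2) ^ n)"
        by (intro order_trans[OF norm_triangle_ineq4]) simp
      then show ?thesis unfolding f'_def norm_mult by (intro mult_left_mono) auto
    qed
    show "summable (\<lambda>n. t y n i j)" using SSt[OF y, of i j] j by (auto simp: sums_iff)
  next
    have "summable (\<lambda>n. real n * (1/2) ^ n)"
      using geometric_deriv_sums[of "1/2::real"] 
      by (subst summable_Suc_iff[symmetric]) (auto simp: sums_iff intro!: summable_mult2)
    then have "summable (\<lambda>n. real e * (term_const\<^sup>2 * 2 * (real n * (1/2) ^ n)))" by (intro summable_mult)
    moreover have "(\<lambda>n. real e * (term_const\<^sup>2 * 2 * (real n * (1/2) ^ n))) = (\<lambda>n. real e * (real n * term_const\<^sup>2 * 2 * (1/2) ^ n))"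
      by (simp only: mult_ac)
    ultimately have "summable (\<lambda>n. real e * (real n * term_const\<^sup>2 * 2 * (1/2) ^ n))" by (simp only:)
    then show "summable (\<lambda>n. cmod c * (2 * term_const * (1/2) ^ n + real e * (real n * term_const\<^sup>2 * 2 * (1/2) ^ n)))"
      by (intro summable_mult[of _ "cmod c"] summable_add[OF summable_half])
  qed
  moreover have "(\<lambda>n. f' n s) sums (c * (cauchy_sum (w s) i (j + e) - cauchy_sum (w s) (i + e) j - (\<Sum>l<e. cauchy_sum (w s) i (e - Suc l) * cauchy_sum (w s) l j)))"
    unfolding f'_def using j by (intro sums_mult sums_diff sums_sum SSt Gs s) auto
  ultimately show ?thesis by (simp add: cauchy_sum_def t_def sums_iff)
qed

end

end

section \<open>Transposition, conjugation symmetry, and the gain of one power\<close>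

text \<open>Iterates of the transposed operator, applied from the left to the power of
  \<open>qq\<close>.\<close>

primrec neumann_dual :: "(real \<Rightarrow> complex) \<Rightarrow> nat \<Rightarrow> nat \<Rightarrow> real \<Rightarrow> complex" where
  "neumann_dual w 0 i = (\<lambda>l. qq l ^ i)"
| "neumann_dual w (Suc n) i = (\<lambda>l. \<integral>k. w k * (neumann_dual w n i k / (pp k - qq l)) \<partial>lborel)"

lemma measurable_neumann_dual [measurable]:
  assumes [measurable]: "w \<in> borel_measurable borel"
  shows "neumann_dual w n j \<in> borel_measurable borel"
proof (induction n)
  case 0 show ?case by simp
next
  case (Suc n)
  note [measurable] = Suc
  show ?case unfolding neumann_dual.simps by measurable
qed

lemma integral_cnj_reflect:
  fixes f :: "real \<Rightarrow> complex"
  shows "cnj (\<integral>k. f k \<partial>lborel) = (\<integral>k. cnj (f (- k)) \<partial>lborel)"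
proof -
  have "(\<integral>k. cnj (f k) \<partial>lborel) = (\<integral>k. cnj (f (- k)) \<partial>lborel)"
    by (subst lborel_integral_real_affine[where c="-1" and t=0]) auto
  then show ?thesis by simp
qed

text \<open>Reflecting both variables and conjugating sends pp k - qq l to pp l - qq k, which is the
  transposed kernel.\<close>

lemma neumann_dual_eq_cnj_neumann:
  assumes w: "\<And>k. w (- k) = cnj (w k)"
  shows "neumann_dual w n i k = (- 1) ^ i * cnj (neumann w n i (- k))"
proof (induction n arbitrary: k)
  case 0
  show ?case by (simp add: power_minus[of "pp k"])
next
  case (Suc n)
  have "cnj (neumann w (Suc n) i (- k)) = (\<integral>l. w l * (cnj (neumann w n i (- l)) / (pp l - qq k)) \<partial>lborel)"
    unfolding neumann.simps integral_cnj_reflect by (simp add: w algebra_simps)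
  then show ?case
    by (simp only: neumann_dual.simps Suc.IH, subst integral_mult_right_zero[symmetric]) (simp add: mult_ac)
qed

context weight
begin

lemma neumann_dual_bound:
  assumes w: "adm w" and j: "j \<le> d" and k: "\<bar>k\<bar> \<ge> 2"
  shows "cmod (neumann_dual w n j k) \<le> (1 + mom d) * \<bar>k\<bar> ^ j"
  using k
proof (induction n arbitrary: k)
  case 0
  have "cmod (qq k ^ j) \<le> 1 * \<bar>k\<bar> ^ j" using qq_pow_le[OF 0] by simp
  also have "\<dots> \<le> (1 + mom d) * \<bar>k\<bar> ^ j" using mom_nonneg by (intro mult_right_mono) auto
  finally show ?case by simp
next
  case (Suc n)
  note [measurable] = adm_meas[OF w]
  have *: "cmod (neumann_dual w (Suc n) j k) \<le> mom d" if "\<bar>k\<bar> \<ge> 2" for k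
    using that
  proof (induction n arbitrary: k)
    case 0
    have "cmod (neumann_dual w (Suc 0) j k) \<le> 1 * mom j"
      unfolding neumann_dual.simps using j 0
      by (intro adm_integrable(2)[OF w]) (auto intro!: kernel_pow qq_pow_le)
    then show ?case using mom_le[OF j order_refl] by simp
  next
    case (Suc n)
    have "cmod (neumann_dual w (Suc (Suc n)) j k) \<le> mom d * mom 0"
      unfolding neumann_dual.simps(2)[of w "Suc n"]
      by (rule adm_integrable(2)[OF w]) (use Suc in \<open>auto intro!: kernel_pow simp del: neumann_dual.simps\<close>)
    also have "\<dots> \<le> mom d * 1" using mom_0 mom_nonneg by (intro mult_left_mono) auto
    finally show ?case by simp
  qed
  have "cmod (neumann_dual w (Suc n) j k) \<le> mom d * 1" using *[OF Suc.prems] by simp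
  also have "\<dots> \<le> (1 + mom d) * \<bar>k\<bar> ^ j" using Suc.prems mom_nonneg[of d] by (intro mult_mono) auto
  finally show ?case .
qed

text \<open>Fubini: one application of the operator moves from the right vector to the left one. The
  double integral converges absolutely because the kernel is bounded by 1, so that the integrand is
  dominated by a product of two moments.\<close>

lemma transpose_step:
  assumes w: "adm w" and i: "i \<le> d" and j: "j \<le> d"
  shows "(\<integral>k. w k * (neumann_dual w a i k * neumann w (Suc b) j k) \<partial>lborel) = (\<integral>k. w k * (neumann_dual w (Suc a) i k * neumann w b j k) \<partial>lborel)"
proof -
  note [measurable] = adm_meas[OF w]
  define f where "f k l = w k * w l * (neumann_dual w a i k * neumann w b j l / (pp k - qq l))" for k l
  have fm: "case_prod f \<in> borel_measurable (lborel \<Otimes>\<^sub>M lborel)"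
    unfolding f_def by measurable
  define B where "B = 1 + mom d"
  have B: "B \<ge> 0" by (simp add: B_def mom_nonneg)
  have fb: "cmod (f k l) \<le> (B * (\<bar>k\<bar> ^ i * m k)) * (B * (\<bar>l\<bar> ^ j * m l))" for k l
  proof (cases "\<bar>k\<bar> \<ge> 2 \<and> \<bar>l\<bar> \<ge> 2")
    case True
    have "cmod (neumann_dual w a i k) * cmod (neumann w b j l) \<le> (B * \<bar>k\<bar> ^ i) * (B * \<bar>l\<bar> ^ j)"
      unfolding B_def using True by (intro mult_mono neumann_dual_bound neumann_bound w i j) (auto simp: mom_nonneg)
    then have "cmod (neumann_dual w a i k * neumann w b j l / (pp k - qq l)) \<le> (B * \<bar>k\<bar> ^ i) * (B * \<bar>l\<bar> ^ j)"
      using True by (intro kernel_pow) (auto simp: norm_mult)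
    then have "cmod (w k) * cmod (w l) * cmod (neumann_dual w a i k * neumann w b j l / (pp k - qq l)) \<le> m k * m l * ((B * \<bar>k\<bar> ^ i) * (B * \<bar>l\<bar> ^ j))"
      by (intro mult_mono adm_le[OF w]) (auto simp: m_nonneg)
    then show ?thesis unfolding f_def norm_mult[of "w k * w l"] norm_mult[of "w k"] by (simp only: mult_ac)
  next
    case False
    then have "w k = 0 \<or> w l = 0" using adm_le[OF w, of k] adm_le[OF w, of l] m_supp[of k] m_supp[of l] by force
    then show ?thesis using B by (auto simp: f_def m_nonneg)
  qed
  have fI: "integrable (lborel \<Otimes>\<^sub>M lborel) (case_prod f)"
  proof (rule lborel_pair.Fubini_integrable[OF fm])
    have il: "integrable lborel (\<lambda>l. (B * (\<bar>l\<bar> ^ j * m l)))" using mom_int[OF j] by auto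
    have ifl: "integrable lborel (\<lambda>l. f k l)" for k
    proof (rule Bochner_Integration.integrable_bound)
      show "integrable lborel (\<lambda>l. (B * (\<bar>k\<bar> ^ i * m k)) * (B * (\<bar>l\<bar> ^ j * m l)))" using il by auto
      show "(\<lambda>l. f k l) \<in> borel_measurable lborel" unfolding f_def by measurable
    qed (auto intro: order_trans[OF fb abs_ge_self])
    then show "AE k in lborel. integrable lborel (\<lambda>l. case_prod f (k, l))" by simp
    show "integrable lborel (\<lambda>k. \<integral>l. norm (case_prod f (k, l)) \<partial>lborel)"
    proof (rule Bochner_Integration.integrable_bound)
      show "integrable lborel (\<lambda>k. B * (\<bar>k\<bar> ^ i * m k) * (B * mom j))" using mom_int[OF i] by auto
      show "(\<lambda>k. \<integral>l. norm (case_prod f (k, l)) \<partial>lborel) \<in> borel_measurable lborel" using fm by measurable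
      have "(\<integral>l. norm (f k l) \<partial>lborel) \<le> (\<integral>l. (B * (\<bar>k\<bar> ^ i * m k)) * (B * (\<bar>l\<bar> ^ j * m l)) \<partial>lborel)" for k
        using il ifl by (intro Bochner_Integration.integral_mono fb) auto
      then have "(\<integral>l. norm (f k l) \<partial>lborel) \<le> B * (\<bar>k\<bar> ^ i * m k) * (B * mom j)" for k
        by (simp add: mom_def)
      moreover have "0 \<le> (\<integral>l. norm (f k l) \<partial>lborel)" for k by simp
      ultimately show "AE k in lborel. norm (\<integral>l. norm (case_prod f (k, l)) \<partial>lborel) \<le> norm (B * (\<bar>k\<bar> ^ i * m k) * (B * mom j))"
        by (auto intro: order_trans[OF _ abs_ge_self])
    qed
  qed
  have "(\<integral>k. w k * (neumann_dual w a i k * neumann w (Suc b) j k) \<partial>lborel) = (\<integral>k. (\<integral>l. f k l \<partial>lborel) \<partial>lborel)"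
  proof (intro Bochner_Integration.integral_cong refl)
    fix k
    have "w k * (neumann_dual w a i k * neumann w (Suc b) j k) = (w k * neumann_dual w a i k) * (\<integral>l. w l * (1 / (pp k - qq l) * neumann w b j l) \<partial>lborel)"
      by simp
    also have "\<dots> = (\<integral>l. (w k * neumann_dual w a i k) * (w l * (1 / (pp k - qq l) * neumann w b j l)) \<partial>lborel)"
      by (rule integral_mult_right_zero[symmetric])
    finally show "w k * (neumann_dual w a i k * neumann w (Suc b) j k) = (\<integral>l. f k l \<partial>lborel)" by (simp add: f_def mult_ac)
  qed
  also have "\<dots> = (\<integral>l. (\<integral>k. f k l \<partial>lborel) \<partial>lborel)"
    using lborel_pair.Fubini_integral[OF fI] by simp
  also have "\<dots> = (\<integral>k. w k * (neumann_dual w (Suc a) i k * neumann w b j k) \<partial>lborel)"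
  proof (intro Bochner_Integration.integral_cong refl)
    fix l
    have "w l * (neumann_dual w (Suc a) i l * neumann w b j l) = (w l * neumann w b j l) * (\<integral>k. w k * (neumann_dual w a i k / (pp k - qq l)) \<partial>lborel)"
      by simp
    also have "\<dots> = (\<integral>k. (w l * neumann w b j l) * (w k * (neumann_dual w a i k / (pp k - qq l))) \<partial>lborel)"
      by (rule integral_mult_right_zero[symmetric])
    finally show "(\<integral>k. f k l \<partial>lborel) = w l * (neumann_dual w (Suc a) i l * neumann w b j l)" by (simp add: f_def mult_ac)
  qed
  finally show ?thesis .
qed

text \<open>The second form keeps exactly one iterate on the left. That iterate is a single
  oscillatory integral in which decay in x can be seen, while the right factor is bounded in
  modulus.\<close>

lemma cauchy_term_eq_neumann_dual:
  assumes w: "adm w" and i: "i \<le> d" and j: "j \<le> d"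
  shows "cauchy_term w n i j = (\<integral>k. w k * (neumann_dual w n i k * pp k ^ j) \<partial>lborel)"
    and "cauchy_term w (Suc n) i j = (\<integral>k. w k * (neumann_dual w 1 i k * neumann w n j k) \<partial>lborel)"
proof -
  have "(\<integral>k. w k * (neumann_dual w a i k * neumann w b j k) \<partial>lborel) = cauchy_term w (a + b) i j" for a b
  proof (induction a arbitrary: b)
    case 0 show ?case by (simp add: cauchy_term_def)
  next
    case (Suc a)
    show ?case unfolding transpose_step[OF w i j, symmetric] Suc.IH by simp
  qed
  from this[of n 0] this[of 1 n]
  show "cauchy_term w n i j = (\<integral>k. w k * (neumann_dual w n i k * pp k ^ j) \<partial>lborel)"
    and "cauchy_term w (Suc n) i j = (\<integral>k. w k * (neumann_dual w 1 i k * neumann w n j k) \<partial>lborel)"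
    by simp_all
qed

text \<open>Conjugation composed with reflection is transposition and exchanges the two indices; the
  sign comes from the oddness of \<open>pp\<close> and \<open>qq\<close>. This symmetry is behind
  the reality of the solution.\<close>

lemma cauchy_term_cnj:
  assumes w: "adm w" and sym: "\<And>k. w (- k) = cnj (w k)" and i: "i \<le> d" and j: "j \<le> d"
  shows "cauchy_term w n i j = (- 1) ^ (i + j) * cnj (cauchy_term w n j i)"
proof -
  have "cnj (cauchy_term w n j i) = (\<integral>k. w k * ((- 1) ^ j * pp k ^ j * cnj (neumann w n i (- k))) \<partial>lborel)"
    unfolding cauchy_term_def integral_cnj_reflect by (simp add: sym power_minus[of "pp _"])
  also have "\<dots> = (\<integral>k. (- 1) ^ (i + j) * (w k * (neumann_dual w n i k * pp k ^ j)) \<partial>lborel)"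
    by (intro Bochner_Integration.integral_cong refl)
       (simp add: neumann_dual_eq_cnj_neumann[of w, OF sym] power_add power_mult_distrib[symmetric] mult_ac)
  also have "\<dots> = (- 1) ^ (i + j) * cauchy_term w n i j" unfolding cauchy_term_eq_neumann_dual(1)[OF w i j] by simp
  finally show ?thesis by (simp flip: power_add power_mult_distrib)
qed

lemma cauchy_sum_cnj:
  assumes w: "adm w" and sym: "\<And>k. w (- k) = cnj (w k)" and ij: "i + j \<le> d"
  shows "cauchy_sum w i j = (- 1) ^ (i + j) * cnj (cauchy_sum w j i)"
proof -
  have "(\<lambda>n. (- 1) ^ n * cauchy_term w n j i) sums cauchy_sum w j i"
    unfolding cauchy_sum_def using cauchy_sum_summable[OF w, of j i] ij by (intro summable_sums) (auto intro: summable_norm_cancel)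
  then have "(\<lambda>n. (- 1) ^ (i + j) * cnj ((- 1) ^ n * cauchy_term w n j i)) sums ((- 1) ^ (i + j) * cnj (cauchy_sum w j i))"
    by (intro sums_mult) (simp only: sums_cnj)
  moreover have "(- 1) ^ (i + j) * cnj ((- 1) ^ n * cauchy_term w n j i) = (- 1) ^ n * cauchy_term w n i j" for n
    using cauchy_term_cnj[OF w sym, of i j n] ij by simp
  ultimately have "(\<lambda>n. (- 1) ^ n * cauchy_term w n i j) sums ((- 1) ^ (i + j) * cnj (cauchy_sum w j i))" by (simp only:)
  then show ?thesis unfolding cauchy_sum_def[of w i j] by (rule sums_unique[symmetric])
qed

text \<open>Nothing is assumed about the term n = 0, so this also applies at order d + 1, where no
  moment of \<open>m\<close> bounds the linear term.\<close>

lemma cauchy_sum_minus_cauchy_term_0: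
  assumes b: "\<And>n. cmod (cauchy_term w (Suc n) i j) \<le> C * (1/2) ^ n"
  shows "cmod (cauchy_sum w i j - cauchy_term w 0 i j) \<le> 2 * C"
proof -
  have s: "summable (\<lambda>n. (- 1) ^ Suc n * cauchy_term w (Suc n) i j)"
    by (rule summable_comparison_test'[OF summable_half[of C]]) (use b in \<open>auto simp: norm_mult norm_power\<close>)
  then have s': "summable (\<lambda>n. (- 1) ^ n * cauchy_term w n i j)"
    by (subst (asm) summable_Suc_iff)
  have "cauchy_sum w i j - cauchy_term w 0 i j = (\<Sum>n. (- 1) ^ Suc n * cauchy_term w (Suc n) i j)"
    unfolding cauchy_sum_def suminf_split_head[OF s'] by simp
  also have "cmod \<dots> \<le> (\<Sum>n. C * (1/2::real) ^ n)"
    by (rule norm_suminf_le[OF _ summable_half]) (use b in \<open>auto simp: norm_mult norm_power\<close>)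
  also have "\<dots> = 2 * C" by (simp add: suminf_mult summable_geometric suminf_geometric)
  finally show ?thesis .
qed

text \<open>In every term of the series the leftmost factor is either the linear term or
  \<open>neumann_dual w 1\<close>. If these two are at most \<open>h\<close>, a quantity decaying in
  x, the whole sum inherits the bound.\<close>

lemma cauchy_sum_decay:
  assumes w: "adm w" and i: "i \<le> d" and j: "j \<le> d"
    and h: "\<And>l. \<bar>l\<bar> \<ge> 2 \<Longrightarrow> cmod (neumann_dual w 1 i l) \<le> h" and h0: "cmod (cauchy_term w 0 i j) \<le> h"
  shows "cmod (cauchy_sum w i j) \<le> h * (1 + 2 * mom j)"
proof -
  note [measurable] = adm_meas[OF w]
  have hp: "h \<ge> 0" using h0 norm_ge_zero order_trans by blast
  have "cmod (cauchy_term w (Suc n) i j) \<le> h * mom j * (1/2) ^ n" for n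
  proof (cases n)
    case 0
    have "cmod (cauchy_term w (Suc n) i j) \<le> h * mom j"
      unfolding cauchy_term_eq_neumann_dual(2)[OF w i j] 0
      by (rule adm_integrable(2)[OF w _ _ j])
         (auto simp: norm_mult simp del: neumann_dual.simps One_nat_def intro!: mult_mono h pp_pow_le hp)
    then show ?thesis using 0 by simp
  next
    case (Suc n')
    have "cmod (cauchy_term w (Suc n) i j) \<le> h * ((1/2) ^ n' * mom j) * mom 0"
      unfolding cauchy_term_eq_neumann_dual(2)[OF w i j] Suc
      by (rule adm_integrable(2)[OF w])
         (auto simp: norm_mult simp del: neumann_dual.simps neumann.simps One_nat_def intro!: mult_mono h neumann_Suc_bound w j hp)
    also have "\<dots> \<le> h * ((1/2) ^ n' * mom j) * (1/2)"
      using hp by (intro mult_left_mono mom_0) (auto simp: mom_nonneg)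
    finally show ?thesis using Suc by (simp add: mult_ac)
  qed
  from cauchy_sum_minus_cauchy_term_0[OF this]
  have "cmod (cauchy_sum w i j - cauchy_term w 0 i j) \<le> 2 * (h * mom j)" .
  then have "cmod (cauchy_sum w i j) \<le> h + 2 * (h * mom j)"
    using h0 norm_triangle_sub[of "cauchy_sum w i j" "cauchy_term w 0 i j"] by linarith
  then show ?thesis by (simp add: algebra_simps)
qed

text \<open>The surplus factor \<open>qq k\<close> is moved under the first integral, where qq k /
  (pp k - qq l) is bounded by 4. The remaining powers are at most d on either side.\<close>

lemma cauchy_term_top_bound:
  assumes w: "adm w" and i: "i \<le> d" and j: "j \<le> d"
  shows "cmod (cauchy_term w (Suc n) (Suc i) j) \<le> 4 * (mom d)\<^sup>2 * (1/2) ^ n"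
proof -
  note [measurable] = adm_meas[OF w]
  have b: "cmod (qq k * neumann w (Suc n) j k) \<le> 4 * mom d * (1/2) ^ n" if k: "\<bar>k\<bar> \<ge> 2" for k
  proof -
    have eq: "qq k * neumann w (Suc n) j k = (\<integral>l. w l * (qq k / (pp k - qq l) * neumann w n j l) \<partial>lborel)"
      unfolding neumann.simps by (subst integral_mult_right_zero[symmetric]) (simp add: mult_ac)
    show ?thesis
    proof (cases n)
      case 0
      have "cmod (qq k * neumann w (Suc 0) j k) \<le> 4 * mom j"
        unfolding eq[unfolded 0 neumann.simps(1)]
      proof (rule adm_integrable(2)[OF w _ _ j])
        show "cmod (qq k / (pp k - qq l) * pp l ^ j) \<le> 4 * \<bar>l\<bar> ^ j" if "\<bar>l\<bar> \<ge> 2" for l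
          unfolding norm_mult using k that by (intro mult_mono kernel_bounds pp_pow_le) auto
      qed measurable
      then show ?thesis using 0 mom_le[OF j order_refl] by simp
    next
      case (Suc n')
      have "cmod (qq k * neumann w (Suc n) j k) \<le> 4 * ((1/2) ^ n' * mom j) * mom 0"
        unfolding eq
      proof (rule adm_integrable(2)[OF w])
        show "cmod (qq k / (pp k - qq l) * neumann w n j l) \<le> 4 * ((1/2) ^ n' * mom j) * \<bar>l\<bar> ^ 0" if "\<bar>l\<bar> \<ge> 2" for l
          unfolding norm_mult power_0 mult_1_right Suc using k that by (intro mult_mono kernel_bounds neumann_Suc_bound w j) auto
      qed simp_all
      also have "\<dots> \<le> 4 * ((1/2) ^ n' * mom d) * (1/2)"
        using mom_le[OF j order_refl] mom_0 by (intro mult_mono) (auto simp: mom_nonneg)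
      finally show ?thesis using Suc by simp
    qed
  qed
  have "cmod (cauchy_term w (Suc n) (Suc i) j) = cmod (\<integral>k. w k * (qq k ^ i * (qq k * neumann w (Suc n) j k)) \<partial>lborel)"
    unfolding cauchy_term_def by (simp only: power_Suc mult_ac)
  also have "\<dots> \<le> (4 * mom d * (1/2) ^ n) * mom i"
  proof (rule adm_integrable(2)[OF w _ _ i])
    fix k :: real assume k: "\<bar>k\<bar> \<ge> 2"
    have "cmod (qq k ^ i) * cmod (qq k * neumann w (Suc n) j k) \<le> \<bar>k\<bar> ^ i * (4 * mom d * (1/2) ^ n)"
      by (intro mult_mono qq_pow_le k b) auto
    then show "cmod (qq k ^ i * (qq k * neumann w (Suc n) j k)) \<le> 4 * mom d * (1/2) ^ n * \<bar>k\<bar> ^ i"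
      by (simp add: norm_mult mult_ac)
  qed measurable
  also have "\<dots> \<le> (4 * mom d * (1/2) ^ n) * mom d"
    using mom_le[OF i order_refl] by (intro mult_left_mono) (auto simp: mom_nonneg)
  finally show ?thesis by (simp add: power2_eq_square mult_ac)
qed

text \<open>One denominator absorbs one power of the spectral variable, so only the linear term sees the
  divergent moment of order \<open>d + 1\<close>.\<close>

lemma cauchy_sum_top:
  assumes w: "adm w" and ij: "i + j = Suc d"
    and sym: "\<And>n. cmod (cauchy_term w n 0 (Suc d)) = cmod (cauchy_term w n (Suc d) 0)"
  shows "cmod (cauchy_sum w i j - cauchy_term w 0 i j) \<le> 2 * (4 * (mom d)\<^sup>2)"
proof (rule cauchy_sum_minus_cauchy_term_0)
  fix n
  show "cmod (cauchy_term w (Suc n) i j) \<le> 4 * (mom d)\<^sup>2 * (1/2) ^ n"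
  \<comment> \<open>For i = 0 there is no factor \<open>qq\<close> on the left to be absorbed;
    \<open>sym\<close> then exchanges the two indices.\<close>
  proof (cases i)
    case 0
    then show ?thesis using cauchy_term_top_bound[OF w, of d 0 n] ij sym[of "Suc n"] by simp
  next
    case (Suc i')
    then show ?thesis using cauchy_term_top_bound[OF w, of i' j n] ij by simp
  qed
qed

end

section \<open>Oscillatory integrals\<close>

lemma has_bochner_integral_powr_to_inf:
  fixes e a :: real
  assumes "e < -1" "a > 0"
  shows "has_bochner_integral lborel (\<lambda>x. indicator {a..} x * x powr e) (- (a powr (e + 1)) / (e + 1))"
proof (rule has_bochner_integral_nn_integral)
  have I: "((\<lambda>x. indicator {a..} x * x powr e) has_integral - (a powr (e + 1)) / (e + 1)) UNIV"
    using has_integral_powr_to_inf[OF assms] has_integral_restrict_UNIV[of "{a..}" "\<lambda>x. x powr e"]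
    by (simp add: indicator_def of_bool_def if_distrib[of "\<lambda>c. c * _"] cong: if_cong)
  show "(\<integral>\<^sup>+x. ennreal (indicator {a..} x * x powr e) \<partial>lborel) = ennreal (- (a powr (e + 1)) / (e + 1))"
    by (rule nn_integral_has_integral_lborel[OF _ _ I]) auto
  show "0 \<le> - (a powr (e + 1)) / (e + 1)" using assms by (auto simp: divide_nonneg_neg divide_nonpos_neg)
qed auto

lemma has_bochner_integral_powr_from_0:
  fixes e c :: real
  assumes "e > -1" "c \<ge> 0"
  shows "has_bochner_integral lborel (\<lambda>x. indicator {0..c} x * x powr e) (c powr (e + 1) / (e + 1))"
proof (rule has_bochner_integral_nn_integral)
  have I: "((\<lambda>x. indicator {0..c} x * x powr e) has_integral c powr (e + 1) / (e + 1)) UNIV"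
    using has_integral_powr_from_0[OF assms] has_integral_restrict_UNIV[of "{0..c}" "\<lambda>x. x powr e"]
    by (simp add: indicator_def of_bool_def if_distrib[of "\<lambda>c. c * _"] cong: if_cong)
  show "(\<integral>\<^sup>+x. ennreal (indicator {0..c} x * x powr e) \<partial>lborel) = ennreal (c powr (e + 1) / (e + 1))"
    by (rule nn_integral_has_integral_lborel[OF _ _ I]) auto
  show "0 \<le> c powr (e + 1) / (e + 1)" using assms by auto
qed auto

lemma pow_le_fact_exp:
  assumes "x \<ge> (0::real)" shows "x ^ n \<le> fact n * exp x"
proof -
  have s: "summable (\<lambda>n. inverse (fact n) * x ^ n)" by (rule summable_exp)
  have "inverse (fact n) * x ^ n = (\<Sum>k\<in>{n}. inverse (fact k) * x ^ k)" by simp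
  also have "\<dots> \<le> (\<Sum>k. inverse (fact k) * x ^ k)"
    by (rule sum_le_suminf[OF s]) (use assms in auto)
  also have "\<dots> = exp x" by (simp add: exp_def)
  finally show ?thesis by (simp add: field_simps)
qed

text \<open>For \<bar>k\<bar> \<ge> 2 the exponent \<open>la k * \<tau>\<close> is at least y =
  \<bar>k\<bar> * (\<eta> / 2), and y ^ n is at most n! exp y. This is the source of all moments,
  and of all spatial decay, at times before T.\<close>

lemma pow_exp_la_bounded:
  assumes "\<eta> > 0"
  shows "\<exists>C\<ge>0. \<forall>k \<tau>. \<bar>k\<bar> \<ge> 2 \<longrightarrow> \<eta> \<le> \<tau> \<longrightarrow> \<bar>k\<bar> ^ n * exp (- la k * \<tau>) \<le> C"
proof (intro exI[of _ "fact n * (2 / \<eta>) ^ n"] conjI allI impI)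
  show "0 \<le> fact n * (2 / \<eta>) ^ n" using assms by simp
  fix k \<tau> :: real assume k: "\<bar>k\<bar> \<ge> 2" and \<tau>: "\<eta> \<le> \<tau>"
  have "\<bar>k\<bar> * 1 \<le> \<bar>k\<bar> * \<bar>k\<bar>" using k by (intro mult_left_mono) auto
  then have "\<bar>k\<bar> \<le> k\<^sup>2" by (simp add: power2_eq_square)
  then have "\<bar>k\<bar> * (\<eta> / 2) \<le> (k\<^sup>2 / 2) * \<eta>" using assms by simp
  also have "\<dots> \<le> la k * \<tau>" using la_lower[OF k] \<tau> assms order_trans[OF _ la_lower[OF k], of 0] by (intro mult_mono) auto
  finally have "exp (- la k * \<tau>) \<le> exp (- (\<bar>k\<bar> * (\<eta> / 2)))" by simp
  moreover have "(\<bar>k\<bar> * (\<eta> / 2)) ^ n \<le> fact n * exp (\<bar>k\<bar> * (\<eta> / 2))" using assms by (intro pow_le_fact_exp) auto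
  ultimately have "(\<bar>k\<bar> * (\<eta> / 2)) ^ n * exp (- la k * \<tau>) \<le> (fact n * exp (\<bar>k\<bar> * (\<eta> / 2))) * exp (- (\<bar>k\<bar> * (\<eta> / 2)))"
    by (intro mult_mono) auto
  also have "\<dots> = fact n" by (simp add: exp_minus)
  finally have "(\<bar>k\<bar> * (\<eta> / 2)) ^ n * exp (- la k * \<tau>) \<le> fact n" .
  then have "(\<bar>k\<bar> ^ n * exp (- la k * \<tau>)) * (\<eta> / 2) ^ n \<le> fact n" by (simp only: power_mult_distrib mult_ac)
  then show "\<bar>k\<bar> ^ n * exp (- la k * \<tau>) \<le> fact n * (2 / \<eta>) ^ n"
    using assms by (simp add: power_divide field_simps)
qed

lemma integrable_inverse_square_tail: "integrable lborel (\<lambda>k::real. indicator {k. \<bar>k\<bar> \<ge> 2} k / k\<^sup>2)"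
proof -
  have "integrable lborel (\<lambda>x. indicator {2..} x * x powr (-2 :: real))"
    using has_bochner_integral_powr_to_inf[of "-2" 2] by (auto simp: has_bochner_integral_iff)
  moreover have "indicator {2..} x * x powr (-2 :: real) = indicator {2..} x / x\<^sup>2" for x :: real
    by (auto simp: indicator_def powr_minus powr_numeral divide_inverse)
  ultimately have 1: "integrable lborel (\<lambda>x::real. indicator {2..} x / x\<^sup>2)" by simp
  then have 2: "integrable lborel (\<lambda>x::real. indicator {2..} (- x) / (- x)\<^sup>2)"
    using lborel_integrable_real_affine[of "\<lambda>x::real. indicator {2..} x / x\<^sup>2" "-1" 0] by simp
  have "(\<lambda>k::real. indicator {k. \<bar>k\<bar> \<ge> 2} k / k\<^sup>2) = (\<lambda>x::real. indicator {2..} x / x\<^sup>2 + indicator {2..} (- x) / (- x)\<^sup>2)"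
    by (rule ext) (auto simp: indicator_def of_bool_def)
  then show ?thesis using Bochner_Integration.integrable_add[OF 1 2] by (simp only:)
qed

text \<open>The fundamental theorem on [-n, n] and dominated convergence. Applied to a product it is
  integration by parts on the whole line without boundary terms.\<close>

lemma integral_vector_derivative_zero:
  fixes H :: "real \<Rightarrow> complex"
  assumes d: "\<And>k. (H has_vector_derivative H' k) (at k)" and i: "integrable lborel H'"
    and top: "(H \<longlongrightarrow> 0) at_top" and bot: "(H \<longlongrightarrow> 0) at_bot"
  shows "(\<integral>k. H' k \<partial>lborel) = 0"
proof -
  define A where "A n = {- real n .. real n}" for n
  have eq: "(\<integral>k. indicator (A n) k *\<^sub>R H' k \<partial>lborel) = H (real n) - H (- real n)" for n
  proof -
    have s: "set_integrable lborel (A n) H'"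
      unfolding set_integrable_def using i by (intro integrable_mult_indicator) (auto simp: A_def)
    have "(H' has_integral (H (real n) - H (- real n))) (A n)"
      unfolding A_def by (rule fundamental_theorem_of_calculus) (auto intro: has_vector_derivative_at_within d)
    then show ?thesis
      using set_borel_integral_eq_integral(2)[OF s] by (simp add: set_lebesgue_integral_def integral_unique)
  qed
  have "(\<lambda>n. \<integral>k. indicator (A n) k *\<^sub>R H' k \<partial>lborel) \<longlonglongrightarrow> (\<integral>k. H' k \<partial>lborel)"
  proof (rule integral_dominated_convergence[where w="\<lambda>k. norm (H' k)"])
    show "integrable lborel (\<lambda>k. norm (H' k))" using i by simp
    show "AE k in lborel. (\<lambda>n. indicator (A n) k *\<^sub>R H' k) \<longlonglongrightarrow> H' k"
    proof (rule AE_I2)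
      fix k :: real
      have "\<forall>\<^sub>F n in sequentially. indicator (A n) k *\<^sub>R H' k = H' k"
        using eventually_ge_at_top[of "nat \<lceil>\<bar>k\<bar>\<rceil>"] 
      proof eventually_elim
        case (elim n)
        then have "\<bar>k\<bar> \<le> real n" by linarith
        then show ?case by (auto simp: A_def indicator_def)
      qed
      then show "(\<lambda>n. indicator (A n) k *\<^sub>R H' k) \<longlonglongrightarrow> H' k" by (rule tendsto_eventually)
    qed
    show "H' \<in> borel_measurable lborel" using i by auto
    then show "(\<lambda>k. indicator (A n) k *\<^sub>R H' k) \<in> borel_measurable lborel" for n by (auto simp: A_def)
    show "AE k in lborel. norm (indicator (A n) k *\<^sub>R H' k) \<le> norm (H' k)" for n
      by (auto simp: indicator_def)
  qed
  moreover have "(\<lambda>n. H (real n) - H (- real n)) \<longlonglongrightarrow> 0 - 0"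
    by (intro tendsto_diff filterlim_compose[OF top] filterlim_compose[OF bot] filterlim_real_sequentially
        filterlim_compose[OF filterlim_uminus_at_bot_at_top])
  ultimately show ?thesis unfolding eq using LIMSEQ_unique by fastforce
qed

lemma rr_nonzero: "\<bar>k\<bar> > 1 \<Longrightarrow> rr k \<noteq> 0"
  using rr_sq[of k] abs_square_eq_1[of k] by auto

lemma rr_deriv: assumes "\<bar>k\<bar> > 1"
  shows "(rr has_real_derivative k / rr k) (at k)"
proof -
  have k2: "k\<^sup>2 - 1 > 0" using assms abs_square_le_1[of k] by linarith
  show ?thesis
  proof (cases "k > 0")
    case True
    have "((\<lambda>k. sqrt (k\<^sup>2 - 1)) has_real_derivative k / rr k) (at k)"
      using k2 True by (auto intro!: derivative_eq_intros simp: rr_def field_simps)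
    then show ?thesis
      by (rule has_field_derivative_transform_within_open[where S="{0<..}"]) (use True in \<open>auto simp: rr_def\<close>)
  next
    case False
    then have "k < 0" using assms by auto
    have "((\<lambda>k. - sqrt (k\<^sup>2 - 1)) has_real_derivative k / rr k) (at k)"
      using k2 \<open>k < 0\<close> by (auto intro!: derivative_eq_intros simp: rr_def field_simps)
    then show ?thesis
      by (rule has_field_derivative_transform_within_open[where S="{..<0}"]) (use \<open>k < 0\<close> in \<open>auto simp: rr_def\<close>)
  qed
qed

lemma la_deriv: assumes "\<bar>k\<bar> > 1"
  shows "(la has_real_derivative rr k + k * (k * (1 / rr k))) (at k)"
  unfolding la_def using rr_deriv[OF assms] by (auto intro!: derivative_eq_intros)

text \<open>The arguments are the time to blow-up, a spectral parameter and the integration variable; the algebra is closed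
  under differentiation in the last one, which allows repeated integration by parts.\<close>

inductive symb :: "(real \<Rightarrow> real \<Rightarrow> real \<Rightarrow> complex) \<Rightarrow> bool" where
  symb_const: "symb (\<lambda>\<tau> l k. c)"
| symb_tau: "symb (\<lambda>\<tau> l k. of_real \<tau>)"
| symb_id: "symb (\<lambda>\<tau> l k. of_real k)"
| symb_rr: "symb (\<lambda>\<tau> l k. of_real (rr k))"
| symb_inv: "symb (\<lambda>\<tau> l k. of_real (1 / rr k))"
| symb_ker: "symb (\<lambda>\<tau> l k. 1 / (pp k - qq l))"
| symb_add: "symb f \<Longrightarrow> symb g \<Longrightarrow> symb (\<lambda>\<tau> l k. f \<tau> l k + g \<tau> l k)"
| symb_mult: "symb f \<Longrightarrow> symb g \<Longrightarrow> symb (\<lambda>\<tau> l k. f \<tau> l k * g \<tau> l k)"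

lemma symb_pow: "symb f \<Longrightarrow> symb (\<lambda>\<tau> l k. f \<tau> l k ^ n)"
  by (induction n) (auto intro: symb_const symb_mult)

lemma symb_pp: "symb (\<lambda>\<tau> l k. pp k)" and symb_qq: "symb (\<lambda>\<tau> l k. qq k)"
proof -
  have "symb (\<lambda>\<tau> l k. of_real (1 / (2 * sqrt 3)) * of_real (rr k) + \<i> / 2 * of_real k)"
    "symb (\<lambda>\<tau> l k. of_real (1 / (2 * sqrt 3)) * of_real (rr k) + (- \<i> / 2) * of_real k)"
    by (intro symb_add symb_mult symb_const symb_rr symb_id)+
  then show "symb (\<lambda>\<tau> l k. pp k)" "symb (\<lambda>\<tau> l k. qq k)"
    by (simp_all add: pp_def qq_def)
qed

lemma symb_measurable: "symb g \<Longrightarrow> g \<tau> l \<in> borel_measurable borel"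
proof (induction rule: symb.induct)
  case (symb_add f g) then show ?case by (intro borel_measurable_add)
next
  case (symb_mult f g) then show ?case by (intro borel_measurable_times)
qed measurable

text \<open>Polynomial growth suffices: for \<tau> \<ge> \<eta> > 0 the wave factor beats every
  power of k. Uniformity in l and in \<tau> \<le> T is built in.\<close>

lemma symb_bound:
  assumes "symb g"
  shows "\<exists>C n. C \<ge> 0 \<and> (\<forall>\<tau> l k. 0 \<le> \<tau> \<longrightarrow> \<tau> \<le> T \<longrightarrow> \<bar>l\<bar> \<ge> 2 \<longrightarrow> \<bar>k\<bar> \<ge> 2 \<longrightarrow> cmod (g \<tau> l k) \<le> C * \<bar>k\<bar> ^ n)"
  using assms
proof induction
  case (symb_const c) show ?case by (rule exI[of _ "cmod c"], rule exI[of _ 0]) auto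
next
  case symb_tau show ?case by (rule exI[of _ "\<bar>T\<bar>"], rule exI[of _ 0]) auto
next
  case symb_id show ?case by (rule exI[of _ 1], rule exI[of _ 1]) auto
next
  case symb_rr show ?case by (rule exI[of _ 1], rule exI[of _ 1]) (auto intro: abs_rr_le)
next
  case symb_inv
  have "cmod (of_real (1 / rr k)) \<le> 1" if "\<bar>k\<bar> \<ge> 2" for k
  proof -
    have "1 * 1 \<le> sqrt 3 / 2 * \<bar>k\<bar>" using that mult_mono[of 1 "sqrt 3" 2 "\<bar>k\<bar>"] by simp
    then have "\<bar>rr k\<bar> \<ge> 1" using abs_rr_ge[OF that] by linarith
    then show ?thesis by (simp add: norm_divide divide_le_eq)
  qed
  then show ?case by (intro exI[of _ 1] exI[of _ 0]) auto
next
  case symb_ker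
  show ?case by (rule exI[of _ 1], rule exI[of _ 0]) (use kernel_bounds(1) in auto)
next
  case (symb_add f g)
  then obtain C n D m where CD: "C \<ge> 0" "D \<ge> 0"
    "\<And>\<tau> l k. 0 \<le> \<tau> \<Longrightarrow> \<tau> \<le> T \<Longrightarrow> \<bar>l\<bar> \<ge> 2 \<Longrightarrow> \<bar>k\<bar> \<ge> 2 \<Longrightarrow> cmod (f \<tau> l k) \<le> C * \<bar>k\<bar> ^ n"
    "\<And>\<tau> l k. 0 \<le> \<tau> \<Longrightarrow> \<tau> \<le> T \<Longrightarrow> \<bar>l\<bar> \<ge> 2 \<Longrightarrow> \<bar>k\<bar> \<ge> 2 \<Longrightarrow> cmod (g \<tau> l k) \<le> D * \<bar>k\<bar> ^ m" by blast
  have "cmod (f \<tau> l k + g \<tau> l k) \<le> (C + D) * \<bar>k\<bar> ^ (n + m)"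
    if "0 \<le> \<tau>" "\<tau> \<le> T" "\<bar>l\<bar> \<ge> 2" "\<bar>k\<bar> \<ge> 2" for \<tau> l k
  proof -
    have "C * \<bar>k\<bar> ^ n \<le> C * \<bar>k\<bar> ^ (n + m)" "D * \<bar>k\<bar> ^ m \<le> D * \<bar>k\<bar> ^ (n + m)"
      using that CD by (auto intro!: mult_left_mono power_increasing)
    then show ?thesis using CD(3,4)[OF that] norm_triangle_ineq[of "f \<tau> l k" "g \<tau> l k"] by (simp add: distrib_right)
  qed
  then show ?case using CD by (intro exI[of _ "C + D"] exI[of _ "n + m"]) auto
next
  case (symb_mult f g)
  then obtain C n D m where CD: "C \<ge> 0" "D \<ge> 0"
    "\<And>\<tau> l k. 0 \<le> \<tau> \<Longrightarrow> \<tau> \<le> T \<Longrightarrow> \<bar>l\<bar> \<ge> 2 \<Longrightarrow> \<bar>k\<bar> \<ge> 2 \<Longrightarrow> cmod (f \<tau> l k) \<le> C * \<bar>k\<bar> ^ n"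
    "\<And>\<tau> l k. 0 \<le> \<tau> \<Longrightarrow> \<tau> \<le> T \<Longrightarrow> \<bar>l\<bar> \<ge> 2 \<Longrightarrow> \<bar>k\<bar> \<ge> 2 \<Longrightarrow> cmod (g \<tau> l k) \<le> D * \<bar>k\<bar> ^ m" by blast
  have "cmod (f \<tau> l k * g \<tau> l k) \<le> (C * D) * \<bar>k\<bar> ^ (n + m)"
    if "0 \<le> \<tau>" "\<tau> \<le> T" "\<bar>l\<bar> \<ge> 2" "\<bar>k\<bar> \<ge> 2" for \<tau> l k
  proof -
    have "cmod (f \<tau> l k) * cmod (g \<tau> l k) \<le> (C * \<bar>k\<bar> ^ n) * (D * \<bar>k\<bar> ^ m)"
      using CD(1,2) by (intro mult_mono CD(3,4) that) auto
    then show ?thesis by (simp add: norm_mult power_add mult_ac)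
  qed
  then show ?case using CD by (intro exI[of _ "C * D"] exI[of _ "n + m"]) auto
qed

lemma has_vector_derivative_complex_of_real: "(f has_real_derivative D) F \<Longrightarrow> ((\<lambda>x. complex_of_real (f x)) has_vector_derivative of_real D) F"
  by (rule has_vector_derivative_of_real) (simp add: has_real_derivative_iff_has_vector_derivative)

text \<open>Derivatives are taken on \<bar>k\<bar> > 1, an open set containing the support
  \<bar>k\<bar> \<ge> 2 of the density on which \<open>rr\<close> is nonzero.\<close>

lemma symb_deriv:
  assumes "symb g"
  shows "\<exists>g'. symb g' \<and> (\<forall>\<tau> l k. \<bar>l\<bar> \<ge> 2 \<longrightarrow> \<bar>k\<bar> > 1 \<longrightarrow> (g \<tau> l has_vector_derivative g' \<tau> l k) (at k))"
  using assms
proof induction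
  case (symb_const c) show ?case by (rule exI[of _ "\<lambda>\<tau> l k. 0"]) (auto intro: symb.intros)
next
  case symb_tau show ?case by (rule exI[of _ "\<lambda>\<tau> l k. 0"]) (auto intro: symb.intros)
next
  case symb_id show ?case
    by (rule exI[of _ "\<lambda>\<tau> l k. 1"]) (auto intro: symb.intros has_vector_derivative_complex_of_real[of "\<lambda>x. x" 1, simplified])
next
  case symb_rr
  have "symb (\<lambda>\<tau> l k. of_real k * of_real (1 / rr k))" by (intro symb.intros)
  moreover have "((\<lambda>k. complex_of_real (rr k)) has_vector_derivative of_real k * of_real (1 / rr k)) (at k)" if "\<bar>k\<bar> > 1" for k
    using has_vector_derivative_complex_of_real[OF rr_deriv[OF that]] by simp
  ultimately show ?case by blast
next
  case symb_inv
  have "symb (\<lambda>\<tau> l k. (- 1) * (of_real k * of_real (1 / rr k) ^ 3))" by (intro symb_mult symb_pow symb.intros)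
  moreover have "((\<lambda>k. complex_of_real (1 / rr k)) has_vector_derivative (- 1) * (of_real k * of_real (1 / rr k) ^ 3)) (at k)" if "\<bar>k\<bar> > 1" for k
  proof -
    have "((\<lambda>k. 1 / rr k) has_real_derivative (- 1) * (k * (1 / rr k) ^ 3)) (at k)"
      using rr_deriv[OF that] rr_nonzero[OF that]
      by (auto intro!: derivative_eq_intros simp: power3_eq_cube field_simps)
    from has_vector_derivative_complex_of_real[OF this] show ?thesis by simp
  qed
  ultimately show ?case by blast
next
  case symb_ker
  define p' where "p' k = of_real (1 / (2 * sqrt 3)) * (of_real k * of_real (1 / rr k)) + \<i> / 2" for k
  have "symb (\<lambda>\<tau> l k. (- 1) * ((of_real (1 / (2 * sqrt 3)) * (of_real k * of_real (1 / rr k)) + \<i> / 2) * (1 / (pp k - qq l)) ^ 2))"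
    by (intro symb_mult symb_add symb_pow symb.symb_const symb.symb_id symb.symb_inv symb.symb_ker)
  then have "symb (\<lambda>\<tau> l k. (- 1) * (p' k * (1 / (pp k - qq l)) ^ 2))" unfolding p'_def .
  moreover have "((\<lambda>k. 1 / (pp k - qq l)) has_vector_derivative (- 1) * (p' k * (1 / (pp k - qq l)) ^ 2)) (at k)"
    if "\<bar>k\<bar> > 1" "\<bar>l\<bar> \<ge> 2" for k l
  proof -
    have "((\<lambda>k. of_real (1 / (2 * sqrt 3)) * of_real (rr k) + \<i> / 2 * of_real k - qq l) has_vector_derivative
       of_real (1 / (2 * sqrt 3)) * of_real (k / rr k) + \<i> / 2 * of_real 1 - 0) (at k)"
      by (intro has_vector_derivative_diff has_vector_derivative_add has_vector_derivative_mult_right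
          has_vector_derivative_const has_vector_derivative_complex_of_real rr_deriv that DERIV_ident)
    moreover have "(\<lambda>k. of_real (1 / (2 * sqrt 3)) * of_real (rr k) + \<i> / 2 * of_real k - qq l) = (\<lambda>k. pp k - qq l)"
      by (auto simp: pp_def)
    ultimately have "((\<lambda>k. pp k - qq l) has_vector_derivative p' k) (at k)" by (simp add: p'_def)
    moreover have "(inverse has_field_derivative - (inverse (pp k - qq l) ^ Suc (Suc 0))) (at (pp k - qq l))"
      using pp_neq_qq[of k l] that by (intro DERIV_inverse) auto
    ultimately have "((inverse \<circ> (\<lambda>k. pp k - qq l)) has_vector_derivative p' k * - (inverse (pp k - qq l) ^ Suc (Suc 0))) (at k)"
      by (rule field_vector_diff_chain_at)
    then show ?thesis by (simp add: o_def inverse_eq_divide power2_eq_square)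
  qed
  ultimately show ?case by (intro exI conjI) auto
next
  case (symb_add f g)
  then obtain f' g' where "symb f'" "symb g'"
   "\<And>\<tau> l k. \<bar>l\<bar> \<ge> 2 \<Longrightarrow> \<bar>k\<bar> > 1 \<Longrightarrow> (f \<tau> l has_vector_derivative f' \<tau> l k) (at k)"
   "\<And>\<tau> l k. \<bar>l\<bar> \<ge> 2 \<Longrightarrow> \<bar>k\<bar> > 1 \<Longrightarrow> (g \<tau> l has_vector_derivative g' \<tau> l k) (at k)" by blast
  then show ?case
    by (intro exI[of _ "\<lambda>\<tau> l k. f' \<tau> l k + g' \<tau> l k"]) (auto intro!: symb.intros has_vector_derivative_add)
next
  case (symb_mult f g)
  then obtain f' g' where fg: "symb f'" "symb g'"
   "\<And>\<tau> l k. \<bar>l\<bar> \<ge> 2 \<Longrightarrow> \<bar>k\<bar> > 1 \<Longrightarrow> (f \<tau> l has_vector_derivative f' \<tau> l k) (at k)"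
   "\<And>\<tau> l k. \<bar>l\<bar> \<ge> 2 \<Longrightarrow> \<bar>k\<bar> > 1 \<Longrightarrow> (g \<tau> l has_vector_derivative g' \<tau> l k) (at k)" by blast
  have "symb (\<lambda>\<tau> l k. f \<tau> l k * g' \<tau> l k + f' \<tau> l k * g \<tau> l k)" using symb_mult fg by (intro symb.symb_add symb.symb_mult)
  then show ?case using fg(3,4)
    by (intro exI[of _ "\<lambda>\<tau> l k. f \<tau> l k * g' \<tau> l k + f' \<tau> l k * g \<tau> l k"]) (auto intro!: has_vector_derivative_mult)
qed

text \<open>The growing mode, with \<tau> the time left until T and y the distance from the focus.
  It is normalised to have modulus 1 at \<tau> = 0.\<close>

definition wave :: "real \<Rightarrow> real \<Rightarrow> real \<Rightarrow> complex" where
  "wave y \<tau> k = exp (\<i> * of_real (k * y) - of_real (la k * \<tau>))"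

lemma norm_wave: "cmod (wave y \<tau> k) = exp (- la k * \<tau>)"
  by (simp add: wave_def)

lemma wave_measurable [measurable]: "wave y \<tau> \<in> borel_measurable borel"
  unfolding wave_def by measurable

lemma wave_deriv:
  assumes "\<bar>k\<bar> > 1"
  shows "(wave y \<tau> has_vector_derivative
    (\<i> * of_real y - of_real \<tau> * (of_real (rr k) + of_real k * (of_real k * of_real (1 / rr k)))) * wave y \<tau> k) (at k)"
proof -
  have "((\<lambda>k. \<i> * of_real (k * y) - of_real (la k * \<tau>)) has_vector_derivative
    \<i> * of_real (1 * y) - of_real ((rr k + k * (k * (1 / rr k))) * \<tau>)) (at k)"
    by (intro has_vector_derivative_diff has_vector_derivative_mult_right has_vector_derivative_complex_of_real DERIV_cmult_right DERIV_ident la_deriv assms)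
  then have "((exp \<circ> (\<lambda>k. \<i> * of_real (k * y) - of_real (la k * \<tau>))) has_vector_derivative
    (\<i> * of_real (1 * y) - of_real ((rr k + k * (k * (1 / rr k))) * \<tau>)) * exp (\<i> * of_real (k * y) - of_real (la k * \<tau>))) (at k)"
    by (rule field_vector_diff_chain_at) (rule DERIV_exp)
  then show ?thesis by (simp add: wave_def[abs_def] o_def mult_ac)
qed

lemma tendsto_inverse_square_infinity: "((\<lambda>k::real. C / k\<^sup>2) \<longlongrightarrow> 0) at_infinity"
proof -
  have "((\<lambda>k::real. C * (inverse k * inverse k)) \<longlongrightarrow> C * (0 * 0)) at_infinity"
    by (intro tendsto_intros tendsto_inverse_0)
  then show ?thesis by (simp add: power2_eq_square field_simps)
qed

section \<open>Spatial decay by repeated integration by parts\<close>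

text \<open>The sequence \<open>mu\<close> lists one function together with all its derivatives, so
  an integration by parts passes from \<open>mu a\<close> to \<open>mu (Suc a)\<close>.\<close>

locale density =
  fixes mu :: "nat \<Rightarrow> real \<Rightarrow> complex" and T :: real
  assumes mu_deriv: "(mu a has_vector_derivative mu (Suc a) k) (at k)"
    and mu_bdd: "\<exists>C. \<forall>k. cmod (mu a k) \<le> C"
    and mu_supp: "\<bar>k\<bar> < 2 \<Longrightarrow> mu a k = 0"
begin

lemma mu_measurable [measurable]: "mu a \<in> borel_measurable borel"
  by (rule borel_measurable_continuous_onI)
    (auto simp: continuous_on_eq_continuous_at intro: has_vector_derivative_continuous mu_deriv)

lemma amplitude_bound:
  assumes g: "symb g" and \<eta>: "\<eta> > 0"
  shows "\<exists>C\<ge>0. \<forall>y \<tau> l k. \<eta> \<le> \<tau> \<longrightarrow> \<tau> \<le> T \<longrightarrow> \<bar>l\<bar> \<ge> 2 \<longrightarrow>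
    cmod (mu a k * (g \<tau> l k * wave y \<tau> k)) \<le> C * (indicator {k. \<bar>k\<bar> \<ge> 2} k / k\<^sup>2)"
proof -
  obtain M where M: "\<And>k. cmod (mu a k) \<le> M" using mu_bdd by blast
  then have M0: "M \<ge> 0" using norm_ge_zero order_trans by blast
  obtain D n where D: "D \<ge> 0" "\<And>\<tau> l k. 0 \<le> \<tau> \<Longrightarrow> \<tau> \<le> T \<Longrightarrow> \<bar>l\<bar> \<ge> 2 \<Longrightarrow> \<bar>k\<bar> \<ge> 2 \<Longrightarrow> cmod (g \<tau> l k) \<le> D * \<bar>k\<bar> ^ n"
    using symb_bound[OF g, of T] by blast
  obtain B where B: "B \<ge> 0" "\<And>k \<tau>. \<bar>k\<bar> \<ge> 2 \<Longrightarrow> \<eta> \<le> \<tau> \<Longrightarrow> \<bar>k\<bar> ^ (n + 2) * exp (- la k * \<tau>) \<le> B"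
    using pow_exp_la_bounded[OF \<eta>, of "n + 2"] by blast
  have "cmod (mu a k * (g \<tau> l k * wave y \<tau> k)) \<le> M * D * B * (indicator {k. \<bar>k\<bar> \<ge> 2} k / k\<^sup>2)"
    if "\<eta> \<le> \<tau>" "\<tau> \<le> T" "\<bar>l\<bar> \<ge> 2" for y \<tau> l k
  proof (cases "\<bar>k\<bar> \<ge> 2")
    case True
    then have k2: "k\<^sup>2 > 0" by auto
    have e: "\<bar>k\<bar> ^ n * exp (- la k * \<tau>) \<le> B / k\<^sup>2"
    proof -
      have "\<bar>k\<bar> ^ (n + 2) = \<bar>k\<bar> ^ n * k\<^sup>2" by (simp only: power_add power2_abs)
      then have "\<bar>k\<bar> ^ n * k\<^sup>2 * exp (- la k * \<tau>) \<le> B" using B(2)[OF True that(1)] by (simp only:)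
      then show ?thesis using k2 by (simp only: pos_le_divide_eq mult_ac)
    qed
    have "cmod (mu a k) * (cmod (g \<tau> l k) * cmod (wave y \<tau> k)) \<le> M * ((D * \<bar>k\<bar> ^ n) * exp (- la k * \<tau>))"
      unfolding norm_wave using that \<eta> True M0 D(1) by (intro mult_mono M D) auto
    also have "\<dots> = M * D * (\<bar>k\<bar> ^ n * exp (- la k * \<tau>))" by simp
    also have "\<dots> \<le> M * D * (B / k\<^sup>2)" using M0 D(1) by (intro mult_left_mono e) auto
    finally show ?thesis using True by (simp add: norm_mult)
  next
    case False then show ?thesis using mu_supp[of k a] by simp
  qed
  then show ?thesis using M0 B(1) D(1) by (intro exI[of _ "M * D * B"]) auto
qed

lemma amplitude_integrable:
  assumes g: "symb g" and \<tau>: "0 < \<tau>" "\<tau> \<le> T" and l: "\<bar>l\<bar> \<ge> 2"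
  shows "integrable lborel (\<lambda>k. mu a k * (g \<tau> l k * wave y \<tau> k))"
proof -
  note [measurable] = symb_measurable[OF g]
  obtain C where C: "\<And>k. cmod (mu a k * (g \<tau> l k * wave y \<tau> k)) \<le> C * (indicator {k. \<bar>k\<bar> \<ge> 2} k / k\<^sup>2)"
    using amplitude_bound[OF g \<tau>(1), of a] \<tau> l by blast
  have i: "integrable lborel (\<lambda>k. C * (indicator {k. \<bar>k\<bar> \<ge> 2} k / k\<^sup>2))"
    using integrable_inverse_square_tail by (rule integrable_mult_right)
  show ?thesis
    by (rule Bochner_Integration.integrable_bound[OF i]) (measurable, simp only: real_norm_def, intro AE_I2 order_trans[OF C abs_ge_self])
qed

text \<open>The derivative of density times symbol times wave integrates to zero. The wave
  contributes the factor \<i> y - \<tau> la' k: the first part isolates y times the integral, the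
  second is merged with the derivative of the symbol into \<open>g2\<close>.\<close>

lemma oscillatory_step:
  assumes g: "symb g" and g': "symb g'" "\<And>k. \<bar>k\<bar> > 1 \<Longrightarrow> (g \<tau> l has_vector_derivative g' \<tau> l k) (at k)"
    and g2: "symb g2" "\<And>k. g2 \<tau> l k = g' \<tau> l k + (- 1) * (of_real \<tau> * (of_real (rr k) + of_real k * (of_real k * of_real (1 / rr k)))) * g \<tau> l k"
    and t: "0 < \<tau>" "\<tau> \<le> T" and l: "\<bar>l\<bar> \<ge> 2"
  shows "\<bar>y\<bar> * cmod (\<integral>k. mu a k * (g \<tau> l k * wave y \<tau> k) \<partial>lborel)
    \<le> cmod (\<integral>k. mu (Suc a) k * (g \<tau> l k * wave y \<tau> k) \<partial>lborel) + cmod (\<integral>k. mu a k * (g2 \<tau> l k * wave y \<tau> k) \<partial>lborel)"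
proof -
  note int = amplitude_integrable[OF _ t l]
  define H where "H k = mu a k * (g \<tau> l k * wave y \<tau> k)" for k
  define H' where "H' k = mu (Suc a) k * (g \<tau> l k * wave y \<tau> k) + mu a k * (g2 \<tau> l k * wave y \<tau> k) + \<i> * of_real y * H k" for k
  have d: "(H has_vector_derivative H' k) (at k)" for k
  proof (cases "\<bar>k\<bar> > 1")
    case True
    show ?thesis unfolding H_def[abs_def]
      by (rule has_vector_derivative_eq_rhs,
          rule has_vector_derivative_mult[OF mu_deriv has_vector_derivative_mult[OF g'(2)[OF True] wave_deriv[OF True]]])
         (simp add: H'_def H_def g2 algebra_simps)
  next
    case False
    then have k: "k \<in> {-2<..<2}" by auto
    have "H' k = 0" using False mu_supp[of k] by (simp add: H'_def H_def)
    moreover have "(H has_vector_derivative 0) (at k)"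
      by (rule has_vector_derivative_transform_within_open[where f="\<lambda>_. 0" and S="{-2<..<2}"])
         (use k mu_supp in \<open>auto simp: H_def\<close>)
    ultimately show ?thesis by simp
  qed
  obtain C where C: "\<And>k. cmod (H k) \<le> C * (indicator {k. \<bar>k\<bar> \<ge> 2} k / k\<^sup>2)" "C \<ge> 0"
    using amplitude_bound[OF g t(1), of a] t l unfolding H_def by blast
  have "(H \<longlongrightarrow> 0) at_infinity"
    by (rule Lim_null_comparison[OF always_eventually tendsto_inverse_square_infinity[of C]])
       (use C in \<open>auto intro!: order_trans[OF C(1)] simp: indicator_def\<close>)
  then have lim: "(H \<longlongrightarrow> 0) at_top" "(H \<longlongrightarrow> 0) at_bot"
    by (auto intro: tendsto_mono[OF at_top_le_at_infinity] tendsto_mono[OF at_bot_le_at_infinity])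
  have iH: "integrable lborel H" unfolding H_def[abs_def] by (rule int[OF g])
  have "integrable lborel H'" unfolding H'_def[abs_def]
    by (intro Bochner_Integration.integrable_add integrable_mult_right int g g2 iH)
  from integral_vector_derivative_zero[OF d this lim]
  have "(\<integral>k. mu (Suc a) k * (g \<tau> l k * wave y \<tau> k) \<partial>lborel) + (\<integral>k. mu a k * (g2 \<tau> l k * wave y \<tau> k) \<partial>lborel)
     + \<i> * of_real y * (\<integral>k. H k \<partial>lborel) = 0"
    unfolding H'_def[abs_def] using int[OF g] int[OF g2(1)] iH by simp
  then have "\<i> * of_real y * (\<integral>k. H k \<partial>lborel) = - ((\<integral>k. mu (Suc a) k * (g \<tau> l k * wave y \<tau> k) \<partial>lborel) + (\<integral>k. mu a k * (g2 \<tau> l k * wave y \<tau> k) \<partial>lborel))"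
    by (rule minus_unique[symmetric])
  then have "\<bar>y\<bar> * cmod (\<integral>k. H k \<partial>lborel) = cmod ((\<integral>k. mu (Suc a) k * (g \<tau> l k * wave y \<tau> k) \<partial>lborel) + (\<integral>k. mu a k * (g2 \<tau> l k * wave y \<tau> k) \<partial>lborel))"
    by (metis (no_types, lifting) norm_ii norm_minus_cancel norm_mult norm_of_real mult_1)
  also have "\<dots> \<le> cmod (\<integral>k. mu (Suc a) k * (g \<tau> l k * wave y \<tau> k) \<partial>lborel) + cmod (\<integral>k. mu a k * (g2 \<tau> l k * wave y \<tau> k) \<partial>lborel)"
    by (rule norm_triangle_ineq)
  finally show ?thesis by (simp only: H_def)
qed

text \<open>Each integration by parts gains one factor \<bar>y\<bar> and produces two integrals of
  the same kind, hence an induction on N over all derivatives \<open>a\<close> and all symbols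
  \<open>g\<close>.\<close>

lemma oscillatory_decay:
  assumes \<eta>: "\<eta> > 0" and g: "symb g"
  shows "\<exists>C. \<forall>y \<tau> l. \<eta> \<le> \<tau> \<longrightarrow> \<tau> \<le> T \<longrightarrow> \<bar>l\<bar> \<ge> 2 \<longrightarrow>
    \<bar>y\<bar> ^ N * cmod (\<integral>k. mu a k * (g \<tau> l k * wave y \<tau> k) \<partial>lborel) \<le> C"
  using g
proof (induction N arbitrary: a g)
  case 0
  obtain C where C: "\<And>y \<tau> l k. \<eta> \<le> \<tau> \<Longrightarrow> \<tau> \<le> T \<Longrightarrow> \<bar>l\<bar> \<ge> 2 \<Longrightarrow>
    cmod (mu a k * (g \<tau> l k * wave y \<tau> k)) \<le> C * (indicator {k. \<bar>k\<bar> \<ge> 2} k / k\<^sup>2)"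
    using amplitude_bound[OF 0 \<eta>, of a] by blast
  have "cmod (\<integral>k. mu a k * (g \<tau> l k * wave y \<tau> k) \<partial>lborel) \<le> (\<integral>k. C * (indicator {k. \<bar>k\<bar> \<ge> 2} k / k\<^sup>2) \<partial>lborel)"
    if "\<eta> \<le> \<tau>" "\<tau> \<le> T" "\<bar>l\<bar> \<ge> 2" for y \<tau> l
  proof (rule Bochner_Integration.integral_norm_bound_integral)
    show "integrable lborel (\<lambda>k. C * (indicator {k. \<bar>k\<bar> \<ge> 2} k / k\<^sup>2))"
      using integrable_inverse_square_tail by (rule integrable_mult_right)
    show "integrable lborel (\<lambda>k. mu a k * (g \<tau> l k * wave y \<tau> k))"
      by (rule amplitude_integrable[OF 0]) (use that \<eta> in auto)
  qed (rule C[OF that])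
  then show ?case by auto
next
  case (Suc N)
  obtain g' where g': "symb g'" "\<And>\<tau> l k. \<bar>l\<bar> \<ge> 2 \<Longrightarrow> \<bar>k\<bar> > 1 \<Longrightarrow> (g \<tau> l has_vector_derivative g' \<tau> l k) (at k)"
    using symb_deriv[OF Suc.prems] by blast
  define g2 where "g2 \<tau> l k = g' \<tau> l k + (- 1) * (of_real \<tau> * (of_real (rr k) + of_real k * (of_real k * of_real (1 / rr k)))) * g \<tau> l k" for \<tau> l k
  have g2: "symb g2" unfolding g2_def[abs_def]
    by (intro symb_add symb_mult symb_const symb_tau symb_rr symb_id symb_inv g' Suc.prems)
  obtain C1 where C1: "\<And>y \<tau> l. \<eta> \<le> \<tau> \<Longrightarrow> \<tau> \<le> T \<Longrightarrow> \<bar>l\<bar> \<ge> 2 \<Longrightarrow>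
    \<bar>y\<bar> ^ N * cmod (\<integral>k. mu (Suc a) k * (g \<tau> l k * wave y \<tau> k) \<partial>lborel) \<le> C1"
    using Suc.IH[OF Suc.prems] by blast
  obtain C2 where C2: "\<And>y \<tau> l. \<eta> \<le> \<tau> \<Longrightarrow> \<tau> \<le> T \<Longrightarrow> \<bar>l\<bar> \<ge> 2 \<Longrightarrow>
    \<bar>y\<bar> ^ N * cmod (\<integral>k. mu a k * (g2 \<tau> l k * wave y \<tau> k) \<partial>lborel) \<le> C2"
    using Suc.IH[OF g2] by blast
  have "\<bar>y\<bar> ^ Suc N * cmod (\<integral>k. mu a k * (g \<tau> l k * wave y \<tau> k) \<partial>lborel) \<le> C1 + C2"
    if t: "\<eta> \<le> \<tau>" "\<tau> \<le> T" "\<bar>l\<bar> \<ge> 2" for y \<tau> l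
  proof -
    have "\<bar>y\<bar> * cmod (\<integral>k. mu a k * (g \<tau> l k * wave y \<tau> k) \<partial>lborel)
      \<le> cmod (\<integral>k. mu (Suc a) k * (g \<tau> l k * wave y \<tau> k) \<partial>lborel) + cmod (\<integral>k. mu a k * (g2 \<tau> l k * wave y \<tau> k) \<partial>lborel)"
      by (rule oscillatory_step[OF Suc.prems g'(1) g'(2)[OF t(3)] g2 g2_def]) (use t \<eta> in auto)
    then have "\<bar>y\<bar> ^ N * (\<bar>y\<bar> * cmod (\<integral>k. mu a k * (g \<tau> l k * wave y \<tau> k) \<partial>lborel)) \<le> \<bar>y\<bar> ^ N * (cmod (\<integral>k. mu (Suc a) k * (g \<tau> l k * wave y \<tau> k) \<partial>lborel) + cmod (\<integral>k. mu a k * (g2 \<tau> l k * wave y \<tau> k) \<partial>lborel))"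
      by (intro mult_left_mono) auto
    also have "\<dots> \<le> C1 + C2" using C1[OF t, of y] C2[OF t, of y] by (simp add: distrib_left)
    finally show ?thesis by (simp add: mult_ac)
  qed
  then show ?case by blast
qed

end

section \<open>A dyadic density with iterated logarithms\<close>

primrec flat_poly :: "nat \<Rightarrow> real poly" where
  "flat_poly 0 = 1"
| "flat_poly (Suc n) = [:0, 0, 1:] * (flat_poly n - pderiv (flat_poly n))"

definition flat :: "nat \<Rightarrow> real \<Rightarrow> real" where
  "flat n x = (if x > 0 then poly (flat_poly n) (1 / x) * exp (- (1 / x)) else 0)"

lemma poly_le_exp: "\<exists>C\<ge>0. \<forall>y::real\<ge>0. \<bar>poly P y\<bar> \<le> C * exp y"
proof (intro exI[of _ "\<Sum>i\<le>degree P. \<bar>coeff P i\<bar> * fact i"] conjI allI impI)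
  fix y :: real assume y: "y \<ge> 0"
  have "\<bar>poly P y\<bar> \<le> (\<Sum>i\<le>degree P. \<bar>coeff P i * y ^ i\<bar>)"
    unfolding poly_altdef by (rule sum_abs)
  also have "\<dots> \<le> (\<Sum>i\<le>degree P. \<bar>coeff P i\<bar> * fact i * exp y)"
    using pow_le_fact_exp[OF y] y by (intro sum_mono) (auto simp: abs_mult mult.assoc intro!: mult_left_mono)
  finally show "\<bar>poly P y\<bar> \<le> (\<Sum>i\<le>degree P. \<bar>coeff P i\<bar> * fact i) * exp y" by (simp add: sum_distrib_right)
qed (auto intro: sum_nonneg)

lemma flat_bound: "\<exists>C\<ge>0. \<forall>x. \<bar>flat n x\<bar> \<le> C * x\<^sup>2"
proof -
  obtain C where C: "C \<ge> 0" "\<And>y::real. y \<ge> 0 \<Longrightarrow> \<bar>poly (flat_poly n * [:0, 0, 1:]) y\<bar> \<le> C * exp y"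
    using poly_le_exp[of "flat_poly n * [:0, 0, 1:]"] by blast
  have "\<bar>flat n x\<bar> \<le> C * x\<^sup>2" for x
  proof (cases "x > 0")
    case True
    have "\<bar>poly (flat_poly n) (1 / x)\<bar> * (1 / x)\<^sup>2 \<le> C * exp (1 / x)"
      using C(2)[of "1 / x"] True by (simp add: abs_mult power2_eq_square)
    then have "\<bar>poly (flat_poly n) (1 / x)\<bar> * (1 / x)\<^sup>2 * (exp (- (1 / x)) * x\<^sup>2) \<le> C * exp (1 / x) * (exp (- (1 / x)) * x\<^sup>2)"
      by (intro mult_right_mono) auto
    then have "\<bar>poly (flat_poly n) (1 / x)\<bar> * exp (- (1 / x)) \<le> C * x\<^sup>2"
      using True by (simp add: exp_minus power2_eq_square field_simps)
    then show ?thesis using True by (simp add: flat_def abs_mult)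
  next
    case False then show ?thesis using C(1) by (simp add: flat_def)
  qed
  then show ?thesis using C(1) by blast
qed

lemma flat_deriv: "(flat n has_real_derivative flat (Suc n) x) (at x)"
proof (rule linorder_cases[of x 0])
  assume x: "x < 0"
  have "((\<lambda>_. 0) has_real_derivative flat (Suc n) x) (at x)" using x by (simp add: flat_def)
  then show ?thesis
    by (rule has_field_derivative_transform_within_open[where S="{..<0}"]) (use x in \<open>auto simp: flat_def\<close>)
next
  assume x: "x > 0"
  have "((\<lambda>x. poly (flat_poly n) (1 / x) * exp (- (1 / x))) has_real_derivative flat (Suc n) x) (at x)"
    using x by (auto intro!: derivative_eq_intros DERIV_chain2[OF poly_DERIV] simp: flat_def field_simps power2_eq_square)
  then show ?thesis
    by (rule has_field_derivative_transform_within_open[where S="{0<..}"]) (use x in \<open>auto simp: flat_def\<close>)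
next
  assume x: "x = 0"
  obtain C where C: "\<And>x. \<bar>flat n x\<bar> \<le> C * x\<^sup>2" using flat_bound by blast
  have "((\<lambda>y. (flat n y - flat n 0) / (y - 0)) \<longlongrightarrow> 0) (at 0)"
  proof (rule Lim_null_comparison)
    show "\<forall>\<^sub>F y in at 0. norm ((flat n y - flat n 0) / (y - 0)) \<le> C * \<bar>y\<bar>"
    proof (rule eventually_mono[OF eventually_neq_at_within[of 0]])
      fix y :: real assume y: "y \<noteq> 0"
      then show "norm ((flat n y - flat n 0) / (y - 0)) \<le> C * \<bar>y\<bar>"
        using C[of y] by (simp add: flat_def[of n 0] divide_le_eq mult.assoc power2_eq_square abs_mult_self_eq)
    qed
    show "((\<lambda>y. C * \<bar>y\<bar>) \<longlongrightarrow> 0) (at 0)" by (auto intro!: tendsto_eq_intros)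
  qed
  then show ?thesis using x by (simp add: has_field_derivative_iff flat_def[of "Suc n"])
qed

text \<open>Pascal's rule; this is the combinatorial step of the Leibniz formula.\<close>

lemma leibniz_sum:
  fixes f g :: "nat \<Rightarrow> real"
  shows "(\<Sum>i\<le>n. of_nat (n choose i) * (f (Suc i) * g (n - i) + f i * g (Suc (n - i))))
    = (\<Sum>i\<le>Suc n. of_nat (Suc n choose i) * (f i * g (Suc n - i)))"
proof -
  have "(\<Sum>i\<le>Suc n. of_nat (Suc n choose i) * (f i * g (Suc n - i)))
    = f 0 * g (Suc n) + (\<Sum>i\<le>n. (of_nat (n choose i) + of_nat (n choose Suc i)) * (f (Suc i) * g (n - i)))"
    unfolding sum.atMost_Suc_shift by simp
  also have "\<dots> = (\<Sum>i\<le>n. of_nat (n choose i) * (f (Suc i) * g (n - i)))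
      + (f 0 * g (Suc n) + (\<Sum>i\<le>n. of_nat (n choose Suc i) * (f (Suc i) * g (Suc n - Suc i))))"
    by (simp add: distrib_right sum.distrib)
  also have "f 0 * g (Suc n) + (\<Sum>i\<le>n. of_nat (n choose Suc i) * (f (Suc i) * g (Suc n - Suc i)))
      = (\<Sum>i\<le>Suc n. of_nat (n choose i) * (f i * g (Suc n - i)))"
    unfolding sum.atMost_Suc_shift by simp
  also have "\<dots> = (\<Sum>i\<le>n. of_nat (n choose i) * (f i * g (Suc (n - i))))"
    by (simp add: Suc_diff_le)
  finally show ?thesis by (simp add: distrib_left sum.distrib)
qed

text \<open>The n-th derivative of exp (-1/(y - 1)) exp (-1/(2 - y)) on (1, 2), written out by the
  Leibniz formula; the signs come from the inner derivative of 2 - y.\<close>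

definition bump :: "nat \<Rightarrow> real \<Rightarrow> real" where
  "bump n y = (\<Sum>i\<le>n. of_nat (n choose i) * (flat i (y - 1) * ((- 1) ^ (n - i) * flat (n - i) (2 - y))))"

lemma bump_deriv: "(bump n has_real_derivative bump (Suc n) y) (at y)"
proof -
  have f: "((\<lambda>y. flat i (y - 1)) has_real_derivative flat (Suc i) (y - 1)) (at y)" for i
  proof -
    have "((\<lambda>y. y - 1) has_real_derivative 1) (at y)" by (auto intro!: derivative_eq_intros)
    from DERIV_chain2[OF flat_deriv this] show ?thesis by simp
  qed
  have g: "((\<lambda>y. (- 1) ^ i * flat i (2 - y)) has_real_derivative (- 1) ^ Suc i * flat (Suc i) (2 - y)) (at y)" for i
  proof -
    have "((\<lambda>y. 2 - y) has_real_derivative - 1) (at y)" by (auto intro!: derivative_eq_intros)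
    from DERIV_cmult[OF DERIV_chain2[OF flat_deriv this]] show ?thesis by (rule DERIV_cong) simp
  qed
  have "(bump n has_real_derivative (\<Sum>i\<le>n. of_nat (n choose i) * (flat (Suc i) (y - 1) * ((- 1) ^ (n - i) * flat (n - i) (2 - y))
      + flat i (y - 1) * ((- 1) ^ Suc (n - i) * flat (Suc (n - i)) (2 - y))))) (at y)"
    unfolding bump_def[abs_def]
    by (intro DERIV_sum DERIV_cmult) (rule DERIV_cong[OF DERIV_mult[OF f g]], simp)
  then show ?thesis
    using leibniz_sum[of n "\<lambda>i. flat i (y - 1)" "\<lambda>i. (- 1) ^ i * flat i (2 - y)"] by (simp add: bump_def)
qed

lemma bump_0: "bump 0 y = flat 0 (y - 1) * flat 0 (2 - y)"
  by (simp add: bump_def)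

lemma bump_supp: "\<not> (1 < y \<and> y < 2) \<Longrightarrow> bump n y = 0"
  by (auto simp: bump_def flat_def)

lemma bump_nonneg: "bump 0 y \<ge> 0"
  by (simp add: bump_0 flat_def)

lemma bump_lower: "5/4 \<le> y \<Longrightarrow> y \<le> 7/4 \<Longrightarrow> bump 0 y \<ge> exp (-8)"
proof -
  assume y: "5/4 \<le> y" "y \<le> 7/4"
  then have "1 / (y - 1) \<le> 4" "1 / (2 - y) \<le> 4" by (auto simp: field_simps)
  then have "exp (-8) \<le> exp (- (1 / (y - 1)) + - (1 / (2 - y)))" by (subst exp_le_cancel_iff) linarith
  also have "\<dots> = exp (- (1 / (y - 1))) * exp (- (1 / (2 - y)))" by (rule exp_add)
  finally show ?thesis using y by (simp add: bump_0 flat_def)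
qed

lemma bump_bounded: "\<exists>C\<ge>0. \<forall>y. \<bar>bump n y\<bar> \<le> C"
proof -
  have "continuous_on {1..2} (bump n)"
    by (meson DERIV_continuous bump_deriv continuous_at_imp_continuous_on)
  then have "bounded (bump n ` {1..2})" by (intro compact_imp_bounded compact_continuous_image) auto
  then have "\<exists>C. \<forall>y\<in>{1..2}. \<bar>bump n y\<bar> \<le> C" by (auto simp: bounded_iff)
  then obtain C where C: "\<And>y. y \<in> {1..2} \<Longrightarrow> \<bar>bump n y\<bar> \<le> C" by blast
  have "\<bar>bump n y\<bar> \<le> \<bar>C\<bar>" for y
    using C[of y] bump_supp[of y n] by (cases "y \<in> {1..2}") auto
  then show ?thesis by (intro exI[of _ "\<bar>C\<bar>"]) auto
qed

text \<open>The a-th derivative of the sum of \<open>c n\<close> times a bump on (2 ^ n, 2 ^ Suc n),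
  with the chain-rule factor of each block. The upper limit makes the sum finite and loses nothing,
  since 2 ^ n > k once n \<ge> \<bar>k\<bar>; starting at n = 1 puts the support into k \<ge>
  2.\<close>

definition rho :: "(nat \<Rightarrow> real) \<Rightarrow> nat \<Rightarrow> real \<Rightarrow> real" where
  "rho c a k = (\<Sum>n\<in>{1..nat \<lceil>\<bar>k\<bar>\<rceil>}. c n * (1 / 2 ^ n) ^ a * bump a (k / 2 ^ n))"

lemma bump_dyadic_0: "n \<ge> nat \<lceil>\<bar>k\<bar>\<rceil> \<Longrightarrow> bump a (k / 2 ^ n) = 0"
proof (rule bump_supp)
  assume "n \<ge> nat \<lceil>\<bar>k\<bar>\<rceil>"
  then have "k \<le> real n" by linarith
  also have "\<dots> < 2 ^ n" by (rule of_nat_less_two_power)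
  finally show "\<not> (1 < k / 2 ^ n \<and> k / 2 ^ n < 2)" by (simp add: field_simps)
qed

text \<open>Any larger cut-off gives the same value. Near a given point one fixed finite sum can
  therefore be differentiated term by term.\<close>

lemma rho_eq: "N \<ge> nat \<lceil>\<bar>k\<bar>\<rceil> \<Longrightarrow> rho c a k = (\<Sum>n\<in>{1..N}. c n * (1 / 2 ^ n) ^ a * bump a (k / 2 ^ n))"
  unfolding rho_def
proof (rule sum.mono_neutral_left)
  show "\<forall>n\<in>{1..N} - {1..nat \<lceil>\<bar>k\<bar>\<rceil>}. c n * (1 / 2 ^ n) ^ a * bump a (k / 2 ^ n) = 0"
  proof
    fix n assume "n \<in> {1..N} - {1..nat \<lceil>\<bar>k\<bar>\<rceil>}"
    then have "n > nat \<lceil>\<bar>k\<bar>\<rceil>" by (metis DiffE atLeastAtMost_iff not_le)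
    from bump_dyadic_0[OF less_imp_le[OF this]] show "c n * (1 / 2 ^ n) ^ a * bump a (k / 2 ^ n) = 0" by simp
  qed
qed auto

lemma rho_deriv: "(rho c a has_real_derivative rho c (Suc a) k) (at k)"
proof -
  \<comment> \<open>The extra 1 makes the cut-off valid on an open interval around k.\<close>
  define N where "N = nat \<lceil>\<bar>k\<bar>\<rceil> + 1"
  have "real (nat \<lceil>\<bar>k\<bar>\<rceil>) < real N" unfolding N_def of_nat_less_iff by simp
  with real_nat_ceiling_ge have "\<bar>k\<bar> < real N" by (rule order.strict_trans1)
  then have k: "k \<in> {- real N<..<real N}" by auto
  have "((\<lambda>k. bump a (k / 2 ^ n)) has_real_derivative bump (Suc a) (k / 2 ^ n) * (1 / 2 ^ n)) (at k)" for n
    by (rule DERIV_chain2[OF bump_deriv]) (auto intro!: derivative_eq_intros)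
  then have "((\<lambda>k. \<Sum>n\<in>{1..N}. c n * (1 / 2 ^ n) ^ a * bump a (k / 2 ^ n)) has_real_derivative
    (\<Sum>n\<in>{1..N}. c n * (1 / 2 ^ n) ^ a * (bump (Suc a) (k / 2 ^ n) * (1 / 2 ^ n)))) (at k)"
    by (intro DERIV_sum DERIV_cmult)
  moreover have "(\<Sum>n\<in>{1..N}. c n * (1 / 2 ^ n) ^ a * (bump (Suc a) (k / 2 ^ n) * (1 / 2 ^ n))) = rho c (Suc a) k"
  proof -
    have "nat \<lceil>\<bar>k\<bar>\<rceil> \<le> N" unfolding N_def by (rule le_add1)
    from rho_eq[OF this] show ?thesis by (simp add: mult_ac)
  qed
  ultimately have "((\<lambda>k. \<Sum>n\<in>{1..N}. c n * (1 / 2 ^ n) ^ a * bump a (k / 2 ^ n)) has_real_derivative rho c (Suc a) k) (at k)"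
    by simp
  then show ?thesis
  proof (rule has_field_derivative_transform_within_open[where S="{- real N<..<real N}"])
    fix y assume "y \<in> {- real N<..<real N}"
    then have "\<bar>y\<bar> \<le> real N" by auto
    then have "nat \<lceil>\<bar>y\<bar>\<rceil> \<le> N" by (simp add: nat_le_iff ceiling_le_iff)
    then show "(\<Sum>n\<in>{1..N}. c n * (1 / 2 ^ n) ^ a * bump a (y / 2 ^ n)) = rho c a y" by (rule rho_eq[symmetric])
  qed (use k in auto)
qed

lemma dyadic_unique:
  fixes k :: real
  assumes "2 ^ n < k" "k < 2 ^ Suc n" "2 ^ m < k" "k < 2 ^ Suc m"
  shows "m = n"
proof (rule ccontr)
  assume "m \<noteq> n"
  then consider "Suc m \<le> n" | "Suc n \<le> m" by linarith
  then show False
  proof cases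
    case 1
    then have "(2::real) ^ Suc m \<le> 2 ^ n" by (intro power_increasing) auto
    then show False using assms by linarith
  next
    case 2
    then have "(2::real) ^ Suc n \<le> 2 ^ m" by (intro power_increasing) auto
    then show False using assms by linarith
  qed
qed

lemma rho_single:
  assumes k: "2 ^ n < k" "k < 2 ^ Suc n" and n: "n \<ge> 1"
  shows "rho c a k = c n * (1 / 2 ^ n) ^ a * bump a (k / 2 ^ n)"
proof -
  have "n < nat \<lceil>\<bar>k\<bar>\<rceil>"
  proof -
    have "real n < 2 ^ n" by (rule of_nat_less_two_power)
    then show ?thesis using k by linarith
  qed
  moreover have "bump a (k / 2 ^ m) = 0" if "m \<noteq> n" for m
    using dyadic_unique[OF k, of m] that by (intro bump_supp) (auto simp: field_simps)
  ultimately show ?thesis unfolding rho_def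
    using n by (subst sum.mono_neutral_right[where S="{n}"]) auto
qed

lemma rho_cases:
  obtains "\<And>a. rho c a k = 0" | n where "n \<ge> 1" "2 ^ n < k" "k < 2 ^ Suc n"
proof (cases "\<exists>n\<ge>1. 2 ^ n < k \<and> k < 2 ^ Suc n")
  case True then show ?thesis using that(2) by blast
next
  case False
  have "rho c a k = 0" for a
    unfolding rho_def
  proof (rule sum.neutral, rule ballI)
    fix n assume "n \<in> {1..nat \<lceil>\<bar>k\<bar>\<rceil>}"
    then have "\<not> (2 ^ n < k \<and> k < 2 ^ Suc n)" using False by auto
    then have "bump a (k / 2 ^ n) = 0" by (intro bump_supp) (auto simp: field_simps)
    then show "c n * (1 / 2 ^ n) ^ a * bump a (k / 2 ^ n) = 0" by simp
  qed
  then show ?thesis using that(1) by blast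
qed

lemma rho_supp: "k \<le> 2 \<Longrightarrow> rho c a k = 0"
proof (rule rho_cases[of c k])
  fix n :: nat assume "k \<le> 2" "n \<ge> 1" "2 ^ n < k"
  moreover have "(2::real) ^ 1 \<le> 2 ^ n" using \<open>n \<ge> 1\<close> by (intro power_increasing) auto
  ultimately show ?thesis by auto
qed auto

lemma rho_nonneg: "(\<And>n. c n \<ge> 0) \<Longrightarrow> rho c 0 k \<ge> 0"
  unfolding rho_def by (intro sum_nonneg mult_nonneg_nonneg bump_nonneg) auto

section \<open>Iterated logarithms as slowly varying functions\<close>

text \<open>Truncation at 1 avoids the junk values of \<open>ln\<close> at nonpositive arguments.\<close>

primrec ell :: "nat \<Rightarrow> real \<Rightarrow> real" where
  "ell 0 s = max 1 s"
| "ell (Suc r) s = max 1 (ln (ell r s))"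

lemma ell_ge_1: "ell r s \<ge> 1"
  by (cases r) auto

lemma ell_pos: "ell r s > 0" using ell_ge_1[of r s] by linarith

lemma ell_mono: "s \<le> t \<Longrightarrow> ell r s \<le> ell r t"
  by (induction r) (auto simp: max.coboundedI2 ell_pos)

lemma ell_at_1: "ell r 1 = 1"
  by (induction r) auto

lemma one_plus_ln_le: "y \<ge> (1::real) \<Longrightarrow> 1 + ln y \<le> y"
  using ln_le_minus_one[of y] by simp

text \<open>A logarithm turns a factor Y into a summand ln Y, and \<open>ell\<close> \<ge> 1 allows
  the sum to be written as a product with 1 + ln y. Since 1 + ln y \<le> y, the same bound passes to
  the next logarithm. At least one logarithm is required to start, hence r \<ge> 1.\<close>

lemma ell_mult:
  assumes "s \<ge> 1" "y \<ge> 1" "r \<ge> 1"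
  shows "ell r (s * y) \<le> ell r s * (1 + ln y)"
proof -
  have step: "ell (Suc r) (s * y) \<le> ell (Suc r) s * (1 + ln y)" if Y: "ell r (s * y) \<le> ell r s * Y" "1 \<le> Y" "Y \<le> y" for r Y
  proof -
    have "ln (ell r (s * y)) \<le> ln (ell r s * Y)" using Y ell_pos[of r] by (subst ln_le_cancel_iff) auto
    also have "\<dots> = ln (ell r s) + ln Y" using Y ell_pos[of r s] by (simp add: ln_mult)
    also have "\<dots> \<le> ell (Suc r) s + ell (Suc r) s * ln y"
    proof (rule add_mono)
      have "ln Y \<le> 1 * ln y" using Y by simp
      also have "\<dots> \<le> ell (Suc r) s * ln y" using assms by (intro mult_right_mono ell_ge_1) auto
      finally show "ln Y \<le> ell (Suc r) s * ln y" .
    qed simp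
    finally have "ln (ell r (s * y)) \<le> ell (Suc r) s * (1 + ln y)" by (simp add: distrib_left)
    moreover have "1 * 1 \<le> ell (Suc r) s * (1 + ln y)" using assms by (intro mult_mono ell_ge_1) (auto simp del: ell.simps simp: ell_pos less_imp_le)
    ultimately show ?thesis by (simp add: max_def)
  qed
  have "ell (Suc r) (s * y) \<le> ell (Suc r) s * (1 + ln y)" for r
  proof (induction r)
    case 0
    have "1 * 1 \<le> s * y" using assms by (intro mult_mono) auto
    then show ?case using assms by (intro step[of 0 y]) auto
  next
    case (Suc r)
    show ?case by (rule step[OF Suc.IH]) (use assms one_plus_ln_le in auto)
  qed
  from this[of "r - 1"] show ?thesis using assms by simp
qed

lemma iter_log_tendsto: "filterlim (\<lambda>s::real. (ln ^^ r) s) at_top at_top"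
proof (induction r)
  case 0 show ?case by (simp add: filterlim_ident)
next
  case (Suc r)
  show ?case using filterlim_compose[OF ln_at_top Suc] by (simp add: o_def)
qed

lemma eventually_ell: "\<forall>\<^sub>F s in at_top. (ln ^^ r) s = ell r s"
proof (induction r)
  case 0 show ?case using eventually_ge_at_top[of 1] by eventually_elim simp
next
  case (Suc r)
  have "\<forall>\<^sub>F s in at_top. (ln ^^ Suc r) (s::real) \<ge> 1"
    using iter_log_tendsto[of "Suc r"] unfolding filterlim_at_top by blast
  with Suc show ?case by eventually_elim simp
qed

text \<open>The modulus of \<open>LOG\<close> with truncated logarithms: equal to it for large s,
  but at least 1 and monotone everywhere when the exponents are nonnegative.\<close>

definition log_weight :: "nat list \<Rightarrow> real list \<Rightarrow> real \<Rightarrow> real" where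
  "log_weight rs as s = (\<Prod>j<length rs. ell (rs ! j) s powr (as ! j))"

lemma log_weight_at_1: "log_weight rs as 1 = 1"
  by (simp add: log_weight_def ell_at_1)

context
  fixes rs :: "nat list" and as :: "real list"
  assumes rs: "\<And>j. j < length rs \<Longrightarrow> rs ! j \<ge> 1" and as: "\<And>j. j < length rs \<Longrightarrow> as ! j \<ge> 0"
begin

lemma log_weight_ge_1: "log_weight rs as s \<ge> 1"
  unfolding log_weight_def by (rule prod_ge_1) (use as ell_ge_1 in \<open>auto intro!: ge_one_powr_ge_zero\<close>)

lemma log_weight_mono: "s \<le> t \<Longrightarrow> log_weight rs as s \<le> log_weight rs as t"
  unfolding log_weight_def by (rule prod_mono) (use as ell_mono in \<open>auto intro!: powr_mono2 simp: less_imp_le[OF ell_pos]\<close>)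

text \<open>Slow variation: each factor grows by at most a power of 1 + ln y, and logarithms are
  dominated by arbitrarily small powers.\<close>

lemma log_weight_mult:
  assumes \<eta>: "\<eta> > 0"
  shows "\<exists>C>0. \<forall>s\<ge>1. \<forall>y\<ge>1. log_weight rs as (s * y) \<le> C * log_weight rs as s * y powr \<eta>"
proof -
  define A where "A = (\<Sum>j<length rs. as ! j)"
  have A0: "A \<ge> 0" unfolding A_def using as by (intro sum_nonneg) auto
  \<comment> \<open>The exponent is divided by the sum A of the \<open>as\<close>, plus 1 to avoid
    division by zero, so that all factors together cost at most y to the power \<eta>.\<close>
  define e where "e = \<eta> / (A + 1)"
  have e: "e > 0" using \<eta> A0 by (simp add: e_def)
  define D where "D = 1 + 1 / e"
  have D: "D > 0" using e by (simp add: D_def add_pos_pos)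
  have ln_le: "1 + ln y \<le> D * y powr e" if "y \<ge> 1" for y
  proof -
    have "ln (y powr e) \<le> y powr e - 1" using that by (intro ln_le_minus_one) auto
    then have "e * ln y \<le> y powr e" using that by (simp add: ln_powr)
    then have "ln y \<le> 1 / e * y powr e" using e by (simp add: field_simps)
    moreover have "1 \<le> y powr e" using that e by (intro ge_one_powr_ge_zero) auto
    ultimately show ?thesis by (simp add: D_def distrib_right)
  qed
  have "log_weight rs as (s * y) \<le> D powr A * log_weight rs as s * y powr \<eta>" if s: "s \<ge> 1" and y: "y \<ge> 1" for s y
  proof -
    have "log_weight rs as (s * y) \<le> (\<Prod>j<length rs. (ell (rs ! j) s * (D * y powr e)) powr (as ! j))"
      unfolding log_weight_def
    proof (rule prod_mono, safe)
      fix j assume j: "j < length rs"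
      have "ell (rs ! j) (s * y) \<le> ell (rs ! j) s * (1 + ln y)" by (rule ell_mult[OF s y rs[OF j]])
      also have "\<dots> \<le> ell (rs ! j) s * (D * y powr e)"
        using ell_pos[of "rs ! j" s] by (intro mult_left_mono ln_le y) auto
      finally show "ell (rs ! j) (s * y) powr as ! j \<le> (ell (rs ! j) s * (D * y powr e)) powr as ! j"
        using as[OF j] ell_pos[of "rs ! j" "s * y"] by (intro powr_mono2) auto
    qed auto
    also have "\<dots> = (\<Prod>j<length rs. ell (rs ! j) s powr (as ! j) * (D * y powr e) powr (as ! j))"
      using D ell_pos by (intro prod.cong refl) (simp add: powr_mult less_imp_le)
    also have "\<dots> = log_weight rs as s * (D * y powr e) powr A"
      unfolding prod.distrib log_weight_def A_def using D y by (subst powr_sum) auto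
    also have "(D * y powr e) powr A = D powr A * y powr (e * A)"
      using D y by (simp add: powr_mult powr_powr)
    also have "log_weight rs as s * (D powr A * y powr (e * A)) \<le> log_weight rs as s * (D powr A * y powr \<eta>)"
    proof (intro mult_left_mono powr_mono y)
      have "e * A \<le> e * (A + 1)" using e by simp
      also have "\<dots> = \<eta>" using A0 by (simp add: e_def)
      finally show "e * A \<le> \<eta>" .
    qed (use log_weight_ge_1[of s] in auto)
    finally show ?thesis by (simp add: mult_ac)
  qed
  then show ?thesis using D by (intro exI[of _ "D powr A"]) auto
qed

lemma eventually_log_weight: "\<forall>\<^sub>F s in at_top. (\<Prod>j<length rs. ((ln ^^ (rs ! j)) s) powr (as ! j)) = log_weight rs as s"
proof -
  have "\<forall>\<^sub>F s in at_top. \<forall>j\<in>{..<length rs}. (ln ^^ (rs ! j)) s = ell (rs ! j) s"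
    by (intro eventually_ball_finite ballI eventually_ell) auto
  then show ?thesis by eventually_elim (simp add: log_weight_def)
qed

end

lemma power2_powr: "k > 0 \<Longrightarrow> (k\<^sup>2) powr e = k powr (2 * (e::real))"
  by (simp add: power2_eq_square powr_mult powr_add[symmetric])

section \<open>The density and its Laplace-type integral\<close>

locale amplitude =
  fixes rs :: "nat list" and as :: "real list" and \<delta> :: real and q :: nat
  assumes rs: "\<And>j. j < length rs \<Longrightarrow> rs ! j \<ge> 1" and as: "\<And>j. j < length rs \<Longrightarrow> as ! j \<ge> 0"
    and \<delta>: "0 < \<delta>" "\<delta> < 1/2"
begin

abbreviation L :: "real \<Rightarrow> real" where "L \<equiv> log_weight rs as"

definition block_exp :: real where "block_exp = real q + 3 - 2 * \<delta>"

definition bcoef :: "nat \<Rightarrow> real" where "bcoef n = (2 ^ n) powr (- block_exp) * L ((2 ^ n)\<^sup>2)"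

lemma block_exp_pos: "block_exp > 0"
  using \<delta> by (simp add: block_exp_def)

lemma L_ge_1: "L s \<ge> 1" by (rule log_weight_ge_1) (use rs as in auto)
lemma L_mono: "s \<le> t \<Longrightarrow> L s \<le> L t" by (rule log_weight_mono) (use rs as in auto)

lemma L_square_le:
  assumes "e > 0"
  shows "\<exists>C>0. \<forall>k\<ge>1. L (k\<^sup>2) \<le> C * k powr e"
proof -
  have "e / 2 > 0" using assms by simp
  with log_weight_mult[of rs as "e / 2"] rs as obtain C where C: "C > 0" "\<And>s y. s \<ge> 1 \<Longrightarrow> y \<ge> 1 \<Longrightarrow> L (s * y) \<le> C * L s * y powr (e / 2)"
    by blast
  have "L (k\<^sup>2) \<le> C * k powr e" if "k \<ge> 1" for k
  proof -
    have "1\<^sup>2 \<le> k\<^sup>2" using that by (intro power_mono) auto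
    then have "L (1 * k\<^sup>2) \<le> C * L 1 * (k\<^sup>2) powr (e / 2)" by (intro C(2)) auto
    also have "(k\<^sup>2) powr (e / 2) = k powr e"
      using that by (simp add: power2_powr)
    finally show ?thesis by (simp add: log_weight_at_1)
  qed
  then show ?thesis using C(1) by blast
qed

lemma bcoef_nonneg: "bcoef n \<ge> 0"
  unfolding bcoef_def using L_ge_1[of "(2 ^ n)\<^sup>2"] by simp

text \<open>On the block of index n one has k/2 < 2 ^ n < k, so powers of 2 ^ n become powers of k
  at the cost of a constant and L increases. Each derivative gains one power of 1/k from the
  dilation.\<close>

lemma rho_bound: "\<exists>C>0. \<forall>k\<ge>2. \<bar>rho bcoef a k\<bar> \<le> C * (k powr (- block_exp - real a) * L (k\<^sup>2))"
proof -
  obtain B where B: "B \<ge> 0" "\<And>y. \<bar>bump a y\<bar> \<le> B" using bump_bounded by blast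
  define C where "C = 2 powr (block_exp + real a) * (B + 1)"
  have C: "C > 0" using B(1) by (simp add: C_def)
  have "\<bar>rho bcoef a k\<bar> \<le> C * (k powr (- block_exp - real a) * L (k\<^sup>2))" if k: "k \<ge> 2" for k
  proof (rule rho_cases[of bcoef k])
    assume "\<And>a. rho bcoef a k = 0"
    then show ?thesis using C L_ge_1[of "k\<^sup>2"] by simp
  next
    fix n :: nat assume n: "n \<ge> 1" "2 ^ n < k" "k < 2 ^ Suc n"
    have p: "((2::real) ^ n) powr (- block_exp) * (1 / 2 ^ n) ^ a = (2 ^ n) powr (- block_exp - real a)"
      by (simp add: powr_diff powr_realpow power_one_over divide_inverse power_inverse)
    have "(k / 2) powr (block_exp + real a) \<le> (2 ^ n) powr (block_exp + real a)"
      using n k block_exp_pos by (intro powr_mono2) auto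
    then have "((2::real) ^ n) powr - (block_exp + real a) \<le> (k / 2) powr - (block_exp + real a)"
      using k by (simp only: powr_minus) (intro le_imp_inverse_le, auto)
    also have "\<dots> = 2 powr (block_exp + real a) * k powr (- block_exp - real a)"
      using k by (simp add: powr_divide powr_minus field_simps powr_diff powr_add)
    finally have p2: "((2::real) ^ n) powr (- block_exp - real a) \<le> 2 powr (block_exp + real a) * k powr (- block_exp - real a)" by simp
    have "((2::real) ^ n)\<^sup>2 \<le> k\<^sup>2" using n by (intro power_mono) auto
    then have l: "L ((2 ^ n)\<^sup>2) \<le> L (k\<^sup>2)" by (rule L_mono)
    have "\<bar>rho bcoef a k\<bar> = ((2 ^ n) powr (- block_exp) * (1 / 2 ^ n) ^ a) * L ((2 ^ n)\<^sup>2) * \<bar>bump a (k / 2 ^ n)\<bar>"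
      using L_ge_1[of "(2 ^ n)\<^sup>2"] by (simp add: rho_single[OF n(2,3,1)] bcoef_def abs_mult)
    also have "\<dots> \<le> (2 powr (block_exp + real a) * k powr (- block_exp - real a)) * L (k\<^sup>2) * (B + 1)"
      unfolding p using B(2)[of "k / 2 ^ n"] L_ge_1[of "k\<^sup>2"] L_ge_1[of "(2 ^ n)\<^sup>2"]
      by (intro mult_mono p2 l) auto
    finally show ?thesis by (simp add: C_def mult_ac)
  qed
  then show ?thesis using C by blast
qed

lemma rho_powr_bound:
  assumes e: "e > 0"
  shows "\<exists>C>0. \<forall>k\<ge>2. \<bar>rho bcoef a k\<bar> \<le> C * k powr (- block_exp - real a + e)"
proof -
  obtain C where C: "C > 0" "\<And>k. k \<ge> 2 \<Longrightarrow> \<bar>rho bcoef a k\<bar> \<le> C * (k powr (- block_exp - real a) * L (k\<^sup>2))"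
    using rho_bound by blast
  obtain D where D: "D > 0" "\<And>k. k \<ge> 1 \<Longrightarrow> L (k\<^sup>2) \<le> D * k powr e" using L_square_le[OF e] by blast
  have "\<bar>rho bcoef a k\<bar> \<le> C * D * k powr (- block_exp - real a + e)" if k: "k \<ge> 2" for k
  proof -
    have "\<bar>rho bcoef a k\<bar> \<le> C * (k powr (- block_exp - real a) * (D * k powr e))"
      using C(1) D(2)[of k] k by (intro order_trans[OF C(2)[OF k]] mult_left_mono) auto
    then show ?thesis by (simp add: powr_add mult_ac)
  qed
  then show ?thesis using C D by (intro exI[of _ "C * D"]) auto
qed

lemma rho_bounded: "\<exists>C. \<forall>k. \<bar>rho bcoef a k\<bar> \<le> C"
proof -
  obtain C where C: "C > 0" "\<And>k. k \<ge> 2 \<Longrightarrow> \<bar>rho bcoef a k\<bar> \<le> C * k powr (- block_exp - real a + block_exp)"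
    using rho_powr_bound[OF block_exp_pos] by blast
  have "\<bar>rho bcoef a k\<bar> \<le> C" for k
  proof (cases "k \<ge> 2")
    case True
    have "k powr (- block_exp - real a + block_exp) \<le> k powr 0" using True by (intro powr_mono) auto
    then have "C * k powr (- block_exp - real a + block_exp) \<le> C * 1" using True C(1) by (intro mult_left_mono) auto
    then show ?thesis using C(2)[OF True] by simp
  next
    case False then show ?thesis using C(1) rho_supp[of k bcoef a] by simp
  qed
  then show ?thesis by blast
qed

text \<open>The margin 1/2 - \<delta> pays for the logarithms, and the exponent left over, \<delta>
  - 3/2, is below -1. Derivatives have correspondingly more moments, which is what integration by
  parts uses.\<close>

lemma rho_moment: "\<exists>C>0. \<forall>k\<ge>2. \<bar>rho bcoef a k\<bar> * k ^ (q + 1 + a) \<le> C * k powr (\<delta> - 3/2)"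
proof -
  have e: "1/2 - \<delta> > 0" using \<delta> by simp
  obtain C where C: "C > 0" "\<And>k. k \<ge> 2 \<Longrightarrow> \<bar>rho bcoef a k\<bar> \<le> C * k powr (- block_exp - real a + (1/2 - \<delta>))"
    using rho_powr_bound[OF e] by blast
  have "\<bar>rho bcoef a k\<bar> * k ^ (q + 1 + a) \<le> C * k powr (\<delta> - 3/2)" if k: "k \<ge> 2" for k
  proof -
    have "\<bar>rho bcoef a k\<bar> * k ^ (q + 1 + a) \<le> C * k powr (- block_exp - real a + (1/2 - \<delta>)) * k powr real (q + 1 + a)"
      using C(2)[OF k] k by (subst powr_realpow) (auto intro: mult_right_mono)
    also have "\<dots> = C * k powr (- block_exp - real a + (1/2 - \<delta>) + real (q + 1 + a))" by (simp only: powr_add mult.assoc)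
    also have "- block_exp - real a + (1/2 - \<delta>) + real (q + 1 + a) = \<delta> - 3/2" by (simp add: block_exp_def)
    finally show ?thesis .
  qed
  then show ?thesis using C(1) by blast
qed

lemma integrable_tail: "integrable lborel (\<lambda>k. indicator {2..} k * k powr (\<delta> - 3/2))"
  using has_bochner_integral_powr_to_inf[of "\<delta> - 3/2" 2] \<delta> by (auto simp: has_bochner_integral_iff)

lemma rho_measurable [measurable]: "rho bcoef a \<in> borel_measurable borel"
  by (rule borel_measurable_continuous_onI)
    (meson DERIV_continuous rho_deriv continuous_at_imp_continuous_on)

context
  fixes q1 q2 :: nat
  assumes q12: "q1 + 2 * q2 = q + 1"
begin

text \<open>Up to constants the linear part, at \<open>x0\<close>, of a derivative of the solution.
  The exponent is \<open>Suc q1\<close> because the solution is itself an x-derivative.\<close>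

definition sing_int :: "real \<Rightarrow> real" where
  "sing_int \<tau> = (\<integral>k. rho bcoef 0 k * (k ^ Suc q1 * la k ^ q2 * exp (- la k * \<tau>)) \<partial>lborel)"

lemma weight_le: "k \<ge> 2 \<Longrightarrow> k ^ Suc q1 * la k ^ q2 \<le> k ^ (q + 2)"
proof -
  assume k: "k \<ge> 2"
  have "la k \<ge> 0" using la_lower[of k] k by (intro order_trans[OF _ la_lower]) auto
  then have "k ^ Suc q1 * la k ^ q2 \<le> k ^ Suc q1 * (k\<^sup>2) ^ q2"
    using k la_upper[of k] by (intro mult_left_mono power_mono) auto
  also have "\<dots> = k ^ (Suc q1 + 2 * q2)" by (simp only: power_add power_mult)
  finally show ?thesis using q12 by simp
qed

lemma sing_int_pointwise_upper:
  "\<exists>C>0. \<forall>\<tau> k. 0 < \<tau> \<longrightarrow> \<tau> \<le> 1 \<longrightarrow> rho bcoef 0 k * (k ^ Suc q1 * la k ^ q2 * exp (- la k * \<tau>)) \<le>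
    C * L (1 / \<tau>) * (indicator {0..\<tau> powr (-1/2)} k * k powr (2 * \<delta> - 1) + 1 / \<tau> * (indicator {\<tau> powr (-1/2)..} k * k powr (2 * \<delta> - 3)))"
proof -
  obtain C where C: "C > 0" "\<And>k. k \<ge> 2 \<Longrightarrow> \<bar>rho bcoef 0 k\<bar> \<le> C * (k powr (- block_exp - real 0) * L (k\<^sup>2))"
    using rho_bound by blast
  obtain D where D: "D > 0" "\<And>s y. s \<ge> 1 \<Longrightarrow> y \<ge> 1 \<Longrightarrow> L (s * y) \<le> D * L s * y powr 1"
    using log_weight_mult[of rs as 1] rs as by auto
  define E where "E = C * (1 + 8 * D)"
  have "rho bcoef 0 k * (k ^ Suc q1 * la k ^ q2 * exp (- la k * \<tau>)) \<le>
    E * L (1 / \<tau>) * (indicator {0..\<tau> powr (-1/2)} k * k powr (2 * \<delta> - 1) + 1 / \<tau> * (indicator {\<tau> powr (-1/2)..} k * k powr (2 * \<delta> - 3)))"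
    (is "?l \<le> ?r") if \<tau>: "0 < \<tau>" "\<tau> \<le> 1" for \<tau> k
  proof (cases "k \<ge> 2")
    case False
    then have "?l = 0" by (simp add: rho_supp)
    also have "0 \<le> ?r" using \<tau> C(1) D(1) L_ge_1[of "1 / \<tau>"] by (auto simp: E_def intro!: mult_nonneg_nonneg add_nonneg_nonneg)
    finally show ?thesis .
  next
    case k: True
    define A where "A = \<tau> powr (-1/2)"
    have "\<tau> powr (-1/2) * \<tau> powr (-1/2) = \<tau> powr (-1/2 + -1/2)" by (rule powr_add[symmetric])
    also have "\<dots> = \<tau> powr - 1" by (rule arg_cong[where f="\<lambda>x. \<tau> powr x"]) simp
    also have "\<dots> = 1 / \<tau>" by (rule powr_neg_one[OF \<tau>(1)])
    finally have "A\<^sup>2 = 1 / \<tau>" by (simp only: A_def power2_eq_square)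
    moreover have "A > 0" using \<tau> by (simp add: A_def)
    ultimately have A: "A > 0" "A\<^sup>2 = 1 / \<tau>" by auto
    have la0: "la k \<ge> 0" using la_lower[of k] k by (intro order_trans[OF _ la_lower]) auto
    have e: "exp (- la k * \<tau>) \<le> exp (- (k\<^sup>2 * \<tau> / 2))" using la_lower[of k] k \<tau> by simp
    have "?l \<le> \<bar>rho bcoef 0 k\<bar> * (k ^ (q + 2) * exp (- (k\<^sup>2 * \<tau> / 2)))"
      using weight_le[OF k] e la0 k by (intro mult_mono) auto
    also have "\<dots> \<le> (C * (k powr (- block_exp - real 0) * L (k\<^sup>2))) * (k ^ (q + 2) * exp (- (k\<^sup>2 * \<tau> / 2)))"
      using C(2)[OF k] k by (intro mult_right_mono) auto
    also have "\<dots> = C * (k powr (- block_exp) * k powr real (q + 2)) * (L (k\<^sup>2) * exp (- (k\<^sup>2 * \<tau> / 2)))"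
      using k by (subst powr_realpow) (auto simp: mult_ac)
    also have "k powr (- block_exp) * k powr real (q + 2) = k powr (2 * \<delta> - 1)"
      by (simp add: block_exp_def flip: powr_add)
    finally have l: "?l \<le> C * k powr (2 * \<delta> - 1) * (L (k\<^sup>2) * exp (- (k\<^sup>2 * \<tau> / 2)))" .
    show ?thesis
    proof (cases "k \<le> A")
      case True
      then have "k\<^sup>2 \<le> 1 / \<tau>" unfolding A(2)[symmetric] using k by (intro power_mono) auto
      then have "L (k\<^sup>2) * exp (- (k\<^sup>2 * \<tau> / 2)) \<le> L (1 / \<tau>) * 1"
        using \<tau> L_ge_1[of "1 / \<tau>"] by (intro mult_mono L_mono) auto
      then have "?l \<le> C * k powr (2 * \<delta> - 1) * L (1 / \<tau>)"
        using C(1) k by (intro order_trans[OF l] mult_left_mono) auto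
      also have "\<dots> \<le> E * k powr (2 * \<delta> - 1) * L (1 / \<tau>)"
        using C(1) D(1) k L_ge_1[of "1 / \<tau>"] by (intro mult_right_mono) (auto simp: E_def)
      also have "\<dots> = E * L (1 / \<tau>) * (k powr (2 * \<delta> - 1))" by simp
      also have "\<dots> \<le> ?r"
        using True k C(1) D(1) \<tau> L_ge_1[of "1 / \<tau>"] unfolding A_def[symmetric] by (intro mult_left_mono) (auto simp: E_def)
      finally show ?thesis .
    next
      case False
      then have k1: "1 / \<tau> \<le> k\<^sup>2" unfolding A(2)[symmetric] using A(1) by (intro power_mono) auto
      define z where "z = k\<^sup>2 * \<tau>"
      have z: "z \<ge> 1" using k1 \<tau> by (simp add: z_def field_simps)
      have "L (1 / \<tau> * z) \<le> D * L (1 / \<tau>) * z powr 1" using z \<tau> by (intro D(2)) auto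
      then have Lk: "L (k\<^sup>2) \<le> D * L (1 / \<tau>) * z" using z \<tau> by (simp add: z_def)
      have ze: "z * exp (- (z / 2)) \<le> 8 / z"
      proof -
        have "(z / 2) ^ 2 \<le> fact 2 * exp (z / 2)" using z by (intro pow_le_fact_exp) auto
        then have "z * z * exp (- (z / 2)) \<le> 8 * exp (z / 2) * exp (- (z / 2))"
          by (intro mult_right_mono) (auto simp: power2_eq_square)
        then have "z * z * exp (- (z / 2)) \<le> 8" by (simp only: mult.assoc exp_minus_inverse mult_1_right)
        then show ?thesis using z by (simp add: field_simps)
      qed
      have "L (k\<^sup>2) * exp (- (z / 2)) \<le> D * L (1 / \<tau>) * z * exp (- (z / 2))"
        by (rule mult_right_mono[OF Lk]) simp
      also have "\<dots> = D * L (1 / \<tau>) * (z * exp (- (z / 2)))" by simp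
      also have "\<dots> \<le> D * L (1 / \<tau>) * (8 / z)"
        using D(1) L_ge_1[of "1 / \<tau>"] by (intro mult_left_mono ze) auto
      finally have "L (k\<^sup>2) * exp (- (z / 2)) \<le> D * L (1 / \<tau>) * (8 / z)" .
      then have "?l \<le> C * k powr (2 * \<delta> - 1) * (D * L (1 / \<tau>) * (8 / z))"
        unfolding z_def using C(1) k by (intro order_trans[OF l] mult_left_mono) auto
      also have "\<dots> = (8 * C * D) * L (1 / \<tau>) * (1 / \<tau> * (k powr (2 * \<delta> - 1) / k\<^sup>2))"
        using \<tau> k by (simp add: z_def mult_ac)
      also have "k powr (2 * \<delta> - 1) / k\<^sup>2 = k powr (2 * \<delta> - 3)"
      proof -
        have "k powr (2 * \<delta> - 3) = k powr ((2 * \<delta> - 1) - 2)" by simp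
        also have "\<dots> = k powr (2 * \<delta> - 1) / k powr 2" by (rule powr_diff)
        finally show ?thesis using k by simp
      qed
      also have "(8 * C * D) * L (1 / \<tau>) * (1 / \<tau> * k powr (2 * \<delta> - 3)) \<le> E * L (1 / \<tau>) * (1 / \<tau> * k powr (2 * \<delta> - 3))"
        using C(1) D(1) \<tau> L_ge_1[of "1 / \<tau>"] by (intro mult_right_mono) (auto simp: E_def algebra_simps)
      also have "\<dots> \<le> ?r"
        using False k C(1) D(1) \<tau> L_ge_1[of "1 / \<tau>"] unfolding A_def[symmetric] by (intro mult_left_mono) (auto simp: E_def)
      finally show ?thesis .
    qed
  qed
  moreover have "E > 0" using C(1) D(1) by (auto simp: E_def intro!: mult_pos_pos add_pos_pos)
  ultimately show ?thesis by blast
qed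

lemma sing_int_nonneg: "rho bcoef 0 k * (k ^ Suc q1 * la k ^ q2 * exp (- la k * \<tau>)) \<ge> 0"
proof (cases "k \<ge> 2")
  case True
  then have "la k \<ge> 0" using la_lower[of k] by (intro order_trans[OF _ la_lower]) auto
  then show ?thesis using True rho_nonneg[of bcoef k] bcoef_nonneg by simp
qed (simp add: rho_supp)

text \<open>Both pieces of the pointwise bound integrate to a constant times \<tau> powr (-
  \<delta>). The constants 1/(2\<delta>) and 1/(2 - 2\<delta>) come from the power integrals on
  either side of the cut; \<delta> > 0 makes the first one converge at 0.\<close>

lemma sing_int_upper:
  "\<exists>C>0. \<forall>\<tau>. 0 < \<tau> \<longrightarrow> \<tau> \<le> 1 \<longrightarrow> 
    integrable lborel (\<lambda>k. rho bcoef 0 k * (k ^ Suc q1 * la k ^ q2 * exp (- la k * \<tau>))) \<and> sing_int \<tau> \<le> C * (L (1 / \<tau>) / \<tau> powr \<delta>)"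
proof -
  obtain C where C: "C > 0" "\<And>\<tau> k. 0 < \<tau> \<Longrightarrow> \<tau> \<le> 1 \<Longrightarrow> rho bcoef 0 k * (k ^ Suc q1 * la k ^ q2 * exp (- la k * \<tau>)) \<le>
    C * L (1 / \<tau>) * (indicator {0..\<tau> powr (-1/2)} k * k powr (2 * \<delta> - 1) + 1 / \<tau> * (indicator {\<tau> powr (-1/2)..} k * k powr (2 * \<delta> - 3)))"
    using sing_int_pointwise_upper by blast
  define D where "D = C * (1 / (2 * \<delta>) + 1 / (2 - 2 * \<delta>))"
  have D: "D > 0" unfolding D_def using \<delta> C(1) by (intro mult_pos_pos add_pos_pos) auto
  have "integrable lborel (\<lambda>k. rho bcoef 0 k * (k ^ Suc q1 * la k ^ q2 * exp (- la k * \<tau>))) \<and> sing_int \<tau> \<le> D * (L (1 / \<tau>) / \<tau> powr \<delta>)"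
    if \<tau>: "0 < \<tau>" "\<tau> \<le> 1" for \<tau>
  proof -
    define A where "A = \<tau> powr (-1/2)"
    have A: "A > 0" using \<tau> by (simp add: A_def)
    define G where "G k = C * L (1 / \<tau>) * (indicator {0..A} k * k powr (2 * \<delta> - 1) + 1 / \<tau> * (indicator {A..} k * k powr (2 * \<delta> - 3)))" for k
    have "has_bochner_integral lborel (\<lambda>x. indicator {0..A} x * x powr (2 * \<delta> - 1)) (A powr (2 * \<delta> - 1 + 1) / (2 * \<delta> - 1 + 1))"
      using \<delta> A by (intro has_bochner_integral_powr_from_0) auto
    then have 1: "has_bochner_integral lborel (\<lambda>x. indicator {0..A} x * x powr (2 * \<delta> - 1)) (\<tau> powr (- \<delta>) / (2 * \<delta>))"
      by (simp add: A_def powr_powr)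
    have "has_bochner_integral lborel (\<lambda>x. indicator {A..} x * x powr (2 * \<delta> - 3)) (- (A powr (2 * \<delta> - 3 + 1)) / (2 * \<delta> - 3 + 1))"
      using \<delta> A by (intro has_bochner_integral_powr_to_inf) auto
    moreover have "- (A powr (2 * \<delta> - 3 + 1)) / (2 * \<delta> - 3 + 1) = \<tau> powr (1 - \<delta>) / (2 - 2 * \<delta>)"
    proof -
      have "A powr (2 * \<delta> - 3 + 1) = \<tau> powr (1 - \<delta>)" by (simp add: A_def powr_powr algebra_simps)
      moreover have "2 * \<delta> - 3 + 1 = - (2 - 2 * \<delta>)" by simp
      ultimately show ?thesis by (simp only: minus_divide_divide)
    qed
    ultimately have 2: "has_bochner_integral lborel (\<lambda>x. indicator {A..} x * x powr (2 * \<delta> - 3)) (\<tau> powr (1 - \<delta>) / (2 - 2 * \<delta>))"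
      by simp
    have G: "has_bochner_integral lborel G (C * L (1 / \<tau>) * (\<tau> powr (- \<delta>) / (2 * \<delta>) + 1 / \<tau> * (\<tau> powr (1 - \<delta>) / (2 - 2 * \<delta>))))"
      unfolding G_def[abs_def] by (intro has_bochner_integral_mult_right has_bochner_integral_add 1 2)
    have le: "rho bcoef 0 k * (k ^ Suc q1 * la k ^ q2 * exp (- la k * \<tau>)) \<le> G k" for k
      unfolding G_def A_def by (rule C(2)[OF \<tau>])
    have i: "integrable lborel (\<lambda>k. rho bcoef 0 k * (k ^ Suc q1 * la k ^ q2 * exp (- la k * \<tau>)))"
    proof (rule Bochner_Integration.integrable_bound)
      show "integrable lborel G" using G by (simp add: has_bochner_integral_iff)
      show "AE k in lborel. norm (rho bcoef 0 k * (k ^ Suc q1 * la k ^ q2 * exp (- la k * \<tau>))) \<le> norm (G k)"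
        using le sing_int_nonneg by (intro AE_I2) (metis abs_of_nonneg order_trans real_norm_def)
    qed measurable
    have "sing_int \<tau> \<le> (\<integral>k. G k \<partial>lborel)"
      unfolding sing_int_def using G by (intro Bochner_Integration.integral_mono i le) (auto simp: has_bochner_integral_iff)
    also have "\<dots> = C * L (1 / \<tau>) * (\<tau> powr (- \<delta>) / (2 * \<delta>) + 1 / \<tau> * (\<tau> powr (1 - \<delta>) / (2 - 2 * \<delta>)))"
      by (rule has_bochner_integral_integral_eq[OF G])
    also have "1 / \<tau> * (\<tau> powr (1 - \<delta>) / (2 - 2 * \<delta>)) = \<tau> powr (- \<delta>) / (2 - 2 * \<delta>)"
      using \<tau> by (simp add: powr_diff powr_minus field_simps)
    also have "C * L (1 / \<tau>) * (\<tau> powr (- \<delta>) / (2 * \<delta>) + \<tau> powr (- \<delta>) / (2 - 2 * \<delta>)) = D * (L (1 / \<tau>) * \<tau> powr (- \<delta>))"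
      by (simp add: D_def distrib_left distrib_right)
    also have "L (1 / \<tau>) * \<tau> powr (- \<delta>) = L (1 / \<tau>) / \<tau> powr \<delta>" by (simp add: powr_minus divide_inverse)
    finally show ?thesis using i by simp
  qed
  then show ?thesis using D by blast
qed

text \<open>The integrand is nonnegative, so a single block at the scale \<tau> powr (-1/2)
  suffices: there the bump is bounded below in its middle half and the exponential is of order
  one.\<close>

lemma sing_int_lower:
  "\<exists>C>0. \<forall>\<tau>. 0 < \<tau> \<longrightarrow> \<tau> \<le> 1/4 \<longrightarrow> C * (L (1 / \<tau>) / \<tau> powr \<delta>) \<le> sing_int \<tau>"
proof -
  define C where "C = exp (-8) * (1 / 2 ^ q2) * exp (-16) / (2::real)"
  have C: "C > 0" by (simp add: C_def)
  have "C * (L (1 / \<tau>) / \<tau> powr \<delta>) \<le> sing_int \<tau>" if \<tau>: "0 < \<tau>" "\<tau> \<le> 1/4" for \<tau>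
  proof -
    have "\<exists>n. 1 / \<tau> \<le> (4::real) ^ n" using real_arch_pow[of 4 "1 / \<tau>"] by (auto intro: less_imp_le)
    \<comment> \<open>Minimality of n gives 4 ^ n * \<tau> \<le> 4, so the block is neither below
      nor far above the critical scale; \<tau> \<le> 1/4 ensures n \<ge> 1, the first index used in
      \<open>rho\<close>.\<close>
    then obtain n where n: "1 / \<tau> \<le> (4::real) ^ n" "\<And>m. m < n \<Longrightarrow> \<not> 1 / \<tau> \<le> (4::real) ^ m"
      using exists_least_iff[of "\<lambda>n. 1 / \<tau> \<le> (4::real) ^ n"] by blast
    have "1 / \<tau> \<ge> 4" using \<tau> by (simp add: field_simps)
    then have n0: "n \<ge> 1" using n(1) by (cases n) auto
    then have "(4::real) ^ (n - 1) < 1 / \<tau>" using n(2)[of "n - 1"] by auto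
    then have n4: "(4::real) ^ n * \<tau> \<le> 4" using n0 \<tau> by (cases n) (auto simp: field_simps)
    define a where "a = (2::real) ^ n"
    have a: "a \<ge> 1" "a\<^sup>2 = 4 ^ n" by (simp_all add: a_def power2_eq_square flip: power_mult_distrib)
    define K where "K = bcoef n * exp (-8) * (a ^ (q + 2) * (1 / 2 ^ q2) * exp (-16))"
    have le: "indicator {5/4 * a..7/4 * a} k * K \<le> rho bcoef 0 k * (k ^ Suc q1 * la k ^ q2 * exp (- la k * \<tau>))" for k
    proof (cases "k \<in> {5/4 * a..7/4 * a}")
      case False then show ?thesis using sing_int_nonneg[of k \<tau>] by simp
    next
      case True
      then have k: "5/4 \<le> k / a" "k / a \<le> 7/4" "a < k" "k < 2 * a" using a by (auto simp: field_simps)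
      then have r: "rho bcoef 0 k = bcoef n * bump 0 (k / a)"
        using rho_single[of n k bcoef 0] n0 by (simp add: a_def)
      have "(2::real) ^ 1 \<le> a" unfolding a_def using n0 by (intro power_increasing) auto
      then have k2: "k \<ge> 2" using k by simp
      have ak: "a\<^sup>2 \<le> k\<^sup>2" using a k by (intro power_mono) auto
      have "a ^ (q + 2) * (1 / 2 ^ q2) = a ^ Suc q1 * (a\<^sup>2 / 2) ^ q2"
      proof -
        have "q + 2 = Suc q1 + 2 * q2" using q12 by simp
        then show ?thesis by (simp only: power_add power_mult power_divide) simp
      qed
      also have "\<dots> \<le> k ^ Suc q1 * la k ^ q2"
        using k a ak la_lower[of k] k2 by (intro mult_mono power_mono) auto
      finally have w: "a ^ (q + 2) * (1 / 2 ^ q2) \<le> k ^ Suc q1 * la k ^ q2" .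
      have "la k * \<tau> \<le> (2 * a)\<^sup>2 * \<tau>"
      proof (rule mult_right_mono)
        have "la k \<le> k\<^sup>2" using k2 by (intro la_upper) auto
        also have "\<dots> \<le> (2 * a)\<^sup>2" using k a k2 by (intro power_mono) auto
        finally show "la k \<le> (2 * a)\<^sup>2" .
      qed (use \<tau> in simp)
      also have "\<dots> = 4 * (4 ^ n * \<tau>)" by (simp add: power_mult_distrib a)
      finally have "la k * \<tau> \<le> 16" using n4 by linarith
      then have e: "exp (-16) \<le> exp (- la k * \<tau>)" by simp
      have "K \<le> (bcoef n * bump 0 (k / a)) * (k ^ Suc q1 * la k ^ q2 * exp (- la k * \<tau>))"
        unfolding K_def using bump_lower[OF k(1,2)] a k2 order_trans[OF _ w, of 0] bump_nonneg bcoef_nonneg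
        by (intro mult_mono w e) auto
      then show ?thesis using True r by simp
    qed
    have "C * (L (1 / \<tau>) / \<tau> powr \<delta>) \<le> C * (L (4 ^ n) * (4 ^ n) powr \<delta>)"
    proof (intro mult_left_mono)
      have "1 / \<tau> powr \<delta> = (1 / \<tau>) powr \<delta>" using \<tau> by (simp add: powr_divide)
      also have "\<dots> \<le> (4 ^ n) powr \<delta>" using \<tau> \<delta> n by (intro powr_mono2) auto
      finally have "L (1 / \<tau>) * (1 / \<tau> powr \<delta>) \<le> L (4 ^ n) * (4 ^ n) powr \<delta>"
        using L_ge_1[of "4 ^ n"] by (intro mult_mono L_mono n(1)) auto
      then show "L (1 / \<tau>) / \<tau> powr \<delta> \<le> L (4 ^ n) * (4 ^ n) powr \<delta>" by simp
    qed (use C in simp)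
    also have "\<dots> = K * (a / 2)"
    proof -
      have "(4 ^ n) powr \<delta> = a powr (2 * \<delta>)" using a(1) power2_powr[of a \<delta>] by (simp add: a(2))
      also have "2 * \<delta> = - block_exp + real (q + 3)" by (simp add: block_exp_def)
      also have "a powr (- block_exp + real (q + 3)) = a powr (- block_exp) * a ^ (q + 3)"
        using a(1) by (subst powr_add, subst powr_realpow) auto
      also have "\<dots> = a powr (- block_exp) * (a ^ (q + 2) * a)" by (simp add: eval_nat_numeral)
      finally show ?thesis by (simp add: C_def K_def bcoef_def flip: a(2)) (simp add: a_def)
    qed
    also have "\<dots> = (\<integral>k. indicator {5/4 * a..7/4 * a} k * K \<partial>lborel)"
      using a by (simp add: field_simps)
    also have "\<dots> \<le> sing_int \<tau>"
      unfolding sing_int_def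
    proof (rule Bochner_Integration.integral_mono[OF _ _ le])
      show "integrable lborel (\<lambda>k. rho bcoef 0 k * (k ^ Suc q1 * la k ^ q2 * exp (- la k * \<tau>)))"
        using sing_int_upper \<tau> by auto
      show "integrable lborel (\<lambda>k. indicator {5/4 * a..7/4 * a} k * K)"
        by (intro integrable_mult_left integrable_real_indicator) (auto simp: emeasure_lborel_Icc_eq)
    qed
    finally show ?thesis .
  qed
  then show ?thesis using C by blast
qed

end

end

section \<open>Differential polynomials and the Boussinesq equation\<close>

text \<open>Differential polynomials in the sums \<open>cauchy_sum i j\<close>. Both partial derivatives act as derivations on them, so
  all space-time derivatives of the solution are again of this form.\<close>

datatype fp = V nat nat | Add fp fp | Mul fp fp | Scale complex fp

text \<open>The value on generators is the case e = 1, c = 1 of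
  \<open>cauchy_sum_derivative\<close>.\<close>

primrec D1 :: "fp \<Rightarrow> fp" where
  "D1 (V i j) = Add (V i (Suc j)) (Scale (- 1) (Add (V (Suc i) j) (Mul (V i 0) (V 0 j))))"
| "D1 (Add a b) = Add (D1 a) (D1 b)"
| "D1 (Mul a b) = Add (Mul (D1 a) b) (Mul a (D1 b))"
| "D1 (Scale c a) = Scale c (D1 a)"

text \<open>The value on generators is the case e = 2, c = - \<i> sqrt 3 of
  \<open>cauchy_sum_derivative\<close>.\<close>

primrec D2 :: "fp \<Rightarrow> fp" where
  "D2 (V i j) = Scale (- \<i> * of_real (sqrt 3)) (Add (V i (Suc (Suc j)))
     (Scale (- 1) (Add (V (Suc (Suc i)) j) (Add (Mul (V i 1) (V 0 j)) (Mul (V i 0) (V 1 j))))))"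
| "D2 (Add a b) = Add (D2 a) (D2 b)"
| "D2 (Mul a b) = Add (Mul (D2 a) b) (Mul a (D2 b))"
| "D2 (Scale c a) = Scale c (D2 a)"

primrec Dw :: "bool list \<Rightarrow> fp \<Rightarrow> fp" where
  "Dw [] e = e"
| "Dw (b # w) e = (if b then D1 (Dw w e) else D2 (Dw w e))"

text \<open>The scaling weight: \<open>D1\<close> raises it by 1 and \<open>D2\<close> by 2, as x
  and t derivatives count in the regularity statement. The summand 1 in the weight of a generator
  makes all weights positive, so both factors of a product are strictly lighter than the
  product.\<close>

primrec homog :: "nat \<Rightarrow> fp \<Rightarrow> bool" where
  "homog w (V i j) = (i + j + 1 = w)"
| "homog w (Add a b) = (homog w a \<and> homog w b)"
| "homog w (Mul a b) = (\<exists>u v. u + v = w \<and> homog u a \<and> homog v b)"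
| "homog w (Scale c a) = homog w a"

lemma homog_V [intro]: "i + j + 1 = w \<Longrightarrow> homog w (V i j)"
  and homog_Add [intro]: "homog w a \<Longrightarrow> homog w b \<Longrightarrow> homog w (Add a b)"
  and homog_Scale [intro]: "homog w a \<Longrightarrow> homog w (Scale c a)"
  by simp_all
lemma homog_Mul [intro]: "homog u a \<Longrightarrow> homog v b \<Longrightarrow> u + v = w \<Longrightarrow> homog w (Mul a b)"
  by auto

lemma homog_pos: "homog w e \<Longrightarrow> w > 0"
  by (induction e arbitrary: w) auto

lemma homog_D1: "homog w e \<Longrightarrow> homog (Suc w) (D1 e)"
proof (induction e arbitrary: w)
  case (V i j)
  have "homog (Suc w) (Mul (V i 0) (V 0 j))" by (rule homog_Mul[OF homog_V homog_V]) (use V in auto)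
  then show ?case using V by auto
next
  case (Mul a b)
  then obtain u v where "u + v = w" "homog u a" "homog v b" by auto
  then have "homog (Suc w) (Mul (D1 a) b)" "homog (Suc w) (Mul a (D1 b))"
    using homog_Mul[OF Mul.IH(1), of u v b "Suc w"] homog_Mul[OF _ Mul.IH(2), of u a v "Suc w"] by auto
  then show ?case by auto
qed auto

lemma homog_D2: "homog w e \<Longrightarrow> homog (Suc (Suc w)) (D2 e)"
proof (induction e arbitrary: w)
  case (V i j)
  have "homog (Suc (Suc w)) (Mul (V i 1) (V 0 j))" "homog (Suc (Suc w)) (Mul (V i 0) (V 1 j))"
    by (rule homog_Mul[OF homog_V homog_V], use V in auto)+
  then show ?case using V by auto
next
  case (Mul a b)
  then obtain u v where "u + v = w" "homog u a" "homog v b" by auto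
  then have "homog (Suc (Suc w)) (Mul (D2 a) b)" "homog (Suc (Suc w)) (Mul a (D2 b))"
    using homog_Mul[OF Mul.IH(1), of u v b "Suc (Suc w)"] homog_Mul[OF _ Mul.IH(2), of u a v "Suc (Suc w)"] by auto
  then show ?case by auto
qed auto

lemma homog_Dw: "homog w e \<Longrightarrow> homog (w + length (filter id bs) + 2 * length (filter Not bs)) (Dw bs e)"
  by (induction bs) (auto dest: homog_D1 homog_D2)

text \<open>The Fourier symbol of the linear part: to first order in the weight,
  \<open>V i j\<close> is the integral of the weight against qq k ^ i * pp k ^ j, and products are
  of higher order.\<close>

primrec lin :: "fp \<Rightarrow> real \<Rightarrow> complex" where
  "lin (V i j) k = qq k ^ i * pp k ^ j"
| "lin (Add a b) k = lin a k + lin b k"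
| "lin (Mul a b) k = 0"
| "lin (Scale c a) k = c * lin a k"

lemma lin_D1: "lin (D1 e) k = lin e k * (\<i> * of_real k)"
proof -
  have "lin (D1 e) k = lin e k * (pp k - qq k)"
  proof (induction e)
    case (V i j) then show ?case by (simp add: algebra_simps)
  qed (simp_all add: distrib_right)
  then show ?thesis by (simp only: pp_minus_qq)
qed

lemma lin_D2: "lin (D2 e) k = lin e k * of_real (la k)"
proof -
  have "lin (D2 e) k = lin e k * (- \<i> * of_real (sqrt 3) * ((pp k)\<^sup>2 - (qq k)\<^sup>2))"
  proof (induction e)
    case (V i j) then show ?case by (simp add: algebra_simps power2_eq_square)
  qed (simp_all only: D2.simps lin.simps distrib_right mult.assoc mult_zero_left add_0)
  then show ?thesis by (simp only: pp_qq_sq)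
qed

lemma lin_Dw: "lin (Dw bs e) k = lin e k * (\<i> * of_real k) ^ length (filter id bs) * of_real (la k) ^ length (filter Not bs)"
  by (induction bs) (auto simp: lin_D1 lin_D2)

section \<open>Evaluation of differential polynomials and the nonlinear equation\<close>

text \<open>\<open>F_dx\<close> and \<open>F_dx3\<close> are two formulas for the same x-derivative,
  available because the third flow is proportional to the first on the curve. Their equality is the
  reduction from KP to Boussinesq.\<close>

locale flow =
  fixes F :: "nat \<Rightarrow> nat \<Rightarrow> real \<times> real \<Rightarrow> complex" and T :: real
  assumes T: "T > 0"
    and F_dx: "0 \<le> t \<Longrightarrow> t < T \<Longrightarrow> ((\<lambda>y. F i j (y, t)) has_vector_derivative
        F i (Suc j) (x, t) - F (Suc i) j (x, t) - F i 0 (x, t) * F 0 j (x, t)) (at x)"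
    and F_dx3: "0 \<le> t \<Longrightarrow> t < T \<Longrightarrow> ((\<lambda>y. F i j (y, t)) has_vector_derivative
        - 4 * (F i (j + 3) (x, t) - F (i + 3) j (x, t) - (F i 2 (x, t) * F 0 j (x, t) + F i 1 (x, t) * F 1 j (x, t) + F i 0 (x, t) * F 2 j (x, t)))) (at x)"
    and F_dt: "0 \<le> t \<Longrightarrow> t < T \<Longrightarrow> ((\<lambda>s. F i j (x, s)) has_vector_derivative
        - \<i> * of_real (sqrt 3) * (F i (j + 2) (x, t) - F (i + 2) j (x, t) - (F i 1 (x, t) * F 0 j (x, t) + F i 0 (x, t) * F 1 j (x, t)))) (at t within {0..<T})"
    and F_cont: "continuous_on (dom_T T) (F i j)"
    and F_cnj: "0 \<le> t \<Longrightarrow> t < T \<Longrightarrow> F i j (x, t) = (- 1) ^ (i + j) * cnj (F j i (x, t))"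
begin

primrec ev :: "fp \<Rightarrow> real \<times> real \<Rightarrow> complex" where
  "ev (V i j) z = F i j z"
| "ev (Add a b) z = ev a z + ev b z"
| "ev (Mul a b) z = ev a z * ev b z"
| "ev (Scale c a) z = c * ev a z"

lemma ev_cont: "continuous_on (dom_T T) (ev e)"
proof (induction e)
  case (V i j) then show ?case using F_cont[of i j] by (simp add: continuous_on_cong[OF refl, of _ "ev (V i j)" "F i j"])
next
  case (Add a b)
  then have "continuous_on (dom_T T) (\<lambda>z. ev a z + ev b z)" by (intro continuous_intros)
  then show ?case by (rule continuous_on_eq) simp
next
  case (Mul a b)
  then have "continuous_on (dom_T T) (\<lambda>z. ev a z * ev b z)" by (intro continuous_intros)
  then show ?case by (rule continuous_on_eq) simp
next
  case (Scale c a)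
  then have "continuous_on (dom_T T) (\<lambda>z. c * ev a z)" by (intro continuous_intros)
  then show ?case by (rule continuous_on_eq) simp
qed

lemma ev_dx: assumes "0 \<le> t" "t < T"
  shows "((\<lambda>y. ev e (y, t)) has_vector_derivative ev (D1 e) (x, t)) (at x)"
proof (induction e)
  case (V i j) then show ?case using F_dx[OF assms, of i j x] by (simp add: algebra_simps)
next
  case (Mul a b)
  then show ?case by (auto intro!: derivative_eq_intros)
qed (auto intro!: derivative_eq_intros has_vector_derivative_mult_right)

lemma ev_dt: assumes "0 \<le> t" "t < T"
  shows "((\<lambda>s. ev e (x, s)) has_vector_derivative ev (D2 e) (x, t)) (at t within {0..<T})"
proof (induction e)
  case (V i j) then show ?case using F_dt[OF assms, of i j x] by (simp add: algebra_simps)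
next
  case (Mul a b)
  then show ?case by (auto intro!: derivative_eq_intros)
qed (auto intro!: derivative_eq_intros has_vector_derivative_mult_right)

lemma Re_ev_dx: assumes "0 \<le> t" "t < T"
  shows "((\<lambda>y. Re (ev e (y, t))) has_vector_derivative Re (ev (D1 e) (x, t))) (at x)"
  using ev_dx[OF assms] by (simp add: has_vector_derivative_complex_iff has_real_derivative_iff_has_vector_derivative)

lemma Re_ev_dt: assumes "0 \<le> t" "t < T"
  shows "((\<lambda>s. Re (ev e (x, s))) has_vector_derivative Re (ev (D2 e) (x, t))) (at t within {0..<T})"
  using ev_dt[OF assms] by (simp add: has_vector_derivative_complex_iff has_real_derivative_iff_has_vector_derivative)

text \<open>Needed for uniqueness of derivatives within {0..<T}, in particular the one-sided ones at
  t = 0.\<close>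

lemma at_within_strip_nontrivial: "0 \<le> t \<Longrightarrow> t < T \<Longrightarrow> at t within {0..<T} \<noteq> bot"
proof -
  assume t: "0 \<le> t" "t < T"
  have "t islimpt {t<..<T}" using t by (intro islimpt_greaterThanLessThan1) auto
  then have "t islimpt {0..<T}" by (rule islimpt_subset) (use t in auto)
  then show ?thesis by (simp add: trivial_limit_within)
qed

lemma vector_derivative_strip: assumes "0 \<le> t" "t < T" "(f has_vector_derivative D) (at t within {0..<T})"
  shows "vector_derivative f (at t within {0..<T}) = D"
  using vector_derivative_within[OF at_within_strip_nontrivial[OF assms(1,2)] assms(3)] .

text \<open>Every word of partial derivatives is again evaluated by a differential polynomial, so
  smoothness of all orders reduces to the generators.\<close>

lemma pd_ev:
  assumes u: "\<And>x t. 0 \<le> t \<Longrightarrow> t < T \<Longrightarrow> u (x, t) = Re (ev e (x, t))"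
    and t: "0 \<le> t" "t < T"
  shows "pd T w u (x, t) = Re (ev (Dw w e) (x, t))"
  using t
proof (induction w arbitrary: x t)
  case Nil then show ?case using u by simp
next
  case (Cons b w)
  show ?case
  proof (cases b)
    case True
    have "((\<lambda>y. pd T w u (y, t)) has_vector_derivative Re (ev (D1 (Dw w e)) (x, t))) (at x)"
      using Re_ev_dx[OF Cons.prems] Cons by simp
    then show ?thesis using True by (simp add: px_def vector_derivative_at)
  next
    case False
    have "((\<lambda>s. pd T w u (x, s)) has_vector_derivative Re (ev (D2 (Dw w e)) (x, t))) (at t within {0..<T})"
      by (rule has_vector_derivative_transform[OF _ _ Re_ev_dt[OF Cons.prems]]) (use Cons in auto)
    then show ?thesis using False Cons.prems by (simp add: pt_def vector_derivative_strip)
  qed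
qed

lemma smooth_ev:
  assumes u: "\<And>x t. 0 \<le> t \<Longrightarrow> t < T \<Longrightarrow> u (x, t) = Re (ev e (x, t))"
  shows "smooth_on_strip T u"
  unfolding smooth_on_strip_def
proof (intro allI conjI impI)
  fix w
  have "continuous_on (dom_T T) (\<lambda>z. Re (ev (Dw w e) z))" by (intro continuous_intros ev_cont)
  then show "continuous_on (dom_T T) (pd T w u)"
    by (rule continuous_on_eq) (auto simp: dom_T_def pd_ev[of u e, OF u])
  fix x t assume t: "0 \<le> t \<and> t < T"
  have "(\<lambda>y. Re (ev (Dw w e) (y, t))) differentiable (at x)"
    using Re_ev_dx t by (intro differentiableI_vector) blast
  then show "(\<lambda>y. pd T w u (y, t)) differentiable (at x)" using pd_ev[of u e, OF u] t by simp
  have "((\<lambda>s. pd T w u (x, s)) has_vector_derivative Re (ev (D2 (Dw w e)) (x, t))) (at t within {0..<T})"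
    by (rule has_vector_derivative_transform[OF _ _ Re_ev_dt]) (use t in \<open>auto simp: pd_ev[of u e, OF u]\<close>)
  then show "(\<lambda>s. pd T w u (x, s)) differentiable (at t within {0..<T})"
    by (rule differentiableI_vector)
qed

text \<open>The two derivations commute on generators by ring arithmetic, hence everywhere; no
  interchange of limits is involved.\<close>

lemma D2_D1: "ev (D2 (D1 e)) z = ev (D1 (D2 e)) z"
  by (induction e) (simp_all add: algebra_simps)

text \<open>\<open>D1\<close> acts on expressions, not on functions. An equality of values that
  relies on the constraint has to be differentiated through uniqueness of the derivative.\<close>

lemma D1_cong:
  assumes "\<And>x. ev a (x, t) = ev b (x, t)" "0 \<le> t" "t < T"
  shows "ev (D1 a) (x, t) = ev (D1 b) (x, t)"
  using ev_dx[OF assms(2,3), of a x] ev_dx[OF assms(2,3), of b x]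
  by (simp add: assms(1) vector_derivative_unique_at)

lemma D2_cong:
  assumes "\<And>t. 0 \<le> t \<Longrightarrow> t < T \<Longrightarrow> ev a (x, t) = ev b (x, t)" and t: "0 \<le> t" "t < T"
  shows "ev (D2 a) (x, t) = ev (D2 b) (x, t)"
proof -
  have "((\<lambda>s. ev a (x, s)) has_vector_derivative ev (D2 b) (x, t)) (at t within {0..<T})"
    by (rule has_vector_derivative_transform[OF _ _ ev_dt[OF t]]) (use t assms(1) in auto)
  with vector_derivative_strip[OF t] ev_dt[OF t, of a x] show ?thesis by metis
qed

lemma constraint:
  assumes "0 \<le> t" "t < T"
  shows "F i (Suc j) (x, t) - F (Suc i) j (x, t) - F i 0 (x, t) * F 0 j (x, t)
   + 4 * (F i (j + 3) (x, t) - F (i + 3) j (x, t) - (F i 2 (x, t) * F 0 j (x, t) + F i 1 (x, t) * F 1 j (x, t) + F i 0 (x, t) * F 2 j (x, t))) = 0"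
  using vector_derivative_unique_at[OF F_dx[OF assms, of i j x] F_dx3[OF assms, of i j x]] by simp

lemma i_sqrt3: "\<i> * of_real (sqrt 3) * (\<i> * of_real (sqrt 3) * z) = - 3 * (z::complex)"
proof -
  have "\<i> * of_real (sqrt 3) * (\<i> * of_real (sqrt 3) * z) = (\<i> * \<i>) * of_real (sqrt 3 * sqrt 3) * z"
    by (simp only: of_real_mult mult_ac)
  then show ?thesis by simp
qed

text \<open>The KP equation is a polynomial identity; the constraint identifies its third flow with \<open>- \<partial>\<^sub>x / 4\<close>.\<close>

lemma potential_equation:
  assumes "0 \<le> t" "t < T"
  shows "ev (D2 (D2 (V 0 0))) (x, t) = ev (D1 (D1 (V 0 0))) (x, t)
    + 12 * (ev (D1 (V 0 0)) (x, t) * ev (D1 (D1 (V 0 0))) (x, t)) + ev (D1 (D1 (D1 (D1 (V 0 0))))) (x, t)"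
proof -
  define f where "f i j = F i j (x, t)" for i j
  have c: "f i (Suc j) - f (Suc i) j - f i 0 * f 0 j
   + 4 * (f i (j + 3) - f (i + 3) j - (f i 2 * f 0 j + f i 1 * f 1 j + f i 0 * f 2 j)) = 0" for i j
    using constraint[OF assms, of i j x] by (simp add: f_def)
  have f: "F i j (x, t) = f i j" for i j by (simp add: f_def)
  define s where "s = \<i> * of_real (sqrt 3)"
  have s: "s * (s * z) = - 3 * z" for z unfolding s_def by (rule i_sqrt3)
  have "ev (D1 (D1 (V 0 0))) (x, t)
    + 12 * (ev (D1 (V 0 0)) (x, t) * ev (D1 (D1 (V 0 0))) (x, t)) + ev (D1 (D1 (D1 (D1 (V 0 0))))) (x, t)
    - ev (D2 (D2 (V 0 0))) (x, t) = (f 0 (Suc 1) - f (Suc 0) 1 - f 0 0 * f 0 1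
   + 4 * (f 0 (1 + 3) - f (0 + 3) 1 - (f 0 2 * f 0 1 + f 0 1 * f 1 1 + f 0 0 * f 2 1)))
   - (f 1 (Suc 0) - f (Suc 1) 0 - f 1 0 * f 0 0
   + 4 * (f 1 (0 + 3) - f (1 + 3) 0 - (f 1 2 * f 0 0 + f 1 1 * f 1 0 + f 1 0 * f 2 0)))
   - 2 * f 0 0 * (f 0 (Suc 0) - f (Suc 0) 0 - f 0 0 * f 0 0
   + 4 * (f 0 (0 + 3) - f (0 + 3) 0 - (f 0 2 * f 0 0 + f 0 1 * f 1 0 + f 0 0 * f 2 0)))"
    by (simp add: f s_def[symmetric] eval_nat_numeral) (simp add: algebra_simps s)
  then show ?thesis unfolding c by (simp del: D1.simps D2.simps ev.simps)
qed

definition U :: fp where "U = Scale 6 (D1 (V 0 0))"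

text \<open>By the conjugation symmetry \<open>F 0 0\<close> is real and \<open>F 0 1\<close> is
  minus the conjugate of \<open>F 1 0\<close>, so \<open>F 0 1\<close> - \<open>F 1 0\<close> is
  real as well. Reality is what identifies the square of the real part with the product in the
  ring.\<close>

lemma Im_U: "0 \<le> t \<Longrightarrow> t < T \<Longrightarrow> Im (ev U (x, t)) = 0"
  using F_cnj[of t 0 0 x] F_cnj[of t 0 1 x] by (simp add: U_def complex_eq_iff)

lemma U_equation:
  assumes t: "0 \<le> t" "t < T"
  shows "ev (D2 (D2 U)) (x, t) = ev (D1 (D1 U)) (x, t) + ev (D1 (D1 (Mul U U))) (x, t) + ev (D1 (D1 (D1 (D1 U)))) (x, t)"
proof -
  let ?w = "V 0 0"
  let ?R = "Add (D1 (D1 ?w)) (Add (Scale 12 (Mul (D1 ?w) (D1 (D1 ?w)))) (D1 (D1 (D1 (D1 ?w)))))"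
  have "ev (D2 (D2 (D1 ?w))) (x, t) = ev (D2 (D1 (D2 ?w))) (x, t)"
    by (rule D2_cong[OF D2_D1 t])
  also have "\<dots> = ev (D1 (D2 (D2 ?w))) (x, t)" by (rule D2_D1)
  also have "\<dots> = ev (D1 ?R) (x, t)"
    by (rule D1_cong[OF _ t]) (use potential_equation[OF t] in \<open>simp del: D1.simps(1) D2.simps(1)\<close>)
  finally have "ev (D2 (D2 U)) (x, t) = 6 * ev (D1 ?R) (x, t)"
    by (simp add: U_def del: D1.simps(1) D2.simps(1))
  then show ?thesis by (simp add: U_def algebra_simps del: D1.simps(1))
qed

lemma boussinesq_U:
  assumes t: "0 \<le> t" "t < T"
  defines "u \<equiv> \<lambda>z. Re (ev U z)"
  shows "dxt T 0 2 u (x,t) = dxt T 2 0 u (x,t) + dxt T 2 0 (\<lambda>z. (u z)\<^sup>2) (x,t) + dxt T 4 0 u (x,t)"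
proof -
  have 1: "dxt T a b u (x, t) = Re (ev (Dw (replicate a True @ replicate b False) U) (x, t))" for a b
    unfolding dxt_def by (rule pd_ev[OF _ t]) (simp add: u_def)
  have 2: "dxt T a b (\<lambda>z. (u z)\<^sup>2) (x, t) = Re (ev (Dw (replicate a True @ replicate b False) (Mul U U)) (x, t))" for a b
    unfolding dxt_def by (rule pd_ev[OF _ t]) (use Im_U in \<open>simp add: u_def power2_eq_square\<close>)
  show ?thesis unfolding 1 2
    using U_equation[OF t, of x] by (simp add: eval_nat_numeral)
qed

end

context flow
begin

lemma ev_bounded:
  assumes F: "\<And>i j. i + j < w \<Longrightarrow> \<exists>M. \<forall>x t. 0 \<le> t \<and> t < T \<longrightarrow> cmod (F i j (x, t)) \<le> M"
    and e: "homog w e"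
  shows "\<exists>M. \<forall>x t. 0 \<le> t \<and> t < T \<longrightarrow> cmod (ev e (x, t)) \<le> M"
proof -
  \<comment> \<open>The factors of a product have smaller weight, hence the induction over all v
    \<le> w.\<close>
  have "homog v e \<Longrightarrow> v \<le> w \<Longrightarrow> ?thesis" for v
  proof (induction e arbitrary: v)
    case (V i j) then show ?case using F[of i j] by auto
  next
    case (Add a b)
    then obtain A B where AB: "\<And>x t. 0 \<le> t \<and> t < T \<Longrightarrow> cmod (ev a (x, t)) \<le> A" "\<And>x t. 0 \<le> t \<and> t < T \<Longrightarrow> cmod (ev b (x, t)) \<le> B"
      by (meson homog.simps(2))
    then have "cmod (ev (Add a b) (x, t)) \<le> A + B" if "0 \<le> t \<and> t < T" for x t
      using AB[OF that, of x] by (auto intro: norm_triangle_mono)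
    then show ?case by blast
  next
    case (Mul a b)
    then obtain u1 u2 where "homog u1 a" "homog u2 b" "u1 \<le> w" "u2 \<le> w" by auto
    note IH = Mul.IH(1)[OF this(1,3)] Mul.IH(2)[OF this(2,4)]
    obtain A B where AB: "\<And>x t. 0 \<le> t \<and> t < T \<Longrightarrow> cmod (ev a (x, t)) \<le> A" "\<And>x t. 0 \<le> t \<and> t < T \<Longrightarrow> cmod (ev b (x, t)) \<le> B"
      using IH by blast
    then have "cmod (ev (Mul a b) (x, t)) \<le> A * B" if "0 \<le> t \<and> t < T" for x t
      using AB[OF that, of x] by (auto simp: norm_mult intro!: mult_mono order_trans[OF norm_ge_zero])
    then show ?case by blast
  next
    case (Scale c a)
    then obtain A where A: "\<And>x t. 0 \<le> t \<and> t < T \<Longrightarrow> cmod (ev a (x, t)) \<le> A"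
      by (metis homog.simps(4))
    then have "cmod (ev (Scale c a) (x, t)) \<le> cmod c * A" if "0 \<le> t \<and> t < T" for x t
      using A[OF that, of x] by (auto simp: norm_mult intro!: mult_left_mono)
    then show ?case by blast
  qed
  then show ?thesis using e by blast
qed

lemma ev_extends:
  assumes F: "\<And>i j. i + j < w \<Longrightarrow> \<exists>g. continuous_on (UNIV \<times> {0..T}) g \<and> (\<forall>x t. 0 \<le> t \<and> t < T \<longrightarrow> g (x, t) = F i j (x, t))"
    and e: "homog w e"
  shows "\<exists>g. continuous_on (UNIV \<times> {0..T}) g \<and> (\<forall>x t. 0 \<le> t \<and> t < T \<longrightarrow> g (x, t) = ev e (x, t))"
proof -
  have "homog v e \<Longrightarrow> v \<le> w \<Longrightarrow> ?thesis" for v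
  proof (induction e arbitrary: v)
    case (V i j) then show ?case using F[of i j] by auto
  next
    case (Add a b)
    then have "homog v a" "homog v b" by auto
    note IH = Add.IH(1)[OF this(1) Add.prems(2)] Add.IH(2)[OF this(2) Add.prems(2)]
    obtain g h where "continuous_on (UNIV \<times> {0..T}) g \<and> (\<forall>x t. 0 \<le> t \<and> t < T \<longrightarrow> g (x, t) = ev a (x, t))"
      "continuous_on (UNIV \<times> {0..T}) h \<and> (\<forall>x t. 0 \<le> t \<and> t < T \<longrightarrow> h (x, t) = ev b (x, t))"
      using IH by blast
    then show ?case by (intro exI[of _ "\<lambda>z. g z + h z"]) (auto intro: continuous_on_add)
  next
    case (Mul a b)
    then obtain u1 u2 where "homog u1 a" "homog u2 b" "u1 \<le> w" "u2 \<le> w" by auto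
    note IH = Mul.IH(1)[OF this(1,3)] Mul.IH(2)[OF this(2,4)]
    obtain g h where "continuous_on (UNIV \<times> {0..T}) g \<and> (\<forall>x t. 0 \<le> t \<and> t < T \<longrightarrow> g (x, t) = ev a (x, t))"
      "continuous_on (UNIV \<times> {0..T}) h \<and> (\<forall>x t. 0 \<le> t \<and> t < T \<longrightarrow> h (x, t) = ev b (x, t))"
      using IH by blast
    then show ?case by (intro exI[of _ "\<lambda>z. g z * h z"]) (auto intro: continuous_on_mult)
  next
    case (Scale c a)
    then have "homog v a" by auto
    note IH = Scale.IH[OF this Scale.prems(2)]
    obtain g where "continuous_on (UNIV \<times> {0..T}) g \<and> (\<forall>x t. 0 \<le> t \<and> t < T \<longrightarrow> g (x, t) = ev a (x, t))"
      using IH by blast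
    then show ?case by (intro exI[of _ "\<lambda>z. c * g z"]) (auto intro: continuous_on_mult_left)
  qed
  then show ?thesis using e by blast
qed

lemma ev_decay:
  assumes F: "\<And>i j N. \<exists>M. \<forall>x t. 0 \<le> t \<and> t \<le> \<tau> \<longrightarrow> (1 + \<bar>x\<bar>) ^ N * cmod (F i j (x, t)) \<le> M"
  shows "\<exists>M. \<forall>x t. 0 \<le> t \<and> t \<le> \<tau> \<longrightarrow> (1 + \<bar>x\<bar>) ^ N * cmod (ev e (x, t)) \<le> M"
proof (induction e arbitrary: N)
  case (V i j) then show ?case using F[of N i j] by simp
next
  case (Add a b)
  obtain A B where AB: "\<And>x t. 0 \<le> t \<and> t \<le> \<tau> \<Longrightarrow> (1 + \<bar>x\<bar>) ^ N * cmod (ev a (x, t)) \<le> A"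
    "\<And>x t. 0 \<le> t \<and> t \<le> \<tau> \<Longrightarrow> (1 + \<bar>x\<bar>) ^ N * cmod (ev b (x, t)) \<le> B"
    using Add.IH by blast
  have "(1 + \<bar>x\<bar>) ^ N * cmod (ev (Add a b) (x, t)) \<le> A + B" if "0 \<le> t \<and> t \<le> \<tau>" for x t
  proof -
    have "(1 + \<bar>x\<bar>) ^ N * cmod (ev (Add a b) (x, t)) \<le> (1 + \<bar>x\<bar>) ^ N * (cmod (ev a (x, t)) + cmod (ev b (x, t)))"
      by (intro mult_left_mono) (auto intro: norm_triangle_ineq)
    then show ?thesis using AB[OF that, of x] by (simp add: distrib_left)
  qed
  then show ?case by blast
next
  case (Mul a b)
  obtain A B where AB: "\<And>x t. 0 \<le> t \<and> t \<le> \<tau> \<Longrightarrow> (1 + \<bar>x\<bar>) ^ N * cmod (ev a (x, t)) \<le> A"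
    "\<And>x t. 0 \<le> t \<and> t \<le> \<tau> \<Longrightarrow> (1 + \<bar>x\<bar>) ^ 0 * cmod (ev b (x, t)) \<le> B"
    using Mul.IH by blast
  have "(1 + \<bar>x\<bar>) ^ N * cmod (ev (Mul a b) (x, t)) \<le> A * B" if "0 \<le> t \<and> t \<le> \<tau>" for x t
  proof -
    have "0 \<le> (1 + \<bar>x\<bar>) ^ N * cmod (ev a (x, t))" by simp
    then have "0 \<le> A" using AB(1)[OF that, of x] by (rule order_trans)
    then have "((1 + \<bar>x\<bar>) ^ N * cmod (ev a (x, t))) * cmod (ev b (x, t)) \<le> A * B"
      using AB[OF that, of x] by (intro mult_mono) auto
    then show ?thesis by (simp add: norm_mult mult.assoc)
  qed
  then show ?case by blast
next
  case (Scale c a)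
  obtain A where A: "\<And>x t. 0 \<le> t \<and> t \<le> \<tau> \<Longrightarrow> (1 + \<bar>x\<bar>) ^ N * cmod (ev a (x, t)) \<le> A"
    using Scale.IH by blast
  have "(1 + \<bar>x\<bar>) ^ N * cmod (ev (Scale c a) (x, t)) \<le> cmod c * A" if "0 \<le> t \<and> t \<le> \<tau>" for x t
    using mult_left_mono[OF A[OF that, of x], of "cmod c"] by (simp add: norm_mult mult_ac)
  then show ?case by blast
qed

lemma schwartz_U:
  assumes F: "\<And>\<tau> i j N. 0 \<le> \<tau> \<Longrightarrow> \<tau> < T \<Longrightarrow> \<exists>M. \<forall>x t. 0 \<le> t \<and> t \<le> \<tau> \<longrightarrow> (1 + \<bar>x\<bar>) ^ N * cmod (F i j (x, t)) \<le> M"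
  shows "schwartz_boussinesq T (\<lambda>z. Re (ev U z))"
  unfolding schwartz_boussinesq_def
proof (intro conjI allI impI)
  show "smooth_on_strip T (\<lambda>z. Re (ev U z))" by (rule smooth_ev) simp
next
  fix x t assume "0 \<le> t \<and> t < T"
  then show "dxt T 0 2 (\<lambda>z. Re (ev U z)) (x, t) = dxt T 2 0 (\<lambda>z. Re (ev U z)) (x, t)
    + dxt T 2 0 (\<lambda>z. (Re (ev U z))\<^sup>2) (x, t) + dxt T 4 0 (\<lambda>z. Re (ev U z)) (x, t)"
    using boussinesq_U by simp
next
  fix N :: nat and \<tau> :: real assume \<tau>: "0 \<le> \<tau> \<and> \<tau> < T"
  define E where "E i = Dw (replicate i True @ replicate 0 False) U" for i
  have "\<forall>i. \<exists>M. \<forall>x t. 0 \<le> t \<and> t \<le> \<tau> \<longrightarrow> (1 + \<bar>x\<bar>) ^ N * cmod (ev (E i) (x, t)) \<le> M"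
    using ev_decay[OF F] \<tau> by blast
  then obtain M where M: "\<And>i x t. 0 \<le> t \<and> t \<le> \<tau> \<Longrightarrow> (1 + \<bar>x\<bar>) ^ N * cmod (ev (E i) (x, t)) \<le> M i" by metis
  have "(\<Sum>i\<le>N. (1 + \<bar>x\<bar>) ^ N * \<bar>dxt T i 0 (\<lambda>z. Re (ev U z)) (x, t)\<bar>) \<le> (\<Sum>i\<le>N. M i)" if t: "0 \<le> t \<and> t \<le> \<tau>" for x t
  proof (rule sum_mono)
    fix i
    have "dxt T i 0 (\<lambda>z. Re (ev U z)) (x, t) = Re (ev (E i) (x, t))"
      unfolding dxt_def E_def by (rule pd_ev) (use t \<tau> in auto)
    then have "(1 + \<bar>x\<bar>) ^ N * \<bar>dxt T i 0 (\<lambda>z. Re (ev U z)) (x, t)\<bar> \<le> (1 + \<bar>x\<bar>) ^ N * cmod (ev (E i) (x, t))"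
      by (auto intro!: mult_left_mono abs_Re_le_cmod)
    then show "(1 + \<bar>x\<bar>) ^ N * \<bar>dxt T i 0 (\<lambda>z. Re (ev U z)) (x, t)\<bar> \<le> M i" using M[OF t] by (rule order_trans)
  qed
  then show "\<exists>M. \<forall>x t. 0 \<le> t \<and> t \<le> \<tau> \<longrightarrow> (\<Sum>i\<le>N. (1 + \<bar>x\<bar>) ^ N * \<bar>dxt T i 0 (\<lambda>z. Re (ev U z)) (x, t)\<bar>) \<le> M"
    by blast
qed

lemma dxt_U:
  assumes "0 \<le> t" "t < T"
  shows "dxt T q1 q2 (\<lambda>z. Re (ev U z)) (x, t) = Re (ev (Dw (replicate q1 True @ replicate q2 False) U) (x, t))"
  unfolding dxt_def by (rule pd_ev) (use assms in auto)

lemma homog_dxt_U: "homog (2 + q1 + 2 * q2) (Dw (replicate q1 True @ replicate q2 False) U)"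
proof -
  have "homog 2 U" unfolding U_def using homog_D1[of 1 "V 0 0"] by (simp add: numeral_2_eq_2)
  from homog_Dw[OF this, of "replicate q1 True @ replicate q2 False"] show ?thesis by (simp add: filter_replicate)
qed

lemma lin_dxt_U: "lin (Dw (replicate q1 True @ replicate q2 False) U) k = 6 * (\<i> * of_real k) ^ Suc q1 * of_real (la k) ^ q2"
  by (simp add: lin_Dw U_def lin_D1 filter_replicate del: D1.simps)

text \<open>The linear part as a function of space and time, with a free choice \<open>L i j\<close>
  of the leading part of each generator.\<close>

primrec lv :: "(nat \<Rightarrow> nat \<Rightarrow> real \<times> real \<Rightarrow> complex) \<Rightarrow> fp \<Rightarrow> real \<times> real \<Rightarrow> complex" where
  "lv L (V i j) z = L i j z"
| "lv L (Add a b) z = lv L a z + lv L b z"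
| "lv L (Mul a b) z = 0"
| "lv L (Scale c a) z = c * lv L a z"

text \<open>At the top weight w a product consists of factors of weight below w, all bounded. Only
  isolated generators of weight w can be unbounded, and for these the leading part is
  subtracted.\<close>

lemma ev_minus_lv_bounded:
  assumes F: "\<And>i j. i + j + 1 < w \<Longrightarrow> \<exists>M. \<forall>x t. 0 \<le> t \<and> t < T \<longrightarrow> cmod (F i j (x, t)) \<le> M"
    and L: "\<And>i j. i + j + 1 = w \<Longrightarrow> \<exists>M. \<forall>x t. 0 \<le> t \<and> t < T \<longrightarrow> cmod (F i j (x, t) - L i j (x, t)) \<le> M"
    and e: "homog w e"
  shows "\<exists>M. \<forall>x t. 0 \<le> t \<and> t < T \<longrightarrow> cmod (ev e (x, t) - lv L e (x, t)) \<le> M"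
  using e
proof (induction e)
  case (V i j) then show ?case using L[of i j] by auto
next
  case (Add a b)
  then obtain A B where AB: "\<And>x t. 0 \<le> t \<and> t < T \<Longrightarrow> cmod (ev a (x, t) - lv L a (x, t)) \<le> A" "\<And>x t. 0 \<le> t \<and> t < T \<Longrightarrow> cmod (ev b (x, t) - lv L b (x, t)) \<le> B"
    by (meson homog.simps(2))
  then have "cmod (ev (Add a b) (x, t) - lv L (Add a b) (x, t)) \<le> A + B" if "0 \<le> t \<and> t < T" for x t
    using AB[OF that, of x] norm_triangle_mono[OF AB(1)[OF that, of x] AB(2)[OF that, of x]] by (simp add: algebra_simps)
  then show ?case by blast
next
  case (Mul a b)
  then obtain u v where uv: "u + v = w" "homog u a" "homog v b" by auto
  then have pos: "u > 0" "v > 0" by (auto dest: homog_pos)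
  have "\<exists>M. \<forall>x t. 0 \<le> t \<and> t < T \<longrightarrow> cmod (ev a (x, t)) \<le> M"
    by (rule ev_bounded[OF F uv(2)]) (use uv(1) pos in simp)
  moreover have "\<exists>M. \<forall>x t. 0 \<le> t \<and> t < T \<longrightarrow> cmod (ev b (x, t)) \<le> M"
    by (rule ev_bounded[OF F uv(3)]) (use uv(1) pos in simp)
  ultimately obtain A B where AB: "\<And>x t. 0 \<le> t \<and> t < T \<Longrightarrow> cmod (ev a (x, t)) \<le> A" "\<And>x t. 0 \<le> t \<and> t < T \<Longrightarrow> cmod (ev b (x, t)) \<le> B"
    by blast
  have "cmod (ev (Mul a b) (x, t) - lv L (Mul a b) (x, t)) \<le> A * B" if "0 \<le> t \<and> t < T" for x t
    using AB[OF that, of x] by (auto simp: norm_mult intro!: mult_mono order_trans[OF norm_ge_zero])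
  then show ?case by blast
next
  case (Scale c a)
  then obtain A where A: "\<And>x t. 0 \<le> t \<and> t < T \<Longrightarrow> cmod (ev a (x, t) - lv L a (x, t)) \<le> A"
    by (metis homog.simps(4))
  have "cmod (ev (Scale c a) (x, t) - lv L (Scale c a) (x, t)) \<le> cmod c * A" if "0 \<le> t \<and> t < T" for x t
    using mult_left_mono[OF A[OF that, of x], of "cmod c"] by (simp add: norm_mult flip: right_diff_distrib)
  then show ?case by blast
qed

end

section \<open>The singular solution\<close>

lemma one_plus_abs_power_le: "(1 + \<bar>y\<bar>) ^ N \<le> 2 ^ N * (1 + \<bar>y::real\<bar> ^ N)"
proof -
  have "(1 + \<bar>y\<bar>) ^ N \<le> (2 * max 1 \<bar>y\<bar>) ^ N" by (intro power_mono) auto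
  also have "\<dots> = 2 ^ N * (max 1 \<bar>y\<bar>) ^ N" by (rule power_mult_distrib)
  also have "(max 1 \<bar>y\<bar>) ^ N \<le> 1 + \<bar>y\<bar> ^ N" by (simp add: max_def)
  finally show ?thesis by simp
qed

lemma lborel_integrable_reflect:
  fixes f :: "real \<Rightarrow> 'a::{banach, second_countable_topology}"
  shows "integrable lborel f \<Longrightarrow> integrable lborel (\<lambda>k. f (- k))"
  using lborel_integrable_real_affine[of f "-1" 0] by simp

lemma lborel_integral_reflect:
  fixes f :: "real \<Rightarrow> 'a::{banach, second_countable_topology}"
  shows "(\<integral>k. f (- k) \<partial>lborel) = (\<integral>k. f k \<partial>lborel)"
  using lborel_integral_real_affine[of "-1" f 0] by simp

locale profile = amplitude rs as \<delta> q for rs as \<delta> q +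
  fixes T x0 :: real and \<sigma> :: nat
  assumes T_pos: "T > 0"
begin

lemma rho_integrable: "integrable lborel (\<lambda>k. \<bar>k\<bar> ^ (q + 1 + a) * \<bar>rho bcoef a k\<bar>)"
proof -
  obtain C where C: "C > 0" "\<And>k. k \<ge> 2 \<Longrightarrow> \<bar>rho bcoef a k\<bar> * k ^ (q + 1 + a) \<le> C * k powr (\<delta> - 3/2)"
    using rho_moment by blast
  show ?thesis
  proof (rule Bochner_Integration.integrable_bound)
    show "integrable lborel (\<lambda>k. C * (indicator {2..} k * k powr (\<delta> - 3/2)))"
      using integrable_tail by (rule integrable_mult_right)
    show "AE k in lborel. norm (\<bar>k\<bar> ^ (q + 1 + a) * \<bar>rho bcoef a k\<bar>) \<le> norm (C * (indicator {2..} k * k powr (\<delta> - 3/2)))"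
    proof (rule AE_I2)
      fix k :: real
      show "norm (\<bar>k\<bar> ^ (q + 1 + a) * \<bar>rho bcoef a k\<bar>) \<le> norm (C * (indicator {2..} k * k powr (\<delta> - 3/2)))"
      proof (cases "k \<ge> 2")
        case True then show ?thesis using C(1) C(2)[OF True] by (simp add: abs_mult mult_ac)
      next
        case False then show ?thesis using rho_supp[of k bcoef a] by simp
      qed
    qed
  qed measurable
qed

lemma rho_0_integrable: "integrable lborel (rho bcoef 0)"
proof (rule Bochner_Integration.integrable_bound[OF rho_integrable[of 0]])
  show "AE k in lborel. norm (rho bcoef 0 k) \<le> norm (\<bar>k\<bar> ^ (q + 1 + 0) * \<bar>rho bcoef 0 k\<bar>)"
  proof (rule AE_I2)
    fix k :: real
    show "norm (rho bcoef 0 k) \<le> norm (\<bar>k\<bar> ^ (q + 1 + 0) * \<bar>rho bcoef 0 k\<bar>)"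
    proof (cases "k \<ge> 2")
      case True
      then have "1 * \<bar>rho bcoef 0 k\<bar> \<le> \<bar>k\<bar> ^ (q + 1 + 0) * \<bar>rho bcoef 0 k\<bar>" by (intro mult_right_mono one_le_power) auto
      then show ?thesis by (simp add: abs_mult)
    next
      case False then show ?thesis using rho_supp[of k bcoef 0] by simp
    qed
  qed
qed measurable

definition rint :: real where "rint = (\<integral>k. rho bcoef 0 k \<partial>lborel)"

lemma rint_nonneg: "rint \<ge> 0"
  unfolding rint_def by (intro Bochner_Integration.integral_nonneg rho_nonneg bcoef_nonneg)

text \<open>The density and its mirror image together have mass at most 2 * eps * rint, which this
  choice keeps below 1/2.\<close>

definition eps :: real where "eps = 1 / (4 * (1 + rint))"

lemma eps_pos: "eps > 0" using rint_nonneg by (simp add: eps_def)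

text \<open>The phase makes cst * \<i> ^ Suc q1 real for every admissible \<open>q1\<close>. One
  choice works for all pairs, since q1 + 2 * q2 = q + 1 fixes the parity of
  \<open>q1\<close>.\<close>

definition cst :: complex where
  "cst = of_real ((- 1) ^ \<sigma> * eps) * (if odd q then - \<i> else 1)"

lemma norm_cst: "cmod cst = eps"
  using eps_pos by (simp add: cst_def norm_mult norm_power)

text \<open>The mirrored, conjugated copy on the negative axis yields the symmetry
  \<open>mu_cnj\<close>, on which the reality of the solution rests. The factor (- 1) ^ a is the
  chain rule for the reflection.\<close>

definition mu :: "nat \<Rightarrow> real \<Rightarrow> complex" where
  "mu a k = cst * of_real (rho bcoef a k) + cnj cst * of_real ((- 1) ^ a * rho bcoef a (- k))"

lemma norm_mu_le: "cmod (mu a k) \<le> eps * (\<bar>rho bcoef a k\<bar> + \<bar>rho bcoef a (- k)\<bar>)"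
  unfolding mu_def by (rule order_trans[OF norm_triangle_ineq]) (simp add: norm_mult norm_cst abs_mult distrib_left norm_power)

lemma mu_cnj: "mu 0 (- k) = cnj (mu 0 k)"
  by (simp add: mu_def)

sublocale density mu T
proof
  fix a k
  have "((\<lambda>k. (- 1) ^ a * rho bcoef a (- k)) has_real_derivative (- 1) ^ a * (rho bcoef (Suc a) (- k) * (- 1))) (at k)"
    by (intro DERIV_cmult DERIV_chain2[OF rho_deriv]) (auto intro!: derivative_eq_intros)
  from has_vector_derivative_add[OF has_vector_derivative_mult_right[OF has_vector_derivative_complex_of_real[OF rho_deriv, of bcoef a k]]
      has_vector_derivative_mult_right[OF has_vector_derivative_complex_of_real[OF this]]]
  show "(mu a has_vector_derivative mu (Suc a) k) (at k)"
    unfolding mu_def[abs_def] by (rule has_vector_derivative_eq_rhs) simp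
next
  fix a
  obtain C where C: "\<And>k. \<bar>rho bcoef a k\<bar> \<le> C" using rho_bounded by blast
  have "cmod (mu a k) \<le> eps * (C + C)" for k
    using eps_pos by (intro order_trans[OF norm_mu_le] mult_left_mono add_mono C) auto
  then show "\<exists>C. \<forall>k. cmod (mu a k) \<le> C" by blast
next
  fix k :: real and a assume "\<bar>k\<bar> < 2"
  then show "mu a k = 0" using rho_supp[of k bcoef a] rho_supp[of "- k" bcoef a] by (simp add: mu_def)
qed

lemma mu_integrable: "integrable lborel (\<lambda>k. \<bar>k\<bar> ^ (q + 1 + a) * cmod (mu a k))"
proof (rule Bochner_Integration.integrable_bound)
  let ?f = "\<lambda>k. \<bar>k\<bar> ^ (q + 1 + a) * \<bar>rho bcoef a k\<bar>"
  show "integrable lborel (\<lambda>k. eps * (?f k + ?f (- k)))"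
    using rho_integrable[of a] lborel_integrable_reflect[OF rho_integrable[of a]] by (intro integrable_mult_right Bochner_Integration.integrable_add)
  show "AE k in lborel. norm (\<bar>k\<bar> ^ (q + 1 + a) * cmod (mu a k)) \<le> norm (eps * (?f k + ?f (- k)))"
  proof (rule AE_I2)
    fix k :: real
    have "\<bar>k\<bar> ^ (q + 1 + a) * cmod (mu a k) \<le> \<bar>k\<bar> ^ (q + 1 + a) * (eps * (\<bar>rho bcoef a k\<bar> + \<bar>rho bcoef a (- k)\<bar>))"
      by (intro mult_left_mono norm_mu_le) auto
    also have "\<dots> = eps * (?f k + ?f (- k))" by (simp add: algebra_simps)
    finally show "norm (\<bar>k\<bar> ^ (q + 1 + a) * cmod (mu a k)) \<le> norm (eps * (?f k + ?f (- k)))"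
      using eps_pos by (simp add: abs_mult)
  qed
qed measurable

lemma mu_0_integrable: "integrable lborel (\<lambda>k. cmod (mu 0 k))"
  and mu_0_small: "(\<integral>k. cmod (mu 0 k) \<partial>lborel) \<le> 1/2"
proof -
  have r: "integrable lborel (\<lambda>k. eps * (rho bcoef 0 k + rho bcoef 0 (- k)))"
    using rho_0_integrable lborel_integrable_reflect[OF rho_0_integrable] by auto
  have le: "cmod (mu 0 k) \<le> eps * (rho bcoef 0 k + rho bcoef 0 (- k))" for k
    using norm_mu_le[of 0 k] rho_nonneg[of bcoef] bcoef_nonneg by simp
  show i: "integrable lborel (\<lambda>k. cmod (mu 0 k))"
    by (rule Bochner_Integration.integrable_bound[OF r])
       (measurable, simp only: real_norm_def abs_norm_cancel, intro AE_I2 order_trans[OF le abs_ge_self])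
  have "(\<integral>k. cmod (mu 0 k) \<partial>lborel) \<le> (\<integral>k. eps * (rho bcoef 0 k + rho bcoef 0 (- k)) \<partial>lborel)"
    by (intro Bochner_Integration.integral_mono i r le)
  also have "\<dots> = eps * (rint + rint)"
    using rho_0_integrable lborel_integrable_reflect[OF rho_0_integrable]
    by (simp add: lborel_integral_reflect rint_def)
  also have "\<dots> \<le> 1/2" using rint_nonneg by (simp add: eps_def field_simps)
  finally show "(\<integral>k. cmod (mu 0 k) \<partial>lborel) \<le> 1/2" .
qed

text \<open>The majorant valid up to and including t = T; it has moments up to q + 1.\<close>

sublocale W0: weight "\<lambda>k. cmod (mu 0 k)" "q + 1"
  using mu_integrable[of 0] mu_0_small by unfold_locales (auto simp: mu_supp)

lemma la_nonneg: "\<bar>k\<bar> \<ge> 2 \<Longrightarrow> la k \<ge> 0"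
  by (rule order_trans[OF _ la_lower]) auto

text \<open>Staying \<eta> away from T inserts exp (- la k * \<eta>). This beats every power of k,
  so d is arbitrary, and it does not increase the mass.\<close>

lemma weight_eta:
  assumes \<eta>: "\<eta> > 0"
  shows "weight (\<lambda>k. cmod (mu 0 k) * exp (- la k * \<eta>)) d"
proof
  show "(\<lambda>k. cmod (mu 0 k) * exp (- la k * \<eta>)) \<in> borel_measurable borel" by measurable
  show "0 \<le> cmod (mu 0 k) * exp (- la k * \<eta>)" for k by simp
  show "\<bar>k\<bar> < 2 \<Longrightarrow> cmod (mu 0 k) * exp (- la k * \<eta>) = 0" for k by (simp add: mu_supp)
  obtain C where C: "C \<ge> 0" "\<And>k \<tau>. \<bar>k\<bar> \<ge> 2 \<Longrightarrow> \<eta> \<le> \<tau> \<Longrightarrow> \<bar>k\<bar> ^ d * exp (- la k * \<tau>) \<le> C"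
    using pow_exp_la_bounded[OF \<eta>, of d] by blast
  have le: "\<bar>k\<bar> ^ d * (cmod (mu 0 k) * exp (- la k * \<eta>)) \<le> C * cmod (mu 0 k)" for k
  proof (cases "\<bar>k\<bar> \<ge> 2")
    case True
    have "cmod (mu 0 k) * (\<bar>k\<bar> ^ d * exp (- la k * \<eta>)) \<le> cmod (mu 0 k) * C"
      by (intro mult_left_mono C(2) True) auto
    then show ?thesis by (simp add: mult_ac)
  next
    case False then show ?thesis by (simp add: mu_supp)
  qed
  show "integrable lborel (\<lambda>k. \<bar>k\<bar> ^ d * (cmod (mu 0 k) * exp (- la k * \<eta>)))"
  proof (rule Bochner_Integration.integrable_bound)
    show "integrable lborel (\<lambda>k. C * cmod (mu 0 k))" using mu_0_integrable by auto
    show "AE k in lborel. norm (\<bar>k\<bar> ^ d * (cmod (mu 0 k) * exp (- la k * \<eta>))) \<le> norm (C * cmod (mu 0 k))"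
      using le C(1) by (intro AE_I2) (simp add: abs_mult)
  qed measurable
  have le1: "cmod (mu 0 k) * exp (- la k * \<eta>) \<le> cmod (mu 0 k)" for k
  proof (cases "\<bar>k\<bar> \<ge> 2")
    case True
    then have "exp (- la k * \<eta>) \<le> 1" using la_nonneg[OF True] \<eta> by simp
    then have "cmod (mu 0 k) * exp (- la k * \<eta>) \<le> cmod (mu 0 k) * 1" by (intro mult_left_mono) auto
    then show ?thesis by simp
  next
    case False then show ?thesis by (simp add: mu_supp)
  qed
  have "(\<integral>k. cmod (mu 0 k) * exp (- la k * \<eta>) \<partial>lborel) \<le> (\<integral>k. cmod (mu 0 k) \<partial>lborel)"
  proof (rule Bochner_Integration.integral_mono[OF _ mu_0_integrable le1])
    show "integrable lborel (\<lambda>k. cmod (mu 0 k) * exp (- la k * \<eta>))"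
      by (rule Bochner_Integration.integrable_bound[OF mu_0_integrable]) (use le1 in \<open>auto simp: abs_mult\<close>)
  qed
  then show "(\<integral>k. cmod (mu 0 k) * exp (- la k * \<eta>) \<partial>lborel) \<le> 1/2" using mu_0_small by linarith
qed

text \<open>The shift by \<open>x0\<close> aligns the phases of all modes there, so nothing cancels
  between frequencies at that point.\<close>

definition W :: "real \<times> real \<Rightarrow> real \<Rightarrow> complex" where
  "W z k = mu 0 k * wave (fst z - x0) (T - snd z) k"

lemma W_measurable [measurable]: "W z \<in> borel_measurable borel"
  unfolding W_def[abs_def] by measurable

lemma W_adm_0: "snd z \<le> T \<Longrightarrow> W0.adm (W z)"
  unfolding W0.adm_def
proof (intro conjI allI W_measurable)
  fix k assume z: "snd z \<le> T"
  show "cmod (W z k) \<le> cmod (mu 0 k)"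
  proof (cases "\<bar>k\<bar> \<ge> 2")
    case True
    then have "exp (- la k * (T - snd z)) \<le> 1" using la_nonneg[OF True] z by simp
    then have "cmod (mu 0 k) * exp (- la k * (T - snd z)) \<le> cmod (mu 0 k) * 1" by (intro mult_left_mono) auto
    then show ?thesis by (simp add: W_def norm_mult norm_wave)
  next
    case False then show ?thesis by (simp add: mu_supp W_def)
  qed
qed

lemma W_adm:
  assumes \<eta>: "\<eta> > 0" and z: "snd z \<le> T - \<eta>"
  shows "weight.adm (\<lambda>k. cmod (mu 0 k) * exp (- la k * \<eta>)) (W z)"
proof -
  \<comment> \<open>The moment count is irrelevant for \<open>adm\<close>, which depends on the
    majorant only; 0 is an arbitrary choice.\<close>
  interpret weight "\<lambda>k. cmod (mu 0 k) * exp (- la k * \<eta>)" 0 by (rule weight_eta[OF \<eta>])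
  show ?thesis
    unfolding adm_def
  proof (intro conjI allI W_measurable)
    fix k
    show "cmod (W z k) \<le> cmod (mu 0 k) * exp (- la k * \<eta>)"
    proof (cases "\<bar>k\<bar> \<ge> 2")
      case True
      then have "la k * \<eta> \<le> la k * (T - snd z)" using la_nonneg[OF True] z by (intro mult_left_mono) auto
      then show ?thesis by (auto simp: W_def norm_mult norm_wave intro!: mult_left_mono)
    next
      case False then show ?thesis by (simp add: mu_supp W_def)
    qed
  qed
qed

lemma W_cnj: "W z (- k) = cnj (W z k)"
  by (simp add: W_def mu_cnj wave_def exp_cnj)

lemma W_dx: "((\<lambda>x. W (x, t) k) has_vector_derivative (\<i> * of_real k) * W (x, t) k) (at x within X)"
proof -
  have "((\<lambda>x. \<i> * of_real (k * (x - x0)) - of_real (la k * (T - t))) has_vector_derivative \<i> * of_real (k * (1 - 0)) - 0) (at x within X)"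
    by (intro has_vector_derivative_diff has_vector_derivative_mult_right has_vector_derivative_complex_of_real has_vector_derivative_const DERIV_cmult derivative_intros)
  then have "((\<lambda>x. \<i> * of_real (k * (x - x0)) - of_real (la k * (T - t))) has_vector_derivative \<i> * of_real k) (at x within X)" by simp
  from field_vector_diff_chain_within[OF this has_field_derivative_at_within[OF DERIV_exp]]
  have "((\<lambda>x. wave (x - x0) (T - t) k) has_vector_derivative \<i> * of_real k * wave (x - x0) (T - t) k) (at x within X)"
    by (simp add: wave_def o_def)
  from has_vector_derivative_mult_right[OF this, of "mu 0 k"] show ?thesis
    by (simp add: W_def mult_ac)
qed

lemma W_dt: "((\<lambda>t. W (x, t) k) has_vector_derivative of_real (la k) * W (x, t) k) (at t within X)"
proof -
  have "((\<lambda>t. \<i> * of_real (k * (x - x0)) - of_real (la k * (T - t))) has_vector_derivative 0 - of_real (la k * (0 - 1))) (at t within X)"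
    by (intro has_vector_derivative_diff has_vector_derivative_const has_vector_derivative_complex_of_real DERIV_cmult derivative_intros)
  then have "((\<lambda>t. \<i> * of_real (k * (x - x0)) - of_real (la k * (T - t))) has_vector_derivative of_real (la k)) (at t within X)" by simp
  from field_vector_diff_chain_within[OF this has_field_derivative_at_within[OF DERIV_exp]]
  have "((\<lambda>t. wave (x - x0) (T - t) k) has_vector_derivative of_real (la k) * wave (x - x0) (T - t) k) (at t within X)"
    by (simp add: wave_def o_def)
  from has_vector_derivative_mult_right[OF this, of "mu 0 k"] show ?thesis
    by (simp add: W_def mult_ac)
qed

lemma W_cont: "continuous_on X (\<lambda>z. W z k)"
  unfolding W_def wave_def by (intro continuous_intros)

definition F :: "nat \<Rightarrow> nat \<Rightarrow> real \<times> real \<Rightarrow> complex" where "F i j z = cauchy_sum (W z) i j"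

lemma F_cont_near:
  assumes "\<eta> > 0"
  shows "continuous_on {z. snd z \<le> T - \<eta>} (F i j)"
proof -
  interpret weight "\<lambda>k. cmod (mu 0 k) * exp (- la k * \<eta>)" "i + j" by (rule weight_eta[OF assms])
  show ?thesis unfolding F_def[abs_def]
  proof (rule cauchy_sum_continuous)
    show "adm (W z)" if "z \<in> {z. snd z \<le> T - \<eta>}" for z by (rule W_adm[OF assms]) (use that in simp)
  qed (auto intro: W_cont)
qed

sublocale flow F T
proof
  show "T > 0" by (rule T_pos)
next
  fix t x i j assume t: "0 \<le> t" "t < T"
  define \<eta> where "\<eta> = T - t"
  have \<eta>: "\<eta> > 0" using t by (simp add: \<eta>_def)
  have 1: "((\<lambda>x. W (x, t) k) has_vector_derivative 1 * (pp k ^ 1 - qq k ^ 1) * W (x, t) k) (at x within UNIV)" for x k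
    using W_dx[of t k x UNIV] by (simp add: pp_minus_qq)
  have 3: "((\<lambda>x. W (x, t) k) has_vector_derivative - 4 * (pp k ^ 3 - qq k ^ 3) * W (x, t) k) (at x within UNIV)" for x k
  proof (cases "\<bar>k\<bar> \<ge> 1")
    case True then show ?thesis using W_dx[of t k x UNIV] pp_qq_cube[OF True] by (simp add: pp_minus_qq)
  next
    case False
    then have "W (x, t) k = 0" for x by (simp add: W_def mu_supp)
    then show ?thesis by simp
  qed
  interpret w: weight "\<lambda>k. cmod (mu 0 k) * exp (- la k * \<eta>)" "i + j + 3" by (rule weight_eta[OF \<eta>])
  have a: "w.adm (W (x, t))" for x by (rule W_adm[OF \<eta>]) (simp add: \<eta>_def)
  show "((\<lambda>y. F i j (y, t)) has_vector_derivative
        F i (Suc j) (x, t) - F (Suc i) j (x, t) - F i 0 (x, t) * F 0 j (x, t)) (at x)"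
    unfolding F_def
    by (rule has_vector_derivative_eq_rhs, rule w.cauchy_sum_derivative[OF convex_UNIV a 1]) auto
  show "((\<lambda>y. F i j (y, t)) has_vector_derivative
        - 4 * (F i (j + 3) (x, t) - F (i + 3) j (x, t) - (F i 2 (x, t) * F 0 j (x, t) + F i 1 (x, t) * F 1 j (x, t) + F i 0 (x, t) * F 2 j (x, t)))) (at x)"
    unfolding F_def
    by (rule has_vector_derivative_eq_rhs, rule w.cauchy_sum_derivative[OF convex_UNIV a 3])
       (auto simp: eval_nat_numeral)
next
  fix t x i j assume t: "0 \<le> t" "t < T"
  \<comment> \<open>Half of the remaining time is kept, so that t lies strictly below T - \<eta> and
    the derivative within {0..T - \<eta>} is the derivative within {0..<T}.\<close>
  define \<eta> where "\<eta> = (T - t) / 2"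
  have \<eta>: "\<eta> > 0" "t < T - \<eta>" using t by (auto simp: \<eta>_def field_simps)
  have 1: "((\<lambda>s. W (x, s) k) has_vector_derivative (- \<i> * of_real (sqrt 3)) * (pp k ^ 2 - qq k ^ 2) * W (x, s) k) (at s within {0..T - \<eta>})" for s k
    unfolding pp_qq_sq by (rule W_dt)
  interpret w: weight "\<lambda>k. cmod (mu 0 k) * exp (- la k * \<eta>)" "i + j + 2" by (rule weight_eta[OF \<eta>(1)])
  have a: "w.adm (W (x, s))" if "s \<in> {0..T - \<eta>}" for s by (rule W_adm[OF \<eta>(1)]) (use that in simp)
  have "((\<lambda>s. F i j (x, s)) has_vector_derivative
        - \<i> * of_real (sqrt 3) * (F i (j + 2) (x, t) - F (i + 2) j (x, t) - (F i 1 (x, t) * F 0 j (x, t) + F i 0 (x, t) * F 1 j (x, t)))) (at t within {0..T - \<eta>})"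
    unfolding F_def
    by (rule has_vector_derivative_eq_rhs, rule w.cauchy_sum_derivative[OF convex_real_interval(5) a 1])
       (use t \<eta> in \<open>auto simp: eval_nat_numeral\<close>)
  moreover have "at t within {0..T - \<eta>} = at t within {0..<T}"
    by (rule at_within_nhd[where S="{..<T - \<eta>}"]) (use \<eta> in auto)
  ultimately show "((\<lambda>s. F i j (x, s)) has_vector_derivative
        - \<i> * of_real (sqrt 3) * (F i (j + 2) (x, t) - F (i + 2) j (x, t) - (F i 1 (x, t) * F 0 j (x, t) + F i 0 (x, t) * F 1 j (x, t)))) (at t within {0..<T})"
    by simp
next
  fix i j
  show "continuous_on (dom_T T) (F i j)"
    unfolding continuous_on_eq_continuous_within
  proof
    fix z assume z: "z \<in> dom_T T"
    define \<eta> where "\<eta> = (T - snd z) / 2"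
    have \<eta>: "\<eta> > 0" "snd z < T - \<eta>" using z by (auto simp: \<eta>_def dom_T_def field_simps)
    have o: "open {z::real \<times> real. snd z < T - \<eta>}" by (intro open_Collect_less continuous_intros)
    have "continuous_on {z. snd z < T - \<eta>} (F i j)"
      by (rule continuous_on_subset[OF F_cont_near[OF \<eta>(1)]]) auto
    then have "isCont (F i j) z" using \<eta>(2) iffD1[OF continuous_on_eq_continuous_at[OF o]] by blast
    then show "continuous (at z within dom_T T) (F i j)" by (rule continuous_at_imp_continuous_at_within)
  qed
next
  fix t x i j assume t: "0 \<le> t" "t < T"
  interpret w: weight "\<lambda>k. cmod (mu 0 k) * exp (- la k * (T - t))" "i + j" by (rule weight_eta) (use t in simp)
  show "F i j (x, t) = (- 1) ^ (i + j) * cnj (F j i (x, t))"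
    unfolding F_def by (rule w.cauchy_sum_cnj[OF W_adm W_cnj]) (use t in auto)
qed

text \<open>By \<open>cauchy_sum_decay\<close> only two oscillatory integrals have to decay, and for
  t \<le> \<tau> the time to T stays at least \<eta>, so \<open>oscillatory_decay\<close> applies to
  both.\<close>

lemma F_decay:
  assumes \<tau>: "0 \<le> \<tau>" "\<tau> < T"
  shows "\<exists>M. \<forall>x t. 0 \<le> t \<and> t \<le> \<tau> \<longrightarrow> (1 + \<bar>x\<bar>) ^ N * cmod (F i j (x, t)) \<le> M"
proof -
  define \<eta> where "\<eta> = T - \<tau>"
  have \<eta>: "\<eta> > 0" using \<tau> by (simp add: \<eta>_def)
  interpret w: weight "\<lambda>k. cmod (mu 0 k) * exp (- la k * \<eta>)" "i + j" by (rule weight_eta[OF \<eta>])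
  have decay: "\<exists>C. \<forall>x t l. 0 \<le> t \<and> t \<le> \<tau> \<longrightarrow> \<bar>l\<bar> \<ge> 2 \<longrightarrow>
    (1 + \<bar>x\<bar>) ^ N * cmod (\<integral>k. W (x, t) k * g (T - t) l k \<partial>lborel) \<le> C" if g: "symb g" for g
  proof -
    obtain A where A: "\<And>y s l. \<eta> \<le> s \<Longrightarrow> s \<le> T \<Longrightarrow> \<bar>l\<bar> \<ge> 2 \<Longrightarrow> \<bar>y\<bar> ^ 0 * cmod (\<integral>k. mu 0 k * (g s l k * wave y s k) \<partial>lborel) \<le> A"
      using oscillatory_decay[OF \<eta> g, of 0 0] by blast
    obtain B where B: "\<And>y s l. \<eta> \<le> s \<Longrightarrow> s \<le> T \<Longrightarrow> \<bar>l\<bar> \<ge> 2 \<Longrightarrow> \<bar>y\<bar> ^ N * cmod (\<integral>k. mu 0 k * (g s l k * wave y s k) \<partial>lborel) \<le> B"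
      using oscillatory_decay[OF \<eta> g, of N 0] by blast
    have "(1 + \<bar>x\<bar>) ^ N * cmod (\<integral>k. W (x, t) k * g (T - t) l k \<partial>lborel) \<le> (1 + \<bar>x0\<bar>) ^ N * (2 ^ N * (A + B))"
      if t: "0 \<le> t \<and> t \<le> \<tau>" and l: "\<bar>l\<bar> \<ge> 2" for x t l
    proof -
      define I where "I = cmod (\<integral>k. mu 0 k * (g (T - t) l k * wave (x - x0) (T - t) k) \<partial>lborel)"
      have I: "cmod (\<integral>k. W (x, t) k * g (T - t) l k \<partial>lborel) = I"
        unfolding I_def W_def by (simp add: mult_ac)
      \<comment> \<open>Integration by parts gives powers of \<bar>x - x0\<bar>; this converts them
        into powers of 1 + \<bar>x\<bar>.\<close>
      have "1 + \<bar>x\<bar> \<le> (1 + \<bar>x0\<bar>) * (1 + \<bar>x - x0\<bar>)"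
      proof -
        have "\<bar>x\<bar> \<le> \<bar>x0\<bar> + \<bar>x - x0\<bar>" by linarith
        moreover have "0 \<le> \<bar>x0\<bar> * \<bar>x - x0\<bar>" by simp
        ultimately have "1 + \<bar>x\<bar> \<le> 1 + \<bar>x0\<bar> + \<bar>x - x0\<bar> + \<bar>x0\<bar> * \<bar>x - x0\<bar>" by linarith
        then show ?thesis by (simp add: distrib_left distrib_right)
      qed
      then have "(1 + \<bar>x\<bar>) ^ N \<le> ((1 + \<bar>x0\<bar>) * (1 + \<bar>x - x0\<bar>)) ^ N" by (intro power_mono) auto
      also have "\<dots> \<le> (1 + \<bar>x0\<bar>) ^ N * (2 ^ N * (1 + \<bar>x - x0\<bar> ^ N))"
        unfolding power_mult_distrib by (intro mult_left_mono one_plus_abs_power_le) auto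
      finally have "(1 + \<bar>x\<bar>) ^ N * I \<le> (1 + \<bar>x0\<bar>) ^ N * (2 ^ N * (1 + \<bar>x - x0\<bar> ^ N)) * I"
        by (intro mult_right_mono) (auto simp: I_def)
      also have "\<dots> = (1 + \<bar>x0\<bar>) ^ N * (2 ^ N * (I + \<bar>x - x0\<bar> ^ N * I))" by (simp add: algebra_simps)
      also have "\<dots> \<le> (1 + \<bar>x0\<bar>) ^ N * (2 ^ N * (A + B))"
        using A[of "T - t" l "x - x0"] B[of "T - t" l "x - x0"] t l
        by (intro mult_left_mono add_mono) (auto simp: I_def \<eta>_def)
      finally show ?thesis unfolding I .
    qed
    then show ?thesis by blast
  qed
  \<comment> \<open>The first symbol belongs to \<open>neumann_dual\<close> at step 1, with spectral
    parameter l, the second to the linear term.\<close>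
  have s: "symb (\<lambda>\<tau> l k. qq k ^ i * (1 / (pp k - qq l)))" "symb (\<lambda>\<tau> l k. qq k ^ i * pp k ^ j)"
    by (intro symb_mult symb_pow symb_qq symb_pp symb_ker)+
  obtain A where
    A: "\<And>x t l. 0 \<le> t \<and> t \<le> \<tau> \<Longrightarrow> \<bar>l\<bar> \<ge> 2 \<Longrightarrow> (1 + \<bar>x\<bar>) ^ N * cmod (\<integral>k. W (x, t) k * (qq k ^ i * (1 / (pp k - qq l))) \<partial>lborel) \<le> A"
    using decay[OF s(1)] by blast
  obtain B where
    B: "\<And>x t l::real. 0 \<le> t \<and> t \<le> \<tau> \<Longrightarrow> \<bar>l\<bar> \<ge> 2 \<Longrightarrow> (1 + \<bar>x\<bar>) ^ N * cmod (\<integral>k. W (x, t) k * (qq k ^ i * pp k ^ j) \<partial>lborel) \<le> B"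
    using decay[OF s(2)] by blast
  have "(1 + \<bar>x\<bar>) ^ N * cmod (F i j (x, t)) \<le> max A B * (1 + 2 * w.mom j)" if t: "0 \<le> t \<and> t \<le> \<tau>" for x t
  proof -
    define h where "h = max A B / (1 + \<bar>x\<bar>) ^ N"
    have p: "(1 + \<bar>x\<bar>) ^ N > 0" by (intro zero_less_power) linarith
    have "cmod (F i j (x, t)) \<le> h * (1 + 2 * w.mom j)"
      unfolding F_def
    proof (rule w.cauchy_sum_decay)
      show "w.adm (W (x, t))" by (rule W_adm[OF \<eta>]) (use t in \<open>simp add: \<eta>_def\<close>)
      show "cmod (neumann_dual (W (x, t)) 1 i l) \<le> h" if "\<bar>l\<bar> \<ge> 2" for l
        using A[OF t that, of x] p by (simp add: h_def pos_le_divide_eq mult.commute[of _ "(1 + \<bar>x\<bar>) ^ N"] le_max_iff_disj)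
      \<comment> \<open>The second symbol does not contain l, so 2 is just some admissible
        value.\<close>
      show "cmod (cauchy_term (W (x, t)) 0 i j) \<le> h"
        using B[OF t, of 2 x] p by (simp add: cauchy_term_def h_def pos_le_divide_eq mult.commute[of _ "(1 + \<bar>x\<bar>) ^ N"] le_max_iff_disj)
    qed auto
    then show ?thesis using p by (simp add: h_def pos_le_divide_eq field_simps)
  qed
  then show ?thesis by blast
qed

lemma F_bounded:
  assumes "i + j \<le> q + 1" shows "\<exists>M. \<forall>x t. 0 \<le> t \<and> t < T \<longrightarrow> cmod (F i j (x, t)) \<le> M"
proof (intro exI allI impI)
  fix x t :: real assume "0 \<le> t \<and> t < T"
  then show "cmod (F i j (x, t)) \<le> 2 * W0.term_const"
    unfolding F_def by (intro W0.cauchy_sum_bound[OF W_adm_0 assms]) auto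
qed

text \<open>With moments up to q + 1 the integrals still converge absolutely at t = T, so
  \<open>F\<close> is its own continuous extension.\<close>

lemma F_extends:
  assumes "i + j \<le> q + 1" shows "continuous_on (UNIV \<times> {0..T}) (F i j)"
  unfolding F_def[abs_def] by (rule W0.cauchy_sum_continuous[OF W_adm_0 W_cont assms]) auto

text \<open>At i + j = q + 2 the leading term may blow up as t approaches T, but the rest of the
  series is bounded by moments of order q + 1, uniformly in time.\<close>

lemma F_top:
  assumes ij: "i + j = q + 2"
  shows "\<exists>M. \<forall>x t. 0 \<le> t \<and> t < T \<longrightarrow> cmod (F i j (x, t) - cauchy_term (W (x, t)) 0 i j) \<le> M"
proof -
  have "cmod (F i j (x, t) - cauchy_term (W (x, t)) 0 i j) \<le> 2 * (4 * (W0.mom (q + 1))\<^sup>2)" if t: "0 \<le> t \<and> t < T" for x t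
    unfolding F_def
  proof (rule W0.cauchy_sum_top)
    show "W0.adm (W (x, t))" using t by (intro W_adm_0) auto
    show "i + j = Suc (q + 1)" using ij by simp
    \<comment> \<open>The index exchange at order q + 2 uses a moment that \<open>W0\<close> does
      not supply. It is an equality at fixed t < T, so the majorant with exponential factor serves;
      the uniform bound still comes from \<open>W0\<close>.\<close>
    interpret w: weight "\<lambda>k. cmod (mu 0 k) * exp (- la k * (T - t))" "Suc (q + 1)" by (rule weight_eta) (use t in simp)
    have "w.adm (W (x, t))" using t by (intro W_adm) auto
    from w.cauchy_term_cnj[OF this W_cnj, of 0 "Suc (q + 1)"]
    show "cmod (cauchy_term (W (x, t)) n 0 (Suc (q + 1))) = cmod (cauchy_term (W (x, t)) n (Suc (q + 1)) 0)" for n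
      by (simp add: norm_mult norm_power)
  qed
  then show ?thesis by blast
qed

lemma lv_eq:
  assumes t: "t < T"
  shows "integrable lborel (\<lambda>k. W (x, t) k * lin e k)"
    and "lv (\<lambda>i j z. cauchy_term (W z) 0 i j) e (x, t) = (\<integral>k. W (x, t) k * lin e k \<partial>lborel)"
proof (induction e)
  case (V i j)
  interpret w: weight "\<lambda>k. cmod (mu 0 k) * exp (- la k * (T - t))" "i + j" by (rule weight_eta) (use t in simp)
  have "w.adm (W (x, t))" by (rule W_adm) (use t in auto)
  from w.cauchy_term_integrable[OF this, of i j 0]
  show "integrable lborel (\<lambda>k. W (x, t) k * lin (V i j) k)" by simp
  show "lv (\<lambda>i j z. cauchy_term (W z) 0 i j) (V i j) (x, t) = (\<integral>k. W (x, t) k * lin (V i j) k \<partial>lborel)" by (simp add: cauchy_term_def)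
next
  case (Add a b)
  { case 1 then show ?case using Add by (simp add: distrib_left) }
  { case 2 then show ?case using Add by (simp add: distrib_left) }
next
  case (Mul a b)
  { case 1 then show ?case by simp }
  { case 2 then show ?case by simp }
next
  case (Scale c a)
  have eq: "W (x, t) k * lin (Scale c a) k = c * (W (x, t) k * lin a k)" for k by simp
  { case 1 show ?case unfolding eq using Scale by (intro integrable_mult_right) }
  { case 2 show ?case unfolding eq using Scale by simp }
qed

end

section \<open>The leading part of the derivatives of order q + 1\<close>

context profile
begin

context
  fixes q1 q2 :: nat
  assumes q12: "q1 + 2 * q2 = q + 1"
begin

text \<open>The symbol of q1 + 1 derivatives in x and q2 in t, the additional one coming from
  \<open>U\<close>.\<close>

definition phi :: "real \<Rightarrow> complex" where
  "phi k = (\<i> * of_real k) ^ Suc q1 * of_real (la k) ^ q2"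

lemma phi_measurable [measurable]: "phi \<in> borel_measurable borel"
  unfolding phi_def[abs_def] by measurable

text \<open>The derivative is homogeneous of weight q + 3, so its heaviest generators have i + j = q
  + 2, the order treated by \<open>F_top\<close>, and all others are bounded.\<close>

lemma dxt_minus_linear_bounded:
  "\<exists>M. \<forall>x t. 0 \<le> t \<and> t < T \<longrightarrow>
    \<bar>dxt T q1 q2 (\<lambda>z. Re (ev U z)) (x, t) - Re (6 * (\<integral>k. W (x, t) k * phi k \<partial>lborel))\<bar> \<le> M"
proof -
  define E where "E = Dw (replicate q1 True @ replicate q2 False) U"
  have "homog (q + 3) E"
    using homog_dxt_U[of q1 q2] q12 by (simp add: E_def numeral_2_eq_2 numeral_3_eq_3)
  then have "\<exists>M. \<forall>x t. 0 \<le> t \<and> t < T \<longrightarrow> cmod (ev E (x, t) - lv (\<lambda>i j z. cauchy_term (W z) 0 i j) E (x, t)) \<le> M"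
    by (rule ev_minus_lv_bounded[rotated 2]) (auto intro: F_bounded F_top)
  then obtain M where M: "\<And>x t. 0 \<le> t \<and> t < T \<Longrightarrow> cmod (ev E (x, t) - lv (\<lambda>i j z. cauchy_term (W z) 0 i j) E (x, t)) \<le> M" by blast
  have "\<bar>dxt T q1 q2 (\<lambda>z. Re (ev U z)) (x, t) - Re (6 * (\<integral>k. W (x, t) k * phi k \<partial>lborel))\<bar> \<le> M"
    if t: "0 \<le> t \<and> t < T" for x t
  proof -
    have "lv (\<lambda>i j z. cauchy_term (W z) 0 i j) E (x, t) = (\<integral>k. 6 * (W (x, t) k * phi k) \<partial>lborel)"
      using lv_eq(2)[where x=x and t=t and e=E] t unfolding E_def lin_dxt_U by (simp add: phi_def mult_ac)
    then have "lv (\<lambda>i j z. cauchy_term (W z) 0 i j) E (x, t) = 6 * (\<integral>k. W (x, t) k * phi k \<partial>lborel)" by simp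
    moreover have "dxt T q1 q2 (\<lambda>z. Re (ev U z)) (x, t) = Re (ev E (x, t))"
      unfolding E_def using t by (intro dxt_U) auto
    ultimately have "dxt T q1 q2 (\<lambda>z. Re (ev U z)) (x, t) - Re (6 * (\<integral>k. W (x, t) k * phi k \<partial>lborel))
      = Re (ev E (x, t) - lv (\<lambda>i j z. cauchy_term (W z) 0 i j) E (x, t))" by (simp only: minus_complex.simps)
    then show ?thesis using order_trans[OF abs_Re_le_cmod M[OF t, of x]] by (simp only:)
  qed
  then show ?thesis by blast
qed

text \<open>Here \<open>q1\<close> is even exactly when \<open>q\<close> is odd, and the factor -
  \<i> in \<open>cst\<close> then makes the product real. The exponent (q1 + 1) div 2 is q1 / 2
  rounded up.\<close>

lemma Re_cst: "Re (cst * \<i> ^ Suc q1) = (- 1) ^ \<sigma> * eps * (- 1) ^ ((q1 + 1) div 2)"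
proof (cases "even q1")
  case True
  then obtain n where n: "q1 = 2 * n" by blast
  then have "odd q" using q12 by presburger
  moreover have i: "\<i> ^ Suc q1 = \<i> * (- 1) ^ n" by (simp add: n power_mult)
  moreover from \<open>odd q\<close> have c: "cst = of_real ((- 1) ^ \<sigma> * eps) * - \<i>" by (simp add: cst_def)
  ultimately have "cst * \<i> ^ Suc q1 = of_real ((- 1) ^ \<sigma> * eps) * (- \<i> * \<i>) * (- 1) ^ n" by (simp only: mult_ac)
  then have "cst * \<i> ^ Suc q1 = of_real ((- 1) ^ \<sigma> * eps * (- 1) ^ n)" by simp
  then show ?thesis by (simp only: Re_complex_of_real) (simp add: n)
next
  case False
  then obtain n where n: "q1 = 2 * n + 1" by (blast elim: oddE)
  then have "even q" using q12 by presburger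
  moreover have "\<i> ^ Suc q1 = (- 1) ^ Suc n"
  proof -
    have "Suc q1 = 2 * Suc n" using n by simp
    then show ?thesis by (simp only: power_mult power2_i)
  qed
  ultimately have "cst * \<i> ^ Suc q1 = of_real ((- 1) ^ \<sigma> * eps * (- 1) ^ Suc n)" by (simp add: cst_def)
  then show ?thesis by (simp only: Re_complex_of_real) (simp add: n)
qed

text \<open>At \<open>x0\<close> the wave is real, and the two halves of the density contribute c
  and its conjugate times the same integral. Together they give 2 Re c, whence 12 = 6 * 2.\<close>

lemma linear_at_x0:
  assumes \<tau>: "0 < T - t" "T - t \<le> 1"
  shows "Re (6 * (\<integral>k. W (x0, t) k * phi k \<partial>lborel)) = (- 1) ^ \<sigma> * (- 1) ^ ((q1 + 1) div 2) * (12 * eps * sing_int q1 q2 (T - t))"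
proof -
  define \<tau> where "\<tau> = T - t"
  define G where "G k = rho bcoef 0 k * (k ^ Suc q1 * la k ^ q2 * exp (- la k * \<tau>))" for k
  have iG: "integrable lborel G"
    unfolding G_def using sing_int_upper[OF q12] assms by (auto simp: \<tau>_def)
  have JG: "(\<integral>k. G k \<partial>lborel) = sing_int q1 q2 \<tau>" unfolding G_def by (simp add: sing_int_def[OF q12])
  define c where "c = cst * \<i> ^ Suc q1"
  have bcoef: "cnj c = cnj cst * \<i> ^ Suc q1 * (- 1) ^ Suc q1"
    unfolding c_def complex_cnj_mult complex_cnj_power complex_cnj_i power_minus[of \<i>] by (simp add: mult_ac)
  have eq: "W (x0, t) k * phi k = c * of_real (G k) + cnj c * of_real (G (- k))" for k
  proof -
    have w: "wave 0 \<tau> k = of_real (exp (- la k * \<tau>))" by (simp add: wave_def exp_of_real[symmetric])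
    have g: "G (- k) = (- 1) ^ Suc q1 * (rho bcoef 0 (- k) * (k ^ Suc q1 * la k ^ q2 * exp (- la k * \<tau>)))"
      unfolding G_def la_minus power_minus[of k] by (simp only: mult_ac)
    have gen: "(a * r0 + b * r1) * E * (I * K * M) = a * I * (r0 * (K * M * E)) + b * I * e * (e * (r1 * (K * M * E)))"
      if "e * e = 1" for a b r0 r1 E I K M e :: complex
    proof -
      have "b * I * e * (e * (r1 * (K * M * E))) = (e * e) * (b * I * (r1 * (K * M * E)))" by (simp only: mult_ac)
      then show ?thesis using that by (simp add: algebra_simps)
    qed
    have s: "(- 1) ^ Suc q1 * (- 1) ^ Suc q1 = (1::complex)" by (simp flip: power_mult_distrib)
    have "W (x0, t) k * phi k = (cst * of_real (rho bcoef 0 k) + cnj cst * of_real (rho bcoef 0 (- k))) *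
       of_real (exp (- la k * \<tau>)) * (\<i> ^ Suc q1 * of_real k ^ Suc q1 * of_real (la k) ^ q2)"
      by (simp only: W_def mu_def phi_def fst_conv snd_conv diff_self \<tau>_def[symmetric] w power_mult_distrib power_0 mult_1_left)
    also have "\<dots> = c * of_real (G k) + cnj c * of_real (G (- k))"
      unfolding bcoef g unfolding G_def c_def of_real_mult of_real_power of_real_minus of_real_1
      by (rule gen[OF s])
    finally show ?thesis .
  qed
  have "(\<integral>k. W (x0, t) k * phi k \<partial>lborel) = (\<integral>k. c * of_real (G k) + cnj c * of_real (G (- k)) \<partial>lborel)"
    by (simp only: eq)
  also have "\<dots> = c * of_real (sing_int q1 q2 \<tau>) + cnj c * of_real (sing_int q1 q2 \<tau>)"
  proof -
    have "has_bochner_integral lborel (\<lambda>k. complex_of_real (G k)) (of_real (sing_int q1 q2 \<tau>))"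
      unfolding JG[symmetric] by (intro has_bochner_integral_of_real has_bochner_integral_integrable iG)
    moreover have "has_bochner_integral lborel (\<lambda>k. complex_of_real (G (- k))) (of_real (sing_int q1 q2 \<tau>))"
      unfolding JG[symmetric] lborel_integral_reflect[of G, symmetric]
      by (intro has_bochner_integral_of_real has_bochner_integral_integrable lborel_integrable_reflect iG)
    ultimately show ?thesis
      by (intro has_bochner_integral_integral_eq has_bochner_integral_add has_bochner_integral_mult_right)
  qed
  finally have "Re (6 * (\<integral>k. W (x0, t) k * phi k \<partial>lborel)) = 12 * Re c * sing_int q1 q2 \<tau>" by simp
  then show ?thesis unfolding c_def Re_cst \<tau>_def by (simp add: mult_ac)
qed

text \<open>One integration by parts, this time with constants uniform up to t = T. The derivative
  of the density has a moment of order q + 2, differentiating \<open>phi\<close> lowers its order by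
  one, and in the term \<tau> la' phi the factor \<tau> is compensated by the exponential.\<close>

lemma linear_decay: "\<exists>C. \<forall>x t. 0 \<le> t \<and> t < T \<longrightarrow> \<bar>x - x0\<bar> * cmod (\<integral>k. W (x, t) k * phi k \<partial>lborel) \<le> C"
proof -
  define la' where "la' k = complex_of_real (rr k) + of_real k * (of_real k * of_real (1 / rr k))" for k
  define phi' where "phi' k = of_nat (Suc q1) * \<i> * (\<i> * of_real k) ^ q1 * of_real (la k) ^ q2
     + (\<i> * of_real k) ^ Suc q1 * (of_nat q2 * of_real (la k) ^ (q2 - 1) * la' k)" for k
  have s_ik: "symb (\<lambda>\<tau> l k. \<i> * of_real k)" by (intro symb_mult symb_const symb_id)
  have "symb (\<lambda>\<tau> l k. of_real k * of_real (rr k))" by (intro symb_mult symb_id symb_rr)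
  then have s_la: "symb (\<lambda>\<tau> l k. of_real (la k))" by (simp add: la_def)
  have s_la': "symb (\<lambda>\<tau> l k. la' k)" unfolding la'_def by (intro symb_add symb_mult symb_rr symb_id symb_inv)
  have s_phi: "symb (\<lambda>\<tau> l k. phi k)" unfolding phi_def by (intro symb_mult symb_pow s_ik s_la)
  have s_phi': "symb (\<lambda>\<tau> l k. phi' k)" unfolding phi'_def
    by (intro symb_add symb_mult symb_pow s_ik s_la s_la' symb_const)
  have d_phi: "(phi has_vector_derivative phi' k) (at k)" if k: "\<bar>k\<bar> > 1" for k
  proof -
    have pw: "((\<lambda>k. f k ^ n) has_vector_derivative f' * (of_nat n * f k ^ (n - 1))) (at k)"
      if "(f has_vector_derivative f') (at k)" for f :: "real \<Rightarrow> complex" and f' n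
    proof -
      have "((\<lambda>z. z ^ n) has_field_derivative of_nat n * f k ^ (n - 1)) (at (f k))"
        by (auto intro!: derivative_eq_intros)
      from field_vector_diff_chain_at[OF that this] show ?thesis by (simp add: o_def)
    qed
    have 1: "((\<lambda>k. \<i> * of_real k) has_vector_derivative \<i> * of_real 1) (at k)"
      by (intro has_vector_derivative_mult_right has_vector_derivative_complex_of_real DERIV_ident)
    have 2: "((\<lambda>k. complex_of_real (la k)) has_vector_derivative of_real (rr k + k * (k * (1 / rr k)))) (at k)"
      by (intro has_vector_derivative_complex_of_real la_deriv k)
    have la'_eq: "complex_of_real (rr k + k * (k * (1 / rr k))) = la' k" by (simp add: la'_def)
    show ?thesis unfolding phi_def[abs_def]
      by (rule has_vector_derivative_eq_rhs, rule has_vector_derivative_mult[OF pw[OF 1] pw[OF 2[unfolded la'_eq]]])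
         (simp add: phi'_def algebra_simps)
  qed
  have la'_le: "cmod (la' k) \<le> 3 * \<bar>k\<bar>" if k: "\<bar>k\<bar> \<ge> 2" for k
  proof -
    have r: "\<bar>rr k\<bar> \<ge> \<bar>k\<bar> / 2"
    proof -
      have "1 * (\<bar>k\<bar> / 2) \<le> sqrt 3 * (\<bar>k\<bar> / 2)" by (intro mult_right_mono) auto
      then show ?thesis using abs_rr_ge[OF k] by simp
    qed
    have "cmod (la' k) \<le> \<bar>rr k\<bar> + \<bar>k\<bar> * (\<bar>k\<bar> * (1 / \<bar>rr k\<bar>))"
      unfolding la'_def by (rule order_trans[OF norm_triangle_ineq]) (simp add: norm_mult norm_divide)
    also have "\<dots> \<le> \<bar>k\<bar> + \<bar>k\<bar> * 2"
    proof (intro add_mono mult_left_mono)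
      show "\<bar>rr k\<bar> \<le> \<bar>k\<bar>" using k by (intro abs_rr_le) auto
      have rpos: "\<bar>rr k\<bar> > 0" using r k by linarith
      have "\<bar>k\<bar> \<le> 2 * \<bar>rr k\<bar>" using r by simp
      then show "\<bar>k\<bar> * (1 / \<bar>rr k\<bar>) \<le> 2" using rpos by (simp add: divide_le_eq)
    qed auto
    finally show ?thesis by simp
  qed
  have la_abs: "cmod (of_real (la k)) \<le> k\<^sup>2" if k: "\<bar>k\<bar> \<ge> 2" for k
    using la_upper[of k] la_nonneg[OF k] k by simp
  have pk: "\<bar>k\<bar> ^ n * (k\<^sup>2) ^ m = \<bar>k\<bar> ^ (n + 2 * m)" for k :: real and n m
    by (simp add: power_add power_mult)
  have phi_le: "cmod (phi k) \<le> \<bar>k\<bar> ^ (q + 2)" if k: "\<bar>k\<bar> \<ge> 2" for k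
  proof -
    have "cmod (phi k) \<le> \<bar>k\<bar> ^ Suc q1 * (k\<^sup>2) ^ q2"
      unfolding phi_def norm_mult norm_power norm_ii using la_abs[OF k] by (intro mult_mono power_mono) auto
    also have "\<dots> = \<bar>k\<bar> ^ (Suc q1 + 2 * q2)" by (rule pk)
    finally show ?thesis using q12 by simp
  qed
  define D where "D = real (Suc q1) + 3 * real q2"
  have phi'_le: "cmod (phi' k) \<le> D * \<bar>k\<bar> ^ (q + 1)" if k: "\<bar>k\<bar> \<ge> 2" for k
  proof -
    have 1: "cmod (of_nat (Suc q1) * \<i> * (\<i> * of_real k) ^ q1 * of_real (la k) ^ q2) \<le> real (Suc q1) * \<bar>k\<bar> ^ (q + 1)"
    proof -
      have "cmod (of_nat (Suc q1) * \<i> * (\<i> * of_real k) ^ q1 * of_real (la k) ^ q2) \<le> real (Suc q1) * (\<bar>k\<bar> ^ q1 * (k\<^sup>2) ^ q2)"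
        unfolding norm_mult norm_power norm_ii norm_of_nat mult_1_right mult_1_left mult.assoc using la_abs[OF k]
        by (intro mult_left_mono mult_mono power_mono) auto
      then show ?thesis unfolding pk q12 .
    qed
    have 2: "cmod ((\<i> * of_real k) ^ Suc q1 * (of_nat q2 * of_real (la k) ^ (q2 - 1) * la' k)) \<le> 3 * real q2 * \<bar>k\<bar> ^ (q + 1)"
    \<comment> \<open>For q2 = 0 the exponent q2 - 1 is truncated to 0, but the factor
      \<open>of_nat q2\<close> makes the term vanish.\<close>
    proof (cases q2)
      case (Suc m)
      have "cmod ((\<i> * of_real k) ^ Suc q1 * (of_nat q2 * of_real (la k) ^ (q2 - 1) * la' k))
        \<le> \<bar>k\<bar> ^ Suc q1 * (real q2 * (k\<^sup>2) ^ m * (3 * \<bar>k\<bar>))"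
        unfolding norm_mult norm_power norm_ii norm_of_nat Suc diff_Suc_1 using la_abs[OF k] la'_le[OF k]
        by (intro mult_mono power_mono) auto
      also have "\<dots> = 3 * real q2 * (\<bar>k\<bar> ^ (q1 + 2) * (k\<^sup>2) ^ m)" by (simp add: mult_ac)
      also have "\<dots> = 3 * real q2 * \<bar>k\<bar> ^ (q1 + 2 + 2 * m)" unfolding pk ..
      also have "q1 + 2 + 2 * m = q + 1" using q12 Suc by simp
      finally show ?thesis .
    qed simp
    show ?thesis unfolding phi'_def D_def distrib_right by (rule norm_triangle_mono[OF 1 2])
  qed
  define g2 where "g2 \<tau> k = phi' k + (- 1) * (of_real \<tau> * la' k) * phi k" for \<tau> k
  have s_g2: "symb (\<lambda>\<tau> l k. g2 \<tau> k)" unfolding g2_def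
    by (intro symb_add symb_mult symb_const symb_tau s_phi s_phi' s_la')
  have b2: "cmod (mu 0 k * (g2 \<tau> k * wave y \<tau> k)) \<le> (D + 6) * (\<bar>k\<bar> ^ (q + 1) * cmod (mu 0 k))" if \<tau>: "\<tau> > 0" for \<tau> k y
  proof (cases "\<bar>k\<bar> \<ge> 2")
    case k: True
    have la: "la k \<ge> 0" "k\<^sup>2 / 2 \<le> la k" using la_nonneg[OF k] la_lower[OF k] .
    have e1: "exp (- la k * \<tau>) \<le> 1" using la \<tau> by simp
    \<comment> \<open>The factor \<tau> la k is the price of differentiating the wave; it is
      absorbed by the exponential without any lower bound on \<tau>.\<close>
    have e2: "\<tau> * la k * exp (- la k * \<tau>) \<le> 1"
    proof -
      have "la k * \<tau> \<le> exp (la k * \<tau>)" using exp_ge_add_one_self[of "la k * \<tau>"] by linarith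
      then have "la k * \<tau> * exp (- (la k * \<tau>)) \<le> exp (la k * \<tau>) * exp (- (la k * \<tau>))" by (intro mult_right_mono) auto
      then show ?thesis unfolding exp_minus_inverse by (simp add: mult_ac)
    qed
    have e3: "\<bar>k\<bar> * cmod (la' k) \<le> 6 * la k"
    proof -
      have "\<bar>k\<bar> * cmod (la' k) \<le> \<bar>k\<bar> * (3 * \<bar>k\<bar>)" by (intro mult_left_mono la'_le k) auto
      also have "\<dots> = 6 * (k\<^sup>2 / 2)" by (simp add: power2_eq_square)
      finally show ?thesis using la by linarith
    qed
    have "cmod (g2 \<tau> k * wave y \<tau> k) \<le> D * \<bar>k\<bar> ^ (q + 1) * 1 + 6 * \<bar>k\<bar> ^ (q + 1)"
    proof -
      have "g2 \<tau> k * wave y \<tau> k = phi' k * wave y \<tau> k + (- 1) * (of_real \<tau> * la' k * phi k * wave y \<tau> k)"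
        by (simp add: g2_def algebra_simps)
      moreover have "cmod (phi' k * wave y \<tau> k) \<le> D * \<bar>k\<bar> ^ (q + 1) * 1"
        unfolding norm_mult norm_wave using e1 phi'_le[OF k] by (intro mult_mono) (auto simp: D_def)
      moreover have "cmod ((- 1) * (of_real \<tau> * la' k * phi k * wave y \<tau> k)) \<le> 6 * \<bar>k\<bar> ^ (q + 1)"
      proof -
        have "cmod ((- 1) * (of_real \<tau> * la' k * phi k * wave y \<tau> k)) = \<tau> * cmod (la' k) * cmod (phi k) * exp (- la k * \<tau>)"
          using \<tau> by (simp add: norm_mult norm_wave)
        also have "\<dots> \<le> \<tau> * cmod (la' k) * \<bar>k\<bar> ^ (q + 2) * exp (- la k * \<tau>)"
          using \<tau> by (intro mult_right_mono mult_left_mono phi_le k) auto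
        also have "\<dots> = \<tau> * (\<bar>k\<bar> * cmod (la' k)) * (\<bar>k\<bar> ^ (q + 1) * exp (- la k * \<tau>))" by (simp add: mult_ac)
        also have "\<dots> \<le> \<tau> * (6 * la k) * (\<bar>k\<bar> ^ (q + 1) * exp (- la k * \<tau>))"
          using \<tau> by (intro mult_right_mono mult_left_mono e3) auto
        also have "\<dots> = 6 * \<bar>k\<bar> ^ (q + 1) * (\<tau> * la k * exp (- la k * \<tau>))" by (simp only: mult_ac)
        also have "\<dots> \<le> 6 * \<bar>k\<bar> ^ (q + 1) * 1" by (intro mult_left_mono e2) auto
        finally show ?thesis by simp
      qed
      ultimately show ?thesis using norm_triangle_mono by metis
    qed
    then have "cmod (mu 0 k) * cmod (g2 \<tau> k * wave y \<tau> k) \<le> cmod (mu 0 k) * ((D + 6) * \<bar>k\<bar> ^ (q + 1))"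
      by (intro mult_left_mono) (simp_all only: distrib_right mult_1_right norm_ge_zero)
    then show ?thesis by (simp add: norm_mult mult_ac)
  next
    case False then show ?thesis by (simp add: mu_supp)
  qed
  have b1: "cmod (mu (Suc 0) k * (phi k * wave y \<tau> k)) \<le> \<bar>k\<bar> ^ (q + 1 + 1) * cmod (mu 1 k)" if \<tau>: "\<tau> > 0" for \<tau> k y
  proof (cases "\<bar>k\<bar> \<ge> 2")
    case k: True
    have e1: "exp (- la k * \<tau>) \<le> 1" using la_nonneg[OF k] \<tau> by simp
    have "cmod (phi k) * cmod (wave y \<tau> k) \<le> \<bar>k\<bar> ^ (q + 2) * 1"
      unfolding norm_wave by (intro mult_mono phi_le e1 k) auto
    then have "cmod (mu (Suc 0) k) * (cmod (phi k) * cmod (wave y \<tau> k)) \<le> cmod (mu (Suc 0) k) * (\<bar>k\<bar> ^ (q + 2) * 1)"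
      by (intro mult_left_mono) auto
    then show ?thesis by (simp add: norm_mult mult_ac)
  next
    case False then show ?thesis by (simp add: mu_supp)
  qed
  define C1 where "C1 = (\<integral>k. \<bar>k\<bar> ^ (q + 1 + 1) * cmod (mu 1 k) \<partial>lborel)"
  define C2 where "C2 = (\<integral>k. (D + 6) * (\<bar>k\<bar> ^ (q + 1) * cmod (mu 0 k)) \<partial>lborel)"
  have "\<bar>x - x0\<bar> * cmod (\<integral>k. W (x, t) k * phi k \<partial>lborel) \<le> C1 + C2" if t: "0 \<le> t \<and> t < T" for x t
  proof -
    define \<tau> where "\<tau> = T - t"
    define y where "y = x - x0"
    have \<tau>: "\<tau> > 0" "\<tau> \<le> T" using t by (auto simp: \<tau>_def)
    \<comment> \<open>None of the symbols used here depends on l; 2 is an admissible value.\<close>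
    have l: "\<bar>2::real\<bar> \<ge> 2" by simp
    have "\<bar>y\<bar> * cmod (\<integral>k. mu 0 k * (phi k * wave y \<tau> k) \<partial>lborel)
      \<le> cmod (\<integral>k. mu (Suc 0) k * (phi k * wave y \<tau> k) \<partial>lborel) + cmod (\<integral>k. mu 0 k * (g2 \<tau> k * wave y \<tau> k) \<partial>lborel)"
      by (rule oscillatory_step[OF s_phi s_phi' d_phi s_g2 _ \<tau> l]) (auto simp: g2_def la'_def)
    also have "cmod (\<integral>k. mu (Suc 0) k * (phi k * wave y \<tau> k) \<partial>lborel) \<le> C1"
      unfolding C1_def by (rule Bochner_Integration.integral_norm_bound_integral[OF amplitude_integrable[OF s_phi \<tau> l] mu_integrable b1[OF \<tau>(1)]])
    also have "cmod (\<integral>k. mu 0 k * (g2 \<tau> k * wave y \<tau> k) \<partial>lborel) \<le> C2"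
      unfolding C2_def
    proof (rule Bochner_Integration.integral_norm_bound_integral[OF amplitude_integrable[OF s_g2 \<tau> l] _ b2[OF \<tau>(1)]])
      show "integrable lborel (\<lambda>k. (D + 6) * (\<bar>k\<bar> ^ (q + 1) * cmod (mu 0 k)))"
        using mu_integrable[of 0] by (intro integrable_mult_right) simp
    qed
    finally have "\<bar>y\<bar> * cmod (\<integral>k. mu 0 k * (phi k * wave y \<tau> k) \<partial>lborel) \<le> C1 + C2" by simp
    then show ?thesis by (simp add: W_def y_def \<tau>_def mult_ac)
  qed
  then show ?thesis by blast
qed

end

end

section \<open>Regularity, spatial bound and blow-up rate of the solution\<close>

context profile
begin

abbreviation sol :: "real \<times> real \<Rightarrow> real" where "sol \<equiv> \<lambda>z. Re (ev U z)"

text \<open>The weight 2 + q1 + 2 * q2 is at most q + 2, so every generator that occurs has i + j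
  \<le> q + 1, for which bounds and extensions hold up to T.\<close>

lemma regular_derivatives:
  assumes "q1 + 2 * q2 \<le> q"
  shows "\<exists>M. \<forall>x t. 0 \<le> t \<and> t < T \<longrightarrow> \<bar>dxt T q1 q2 sol (x, t)\<bar> \<le> M"
    and "\<exists>g. continuous_on (UNIV \<times> {0..T}) g \<and> (\<forall>x t. 0 \<le> t \<and> t < T \<longrightarrow> g (x, t) = dxt T q1 q2 sol (x, t))"
proof -
  define E where "E = Dw (replicate q1 True @ replicate q2 False) U"
  have hE: "homog (2 + q1 + 2 * q2) E" unfolding E_def by (rule homog_dxt_U)
  have dE: "dxt T q1 q2 sol (x, t) = Re (ev E (x, t))" if "0 \<le> t \<and> t < T" for x t
    unfolding E_def using that by (intro dxt_U) auto
  obtain M where "\<And>x t. 0 \<le> t \<and> t < T \<Longrightarrow> cmod (ev E (x, t)) \<le> M"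
    using ev_bounded[OF F_bounded hE] assms by auto
  then show "\<exists>M. \<forall>x t. 0 \<le> t \<and> t < T \<longrightarrow> \<bar>dxt T q1 q2 sol (x, t)\<bar> \<le> M"
    using dE by (metis abs_Re_le_cmod order_trans)
  have "\<exists>g. continuous_on (UNIV \<times> {0..T}) g \<and> (\<forall>x t. 0 \<le> t \<and> t < T \<longrightarrow> g (x, t) = ev E (x, t))"
    by (rule ev_extends[OF _ hE]) (use F_extends assms in force)
  then obtain g where g: "continuous_on (UNIV \<times> {0..T}) g" "\<And>x t. 0 \<le> t \<and> t < T \<Longrightarrow> g (x, t) = ev E (x, t)" by blast
  have "continuous_on (UNIV \<times> {0..T}) (\<lambda>z. Re (g z))" by (intro continuous_intros g)
  then show "\<exists>g. continuous_on (UNIV \<times> {0..T}) g \<and> (\<forall>x t. 0 \<le> t \<and> t < T \<longrightarrow> g (x, t) = dxt T q1 q2 sol (x, t))"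
    using g(2) dE by (intro exI[of _ "\<lambda>z. Re (g z)"]) auto
qed

text \<open>The linear part decays like 1 / \<bar>x - x0\<bar>. The remainder is merely bounded, and
  the numerator 1 + \<bar>x\<bar> accommodates it, since \<bar>x - x0\<bar> is at most (1 +
  \<bar>x0\<bar>) (1 + \<bar>x\<bar>).\<close>

lemma singular_bound:
  assumes "q1 + 2 * q2 = q + 1"
  shows "\<exists>C>0. \<forall>x t. x \<noteq> x0 \<and> 0 \<le> t \<and> t < T \<longrightarrow> \<bar>dxt T q1 q2 sol (x, t)\<bar> \<le> C * (1 + \<bar>x\<bar>) / \<bar>x - x0\<bar>"
proof -
  obtain M where M: "\<And>x t. 0 \<le> t \<and> t < T \<Longrightarrow>
    \<bar>dxt T q1 q2 sol (x, t) - Re (6 * (\<integral>k. W (x, t) k * phi q1 q2 k \<partial>lborel))\<bar> \<le> M"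
    using dxt_minus_linear_bounded[OF assms] by blast
  obtain D where D: "\<And>x t. 0 \<le> t \<and> t < T \<Longrightarrow> \<bar>x - x0\<bar> * cmod (\<integral>k. W (x, t) k * phi q1 q2 k \<partial>lborel) \<le> D"
    using linear_decay[OF assms] by blast
  define C where "C = \<bar>M\<bar> * (1 + \<bar>x0\<bar>) + 6 * \<bar>D\<bar> + 1"
  have "\<bar>dxt T q1 q2 sol (x, t)\<bar> \<le> C * (1 + \<bar>x\<bar>) / \<bar>x - x0\<bar>" if x: "x \<noteq> x0" and t: "0 \<le> t \<and> t < T" for x t
  proof -
    define I where "I = (\<integral>k. W (x, t) k * phi q1 q2 k \<partial>lborel)"
    have "\<bar>Re (6 * I)\<bar> \<le> 6 * cmod I" using abs_Re_le_cmod[of "6 * I"] by (simp add: norm_mult)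
    then have "\<bar>dxt T q1 q2 sol (x, t)\<bar> \<le> \<bar>M\<bar> + 6 * cmod I" using M[OF t, of x] unfolding I_def by linarith
    then have "\<bar>dxt T q1 q2 sol (x, t)\<bar> * \<bar>x - x0\<bar> \<le> (\<bar>M\<bar> + 6 * cmod I) * \<bar>x - x0\<bar>" by (intro mult_right_mono) auto
    also have "\<dots> = \<bar>M\<bar> * \<bar>x - x0\<bar> + 6 * (\<bar>x - x0\<bar> * cmod I)" by (simp add: algebra_simps)
    also have "\<dots> \<le> \<bar>M\<bar> * ((1 + \<bar>x0\<bar>) * (1 + \<bar>x\<bar>)) + 6 * \<bar>D\<bar> * (1 + \<bar>x\<bar>)"
    proof (rule add_mono)
      have "\<bar>x - x0\<bar> \<le> \<bar>x\<bar> + \<bar>x0\<bar>" by linarith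
      also have "\<dots> \<le> (1 + \<bar>x0\<bar>) * (1 + \<bar>x\<bar>)" by (simp add: distrib_left distrib_right)
      finally show "\<bar>M\<bar> * \<bar>x - x0\<bar> \<le> \<bar>M\<bar> * ((1 + \<bar>x0\<bar>) * (1 + \<bar>x\<bar>))" by (intro mult_left_mono) auto
      have "\<bar>x - x0\<bar> * cmod I \<le> \<bar>D\<bar> * 1" using D[OF t, of x] unfolding I_def by linarith
      also have "\<dots> \<le> \<bar>D\<bar> * (1 + \<bar>x\<bar>)" by (intro mult_left_mono) auto
      finally show "6 * (\<bar>x - x0\<bar> * cmod I) \<le> 6 * \<bar>D\<bar> * (1 + \<bar>x\<bar>)" by simp
    qed
    also have "\<dots> \<le> C * (1 + \<bar>x\<bar>)" by (simp add: C_def distrib_right mult.assoc)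
    finally show ?thesis using x by (simp add: le_divide_eq)
  qed
  moreover have "C > 0" by (auto simp: C_def intro!: add_nonneg_pos)
  ultimately show ?thesis by blast
qed

text \<open>Close to T the linear part is comparable to a function tending to infinity, so the
  bounded remainder changes only the constants.\<close>

lemma singular_asymptotics:
  assumes q12: "q1 + 2 * q2 = q + 1" and \<sigma>: "\<sigma> \<le> 1"
  shows "asymp_at T (\<lambda>t. (-1) ^ ((q1 + 1) div 2) * dxt T q1 q2 sol (x0,t))
     (\<lambda>t. LOG (1 / (T - t)) rs as \<sigma> / (T - t) powr \<delta>)"
proof -
  define G where "G \<tau> = L (1 / \<tau>) / \<tau> powr \<delta>" for \<tau>
  define f where "f t = (-1) ^ ((q1 + 1) div 2) * dxt T q1 q2 sol (x0,t)" for t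
  obtain M where M: "\<And>x t. 0 \<le> t \<and> t < T \<Longrightarrow>
    \<bar>dxt T q1 q2 sol (x, t) - Re (6 * (\<integral>k. W (x, t) k * phi q1 q2 k \<partial>lborel))\<bar> \<le> M"
    using dxt_minus_linear_bounded[OF q12] by blast
  obtain c1 where c1: "c1 > 0" "\<And>\<tau>. 0 < \<tau> \<Longrightarrow> \<tau> \<le> 1/4 \<Longrightarrow> c1 * G \<tau> \<le> sing_int q1 q2 \<tau>"
    using sing_int_lower[OF q12] unfolding G_def by blast
  obtain c2 where c2: "c2 > 0" "\<And>\<tau>. 0 < \<tau> \<Longrightarrow> \<tau> \<le> 1 \<Longrightarrow> sing_int q1 q2 \<tau> \<le> c2 * G \<tau>"
    using sing_int_upper[OF q12] unfolding G_def by blast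
  obtain S where S: "\<And>s. s \<ge> S \<Longrightarrow> (\<Prod>j<length rs. ((ln ^^ (rs ! j)) s) powr (as ! j)) = L s"
    using eventually_log_weight[of rs as] rs as unfolding eventually_at_top_linorder by blast
  \<comment> \<open>Half of the lower constant 12 * eps * c1 of the linear part; the other half
    absorbs the remainder M.\<close>
  define a where "a = 6 * eps * c1"
  define b where "b = 12 * eps * c2 + a"
  have a: "a > 0" using eps_pos c1 by (simp add: a_def)
  have b: "b > 0" using eps_pos c2 a by (simp add: b_def add_pos_pos)
  define r where "r = a / (\<bar>M\<bar> + 1)"
  have r: "r > 0" using a by (simp add: r_def add_nonneg_pos)
  \<comment> \<open>The four entries ensure, in order: a starting time that stays positive, the
    range of the lower bound for \<open>sing_int\<close>, a * G \<ge> \<bar>M\<bar> + 1, and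
    logarithms past their truncation.\<close>
  define h where "h = min (T / 2) (min (1/4) (min (r powr (1 / \<delta>)) (1 / max 1 S)))"
  have h: "h > 0" using T_pos r by (simp add: h_def)
  have main: "a * G (T - t) \<le> (- 1) ^ \<sigma> * f t \<and> (- 1) ^ \<sigma> * f t \<le> b * G (T - t)
      \<and> LOG (1 / (T - t)) rs as \<sigma> / (T - t) powr \<delta> = (- 1) ^ \<sigma> * G (T - t)"
    if t: "T - h \<le> t" "t < T" for t
  proof -
    define \<tau> where "\<tau> = T - t"
    have \<tau>: "0 < \<tau>" "\<tau> \<le> 1/4" "\<tau> \<le> r powr (1 / \<delta>)" "\<tau> \<le> 1 / max 1 S" "\<tau> \<le> T / 2"
      using t by (auto simp: \<tau>_def h_def)
    have t0: "0 \<le> t \<and> t < T" using \<tau> T_pos unfolding \<tau>_def by linarith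
    have "max 1 S \<le> 1 / \<tau>"
    proof -
      have "\<tau> * max 1 S \<le> 1" using \<tau>(4) by (simp add: le_divide_eq)
      then show ?thesis using \<tau>(1) by (simp add: le_divide_eq mult.commute)
    qed
    then have "S \<le> 1 / \<tau>" by simp
    from S[OF this] have lg: "LOG (1 / \<tau>) rs as \<sigma> = (- 1) ^ \<sigma> * L (1 / \<tau>)"
      by (simp add: LOG_def iter_log_def)
    have Gge: "\<bar>M\<bar> + 1 \<le> a * G \<tau>"
    proof -
      have "\<tau> powr \<delta> \<le> (r powr (1 / \<delta>)) powr \<delta>" using \<tau> \<delta> by (intro powr_mono2) auto
      also have "\<dots> = r" using \<delta> r by (simp add: powr_powr)
      finally have "(\<bar>M\<bar> + 1) * \<tau> powr \<delta> \<le> a" by (simp add: r_def le_divide_eq mult.commute add_nonneg_pos)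
      then have "\<bar>M\<bar> + 1 \<le> a / \<tau> powr \<delta>" using \<tau>(1) by (simp add: le_divide_eq)
      also have "\<dots> \<le> a * G \<tau>" unfolding G_def using a L_ge_1[of "1 / \<tau>"] by (simp add: divide_right_mono)
      finally show ?thesis .
    qed
    define K where "K = 12 * eps * sing_int q1 q2 \<tau>"
    have "12 * eps * (c1 * G \<tau>) \<le> K"
      unfolding K_def using eps_pos \<tau> by (intro mult_left_mono c1(2)) auto
    then have K1: "2 * (a * G \<tau>) \<le> K" by (simp add: a_def mult_ac)
    have K2: "K \<le> 12 * eps * (c2 * G \<tau>)"
      unfolding K_def using eps_pos \<tau> by (intro mult_left_mono c2(2)) auto
    have lin: "Re (6 * (\<integral>k. W (x0, t) k * phi q1 q2 k \<partial>lborel)) = (- 1) ^ \<sigma> * (- 1) ^ ((q1 + 1) div 2) * K"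
      unfolding K_def \<tau>_def using \<tau> by (intro linear_at_x0[OF q12]) (auto simp: \<tau>_def)
    define s where "s = (- 1 :: real) ^ \<sigma>"
    define v where "v = (- 1 :: real) ^ ((q1 + 1) div 2)"
    have sv: "s * s = 1" "v * v = 1" "\<bar>s\<bar> = 1" "\<bar>v\<bar> = 1"
      by (simp_all add: s_def v_def power_abs flip: power_mult_distrib)
    have "s * f t - K = s * v * (dxt T q1 q2 sol (x0, t) - s * v * K)"
    proof -
      have "s * v * (s * v * K) = (s * s) * (v * v) * K" by (simp only: mult_ac)
      then have e: "s * v * (s * v * K) = K" unfolding sv by simp
      show ?thesis unfolding right_diff_distrib e by (simp add: f_def v_def)
    qed
    then have "\<bar>s * f t - K\<bar> = \<bar>dxt T q1 q2 sol (x0, t) - s * v * K\<bar>" by (simp add: abs_mult sv)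
    also have "\<dots> \<le> M" using M[OF t0, of x0] unfolding lin s_def v_def .
    finally have d: "\<bar>s * f t - K\<bar> \<le> M" .
    have "a * G \<tau> \<le> s * f t" using d K1 Gge by linarith
    moreover have "s * f t \<le> b * G \<tau>"
    proof -
      have "s * f t \<le> 12 * eps * (c2 * G \<tau>) + a * G \<tau>" using d K2 Gge by linarith
      then show ?thesis by (simp add: b_def algebra_simps)
    qed
    ultimately show ?thesis using lg unfolding s_def \<tau>_def G_def by simp
  qed
  have T0: "0 < T - h" "T - h < T" using h T_pos by (auto simp: h_def min_def)
  show ?thesis
    unfolding asymp_at_def f_def[symmetric]
  proof (cases "\<sigma> = 0")
    case True
    have "a * (LOG (1 / (T - t)) rs as \<sigma> / (T - t) powr \<delta>) \<le> f t \<and> f t \<le> b * (LOG (1 / (T - t)) rs as \<sigma> / (T - t) powr \<delta>)"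
      if "T - h \<le> t \<and> t < T" for t
      using main[of t] that True by simp
    then show "\<exists>T0 c1 c2. 0 < T0 \<and> T0 < T \<and> 0 < c1 \<and> 0 < c2 \<and> (\<forall>t. T0 \<le> t \<and> t < T \<longrightarrow>
      c1 * (LOG (1 / (T - t)) rs as \<sigma> / (T - t) powr \<delta>) \<le> f t \<and> f t \<le> c2 * (LOG (1 / (T - t)) rs as \<sigma> / (T - t) powr \<delta>))"
      using T0 a b by blast
  next
    case False
    then have s1: "\<sigma> = 1" using \<sigma> by simp
    \<comment> \<open>Here \<open>LOG\<close> is negative, so multiplying by -1 reverses the
      inequalities and the constants exchange their roles.\<close>
    have "b * (LOG (1 / (T - t)) rs as \<sigma> / (T - t) powr \<delta>) \<le> f t \<and> f t \<le> a * (LOG (1 / (T - t)) rs as \<sigma> / (T - t) powr \<delta>)"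
      if "T - h \<le> t \<and> t < T" for t
    proof -
      have m: "a * G (T - t) \<le> - f t" "- f t \<le> b * G (T - t)"
        "LOG (1 / (T - t)) rs as \<sigma> / (T - t) powr \<delta> = - G (T - t)"
        using main[of t] that unfolding s1 by simp_all
      show ?thesis unfolding m(3) using m(1,2) by simp
    qed
    then show "\<exists>T0 c1 c2. 0 < T0 \<and> T0 < T \<and> 0 < c1 \<and> 0 < c2 \<and> (\<forall>t. T0 \<le> t \<and> t < T \<longrightarrow>
      c1 * (LOG (1 / (T - t)) rs as \<sigma> / (T - t) powr \<delta>) \<le> f t \<and> f t \<le> c2 * (LOG (1 / (T - t)) rs as \<sigma> / (T - t) powr \<delta>))"
      using T0 a b by blast
  qed
qed

end

theorem theorem2p3:
  fixes q p :: nat and rs :: "nat list" and as :: "real list" and \<sigma> :: nat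
    and T x0 \<delta> :: real
  assumes "length rs = p" and "length as = p"
    and "sorted_wrt (<) rs" and "\<forall>r\<in>set rs. r > 0"
    and "\<forall>a\<in>set as. a \<ge> 0"
    and "\<sigma> \<le> 1" and "T > 0" and "0 < \<delta>" and "\<delta> < 1/2"
  shows "\<exists>u. schwartz_boussinesq T u \<and>
     (\<forall>q1 q2. q1 + 2 * q2 \<le> q \<longrightarrow>
        (\<exists>M. \<forall>x t. 0 \<le> t \<and> t < T \<longrightarrow> \<bar>dxt T q1 q2 u (x,t)\<bar> \<le> M) \<and>
        (\<exists>g. continuous_on (UNIV \<times> {0..T}) g \<and>
             (\<forall>x t. 0 \<le> t \<and> t < T \<longrightarrow> g (x,t) = dxt T q1 q2 u (x,t)))) \<and>
     (\<forall>q1 q2. q1 + 2 * q2 = q + 1 \<longrightarrow>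
        asymp_at T (\<lambda>t. (-1) ^ ((q1 + 1) div 2) * dxt T q1 q2 u (x0,t))
                   (\<lambda>t. LOG (1 / (T - t)) rs as \<sigma> / (T - t) powr \<delta>) \<and>
        (\<exists>C>0. \<forall>x t. x \<noteq> x0 \<and> 0 \<le> t \<and> t < T \<longrightarrow>
           \<bar>dxt T q1 q2 u (x,t)\<bar> \<le> C * (1 + \<bar>x\<bar>) / \<bar>x - x0\<bar>))"
proof -
  interpret profile rs as \<delta> q T x0 \<sigma>
  proof
    show "1 \<le> rs ! j" if "j < length rs" for j
    proof -
      have "rs ! j > 0" using assms(4) nth_mem[OF that] by blast
      then show ?thesis by simp
    qed
    show "0 \<le> as ! j" if "j < length rs" for j
      using assms(1,2,5) that nth_mem[of j as] by auto
  qed (use assms in auto)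
  have "schwartz_boussinesq T sol" by (rule schwartz_U[OF F_decay])
  moreover have "\<forall>q1 q2. q1 + 2 * q2 \<le> q \<longrightarrow>
        (\<exists>M. \<forall>x t. 0 \<le> t \<and> t < T \<longrightarrow> \<bar>dxt T q1 q2 sol (x,t)\<bar> \<le> M) \<and>
        (\<exists>g. continuous_on (UNIV \<times> {0..T}) g \<and>
             (\<forall>x t. 0 \<le> t \<and> t < T \<longrightarrow> g (x,t) = dxt T q1 q2 sol (x,t)))"
    using regular_derivatives by blast
  moreover have "\<forall>q1 q2. q1 + 2 * q2 = q + 1 \<longrightarrow>
        asymp_at T (\<lambda>t. (-1) ^ ((q1 + 1) div 2) * dxt T q1 q2 sol (x0,t))
                   (\<lambda>t. LOG (1 / (T - t)) rs as \<sigma> / (T - t) powr \<delta>) \<and>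
        (\<exists>C>0. \<forall>x t. x \<noteq> x0 \<and> 0 \<le> t \<and> t < T \<longrightarrow>
           \<bar>dxt T q1 q2 sol (x,t)\<bar> \<le> C * (1 + \<bar>x\<bar>) / \<bar>x - x0\<bar>)"
    using singular_bound singular_asymptotics[OF _ assms(6)] by blast
  ultimately show ?thesis by blast
qed

end
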